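(* Let $P(x)=\prod_{i=1}^\infty \frac{1}{1-x^i}$, and let $x_0$ be the unique real solution with $0<x_0<1$ of $xP(x)=1$ (numerically $x_0=0.4196\ldots$). Let $a_n$ denote the number of isomorphism classes of linear trees on $n$ vertices. Then, as $n\to\infty$, $$a_n \sim \frac12 \left(P(x_0) - \frac{1}{1-x_0}\right)^2 \frac{x_0}{P(x_0) + x_0P'(x_0) } \left( \frac{1}{x_0}\right)^n \simeq 0.7560\, (2.3822)^n .$$
   Context: All graphs are finite, simple and undirected. A high degree vertex (HDV) of a graph is a vertex of degree at least $3$. A tree is called linear if all of its HDVs lie on a single induced path. Trees are counted up to graph isomorphism (unlabeled).
   Formalization: The printed decimals 0.7560 (2.3822)^n are wrong for the displayed formula (x_0=0.4196... gives 1/x_0≈2.3832 and the constant is ≈0.0145); they are replaced by 0.0145 and 2.3832, each within 0.00005; the asymptotic formula itself is unchanged. *)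

theory Defs
  imports "HOL-Analysis.Analysis" "HOL-Library.Landau_Symbols"
begin

text \<open>
  An undirected graph is given by its vertex set \<open>V\<close> and its set \<open>E\<close> of edges, where an edge is a
  two-element set of vertices.
\<close>

definition simple_graph :: "'a set \<Rightarrow> 'a set set \<Rightarrow> bool" where
  "simple_graph V E \<longleftrightarrow> finite V \<and> (\<forall>e\<in>E. e \<subseteq> V \<and> card e = 2)"

definition graph_degree :: "'a set set \<Rightarrow> 'a \<Rightarrow> nat" where
  "graph_degree E v = card {e \<in> E. v \<in> e}"

definition high_degree_vertices :: "'a set \<Rightarrow> 'a set set \<Rightarrow> 'a set" where
  "high_degree_vertices V E = {v \<in> V. graph_degree E v \<ge> 3}"

text \<open>A path is a nonempty list of distinct vertices; a single vertex is a path.\<close>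

definition graph_path :: "'a set \<Rightarrow> 'a set set \<Rightarrow> 'a list \<Rightarrow> bool" where
  "graph_path V E p \<longleftrightarrow> p \<noteq> [] \<and> distinct p \<and> set p \<subseteq> V \<and>
     (\<forall>i. Suc i < length p \<longrightarrow> {p ! i, p ! Suc i} \<in> E)"

definition induced_path :: "'a set \<Rightarrow> 'a set set \<Rightarrow> 'a list \<Rightarrow> bool" where
  "induced_path V E p \<longleftrightarrow> graph_path V E p \<and>
     (\<forall>i<length p. \<forall>j<length p. {p ! i, p ! j} \<in> E \<longrightarrow> j = Suc i \<or> i = Suc j)"

definition graph_cycle :: "'a set \<Rightarrow> 'a set set \<Rightarrow> 'a list \<Rightarrow> bool" where
  "graph_cycle V E p \<longleftrightarrow> graph_path V E p \<and> length p \<ge> 3 \<and> {last p, hd p} \<in> E"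

definition graph_connected :: "'a set \<Rightarrow> 'a set set \<Rightarrow> bool" where
  "graph_connected V E \<longleftrightarrow> V \<noteq> {} \<and>
     (\<forall>u\<in>V. \<forall>v\<in>V. \<exists>p. graph_path V E p \<and> hd p = u \<and> last p = v)"

definition tree :: "'a set \<Rightarrow> 'a set set \<Rightarrow> bool" where
  "tree V E \<longleftrightarrow> simple_graph V E \<and> graph_connected V E \<and> (\<nexists>p. graph_cycle V E p)"

definition linear_tree :: "'a set \<Rightarrow> 'a set set \<Rightarrow> bool" where
  "linear_tree V E \<longleftrightarrow> tree V E \<and>
     (\<exists>p. induced_path V E p \<and> high_degree_vertices V E \<subseteq> set p)"

definition graph_isomorphic :: "'a set \<Rightarrow> 'a set set \<Rightarrow> 'b set \<Rightarrow> 'b set set \<Rightarrow> bool" where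
  "graph_isomorphic V E W F \<longleftrightarrow>
     (\<exists>f. bij_betw f V W \<and> (\<forall>u\<in>V. \<forall>v\<in>V. {u, v} \<in> E \<longleftrightarrow> {f u, f v} \<in> F))"

text \<open>
  Every graph on \<open>n\<close> vertices is isomorphic to one with vertex set \<open>{..<n}\<close>, so the isomorphism
  classes of linear trees on \<open>n\<close> vertices are counted on that vertex set.
\<close>

definition labelled_linear_trees :: "nat \<Rightarrow> nat set set set" where
  "labelled_linear_trees n = {E. linear_tree {..<n} E}"

definition linear_tree_iso :: "nat \<Rightarrow> (nat set set \<times> nat set set) set" where
  "linear_tree_iso n = {(E, F). E \<in> labelled_linear_trees n \<and> F \<in> labelled_linear_trees n \<and>
     graph_isomorphic {..<n} E {..<n} F}"

definition num_linear_trees :: "nat \<Rightarrow> nat" where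
  "num_linear_trees n = card (labelled_linear_trees n // linear_tree_iso n)"

definition partition_gf :: "real \<Rightarrow> real" where
  "partition_gf x = (\<Prod>i. 1 / (1 - x ^ Suc i))"

definition x0 :: real where
  "x0 = (THE x. 0 < x \<and> x < 1 \<and> x * partition_gf x = 1)"

end

theory Submission
  imports Defs "HOL-Combinatorics.List_Permutation"
begin

text \<open>
  A linear tree with at least two HDVs is a spine of vertices, joining the two extreme HDVs, with a
  partition attached to each spine vertex: the multiset of the sizes of the pendant paths there. The
  partitions at the two ends have at least two parts. This code is unique up to reversal, so the
  number of such trees is half the number of codes plus half the number of palindromic ones. The
  generating function of the codes is \<open>x^2 Q(x)^2 / (1 - x P(x))\<close> with \<open>Q(x) = P(x) - 1/(1-x)\<close>.
  With weights \<open>q k = p(k - 1) x0^k\<close>, which sum to \<open>x0 P(x0) = 1\<close>, the factor \<open>1 / (1 - x P(x))\<close> becomes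
  a renewal sequence with mean \<open>x0 (P(x0) + x0 P'(x0))\<close>, so the renewal theorem gives the growth of the
  number of codes. Palindromic codes, and trees with at most one HDV, are negligible.
\<close>

section \<open>Partitions and their generating function\<close>

text \<open>Uniqueness of codes rests on recognising the spine in the bare graph: the vertices off
  the spine are exactly the leaves and the vertices joined to a leaf by a chain of degree-two
  vertices. Two parts at each end give the end vertices degree at least 3, so this test cannot eat
  into the spine. With a single spine vertex the code need not be unique, and such codes enter only
  through an upper bound. The asymptotics use real methods only: the positive weight
  \<open>q 1\<close>, contributed by a spine vertex without branches, excludes periodicity. A
  palindrome is fixed by its middle and one half, so palindromes grow at most at the square root of
  the rate of all codes, up to a linear factor. Enclosing the leading constant requires bounds on
  P'(x0), which convexity supplies from values of \<open>P\<close> at nearby points.\<close>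

definition partitions_of :: "nat \<Rightarrow> nat list set" where
  "partitions_of n = {b. sorted b \<and> 0 \<notin> set b \<and> sum_list b = n}"

text \<open>Bounding the parts by \<open>k\<close> truncates the Euler product after
  \<open>k\<close> factors, so the product formula can be proved factor by factor.\<close>

definition bounded_partitions_of :: "nat \<Rightarrow> nat \<Rightarrow> nat list set" where
  "bounded_partitions_of k n = {b \<in> partitions_of n. set b \<subseteq> {..k}}"

lemma length_le_sum_list: "0 \<notin> set b \<Longrightarrow> length b \<le> sum_list (b :: nat list)"
  by (induction b) auto

lemma finite_partitions_of: "finite (partitions_of n)"
proof (rule finite_subset)
  show "partitions_of n \<subseteq> {b. set b \<subseteq> {..n} \<and> length b \<le> n}"
    using member_le_sum_list length_le_sum_list by (fastforce simp: partitions_of_def)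
  show "finite {b. set b \<subseteq> {..n} \<and> length b \<le> n}"
    by (rule finite_lists_length_le) simp
qed

lemma finite_bounded_partitions_of: "finite (bounded_partitions_of k n)"
  unfolding bounded_partitions_of_def using finite_partitions_of by simp

lemma bounded_partitions_of_eq: "n \<le> k \<Longrightarrow> bounded_partitions_of k n = partitions_of n"
  using member_le_sum_list by (fastforce simp: bounded_partitions_of_def partitions_of_def)

lemma card_bounded_partitions_of_le: "card (bounded_partitions_of k n) \<le> card (partitions_of n)"
  by (rule card_mono[OF finite_partitions_of]) (auto simp: bounded_partitions_of_def)

lemma card_bounded_partitions_of_0:
  "card (bounded_partitions_of 0 n) = (if n = 0 then 1 else 0)"
proof -
  have "b \<in> bounded_partitions_of 0 n \<longleftrightarrow> b = [] \<and> n = 0" for b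
    by (cases b) (auto simp: bounded_partitions_of_def partitions_of_def)
  then have "bounded_partitions_of 0 n = (if n = 0 then {[]} else {})"
    by auto
  then show ?thesis by simp
qed

text \<open>A partition either avoids the part \<open>Suc k\<close> or, being sorted, ends in it.
  Then one copy is dropped and further copies may remain, which corresponds to the factor 1 / (1 -
  x^(k+1)).\<close>

lemma card_bounded_partitions_of_Suc:
  "card (bounded_partitions_of (Suc k) n) = card (bounded_partitions_of k n) +
    (if Suc k \<le> n then card (bounded_partitions_of (Suc k) (n - Suc k)) else 0)"
proof -
  let ?W = "{b \<in> bounded_partitions_of (Suc k) n. Suc k \<in> set b}"
  let ?A = "if Suc k \<le> n then (\<lambda>b. b @ [Suc k]) ` bounded_partitions_of (Suc k) (n - Suc k) else {}"
  have "bounded_partitions_of (Suc k) n = bounded_partitions_of k n \<union> ?W"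
    by (auto simp: bounded_partitions_of_def) (metis atMost_iff le_SucE subset_iff)+
  moreover have "bounded_partitions_of k n \<inter> ?W = {}"
    by (auto simp: bounded_partitions_of_def)
  moreover have "?W = ?A"
  proof (intro equalityI subsetI)
    fix b assume b: "b \<in> ?W"
    then have b1: "sorted b" "0 \<notin> set b" "sum_list b = n" "set b \<subseteq> {..Suc k}" "Suc k \<in> set b"
      by (auto simp: bounded_partitions_of_def partitions_of_def)
    then have ne: "b \<noteq> []" by auto
    then obtain a l where al: "b = a @ [l]" by (metis rev_exhaust)
    have "l = Suc k" using b1 al by (auto simp: sorted_append le_antisym)
    then have "a \<in> bounded_partitions_of (Suc k) (n - Suc k)" "Suc k \<le> n"
      using b1 al by (auto simp: bounded_partitions_of_def partitions_of_def sorted_append)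
    then show "b \<in> ?A" using al \<open>l = Suc k\<close> by auto
  next
    fix b assume "b \<in> ?A"
    then show "b \<in> ?W"
      by (auto simp: bounded_partitions_of_def partitions_of_def sorted_append split: if_splits)
  qed
  moreover have "card ?A = (if Suc k \<le> n then card (bounded_partitions_of (Suc k) (n - Suc k)) else 0)"
    by (auto intro!: card_image inj_onI)
  ultimately show ?thesis
    using card_Un_disjoint[of "bounded_partitions_of k n" ?W] finite_bounded_partitions_of by simp
qed

text \<open>The recursion for the counts reads A = S + x^(k+1) A for the sums, which yields the next
  factor. It can be solved only once the new series is known to converge, hence the bound on its
  partial sums.\<close>

lemma bounded_partitions_gf:
  fixes x :: real
  assumes x: "0 \<le> x" "x < 1"
  shows "(\<lambda>n. card (bounded_partitions_of k n) * x ^ n) sums (\<Prod>i<k. 1 / (1 - x ^ Suc i))"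
proof (induction k)
  case 0
  have "(\<lambda>n. card (bounded_partitions_of 0 n) * x ^ n) = (\<lambda>n. if n = 0 then 1 else 0)"
    by (auto simp: card_bounded_partitions_of_0)
  then show ?case using sums_single[of 0 "\<lambda>_. 1::real"] by simp
next
  case (Suc k)
  define a where "a = (\<lambda>n. card (bounded_partitions_of (Suc k) n) * x ^ n)"
  define b where "b = (\<lambda>n. card (bounded_partitions_of k n) * x ^ n)"
  define S where "S = (\<Prod>i<k. 1 / (1 - x ^ Suc i))"
  have b: "b sums S" using Suc by (simp add: b_def S_def)
  have a0: "a n \<ge> 0" and b0: "b n \<ge> 0" for n using x by (auto simp: a_def b_def)
  have xk: "x ^ Suc k < 1" "0 \<le> x ^ Suc k" using x by (auto simp: power_Suc_less_one power_less_one_iff simp del: power_Suc)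
  have a_rec: "a n = b n + (if Suc k \<le> n then x ^ Suc k * a (n - Suc k) else 0)" for n
  proof -
    have "x ^ n = x ^ Suc k * x ^ (n - Suc k)" if "Suc k \<le> n"
      using that by (metis le_add_diff_inverse power_add)
    then show ?thesis
      by (auto simp: a_def b_def card_bounded_partitions_of_Suc[of k n] algebra_simps simp del: power_Suc)
  qed
  have shift: "(\<Sum>n<N. if Suc k \<le> n then x ^ Suc k * a (n - Suc k) else 0) = x ^ Suc k * (\<Sum>n<N - Suc k. a n)" for N
  proof -
    have "(\<Sum>n<N. if Suc k \<le> n then x ^ Suc k * a (n - Suc k) else 0)
        = (\<Sum>n\<in>{Suc k..<N}. x ^ Suc k * a (n - Suc k))"
      by (rule sum.mono_neutral_cong_right) auto
    also have "\<dots> = (\<Sum>n<N - Suc k. x ^ Suc k * a n)"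
      by (rule sum.reindex_bij_witness[of _ "\<lambda>n. n + Suc k" "\<lambda>n. n - Suc k"]) auto
    finally show ?thesis by (simp add: sum_distrib_left)
  qed
  have T: "(\<Sum>n<N. a n) = (\<Sum>n<N. b n) + x ^ Suc k * (\<Sum>n<N - Suc k. a n)" for N
    by (subst a_rec, subst sum.distrib) (simp only: shift)
  \<comment> \<open>Nonnegative terms allow the shifted partial sum to be enlarged to the full one,
    which turns the recursion into a bound independent of \<open>N\<close>.\<close>
  have "(\<Sum>n<N. a n) \<le> S / (1 - x ^ Suc k)" for N
  proof -
    have "(\<Sum>n<N - Suc k. a n) \<le> (\<Sum>n<N. a n)" by (rule sum_mono2) (auto simp: a0)
    then have "x ^ Suc k * (\<Sum>n<N - Suc k. a n) \<le> x ^ Suc k * (\<Sum>n<N. a n)"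
      using xk by (intro mult_left_mono)
    moreover have "(\<Sum>n<N. b n) \<le> S" using b b0 by (metis sum_le_suminf finite_lessThan sums_iff)
    ultimately have "(\<Sum>n<N. a n) * (1 - x ^ Suc k) \<le> S" using T[of N] by (simp add: algebra_simps)
    then show ?thesis using xk by (simp add: field_simps)
  qed
  then have "summable a" by (intro bounded_imp_summable[of _ "S / (1 - x ^ Suc k)"] a0) (metis lessThan_Suc_atMost)
  then obtain A where A: "a sums A" by blast
  have "(\<lambda>N. (\<Sum>n<N - Suc k. a n)) \<longlonglongrightarrow> A"
    using A unfolding sums_def
    by (rule filterlim_compose) (rule filterlim_minus_const_nat_at_top)
  then have "(\<lambda>N. (\<Sum>n<N. b n) + x ^ Suc k * (\<Sum>n<N - Suc k. a n)) \<longlonglongrightarrow> S + x ^ Suc k * A"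
    using b unfolding sums_def by (intro tendsto_intros)
  then have "A = S + x ^ Suc k * A"
    using A unfolding sums_def T[symmetric] using LIMSEQ_unique by blast
  then have "A = S * (1 / (1 - x ^ Suc k))" using xk by (simp add: field_simps)
  then show ?case using A by (simp add: a_def S_def)
qed

lemma partition_gf_LIMSEQ:
  assumes x: "0 \<le> x" "x < 1"
  shows "(\<lambda>k. \<Prod>i<k. 1 / (1 - x ^ Suc i)) \<longlonglongrightarrow> partition_gf x"
proof -
  have "summable (\<lambda>i. x ^ i)" using x by (intro summable_geometric) auto
  then have s: "summable (\<lambda>i. norm (- (x ^ Suc i)))"
    using x by (subst summable_cong[where g = "\<lambda>i. x * x ^ i"]) auto
  have ne: "x ^ Suc i \<noteq> 1" for i using x power_Suc_less_one[of x i] by (cases "x = 0") auto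
  have "convergent_prod (\<lambda>i. 1 + (- (x ^ Suc i)))"
    using s ne by (intro summable_imp_convergent_prod_real) auto
  then have "convergent_prod (\<lambda>i. inverse (1 + (- (x ^ Suc i))))" by (rule convergent_prod_inverse)
  then have c: "convergent_prod (\<lambda>i. 1 / (1 - x ^ Suc i))" by (simp add: inverse_eq_divide)
  have "(\<lambda>k. \<Prod>i\<le>k. 1 / (1 - x ^ Suc i)) \<longlonglongrightarrow> partition_gf x"
    unfolding partition_gf_def by (rule convergent_prod_LIMSEQ[OF c])
  then have "(\<lambda>k. \<Prod>i<Suc k. 1 / (1 - x ^ Suc i)) \<longlonglongrightarrow> partition_gf x"
    by (simp only: lessThan_Suc_atMost)
  then show ?thesis by (rule LIMSEQ_imp_Suc)
qed

lemma incseq_partition_product: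
  fixes x :: real
  assumes x: "0 \<le> x" "x < 1"
  shows "incseq (\<lambda>k. \<Prod>i<k. 1 / (1 - x ^ Suc i))"
proof (rule incseq_SucI)
  fix k
  have "0 \<le> (\<Prod>i<k. 1 / (1 - x ^ Suc i))"
    using x by (auto simp: power_le_one simp del: power_Suc intro!: prod_nonneg)
  moreover have "1 / (1 - x ^ Suc k) \<ge> 1"
    using x power_Suc_less_one[of x k] by (cases "x = 0") (auto simp: field_simps)
  ultimately have "(\<Prod>i<k. 1 / (1 - x ^ Suc i)) * 1 \<le> (\<Prod>i<k. 1 / (1 - x ^ Suc i)) * (1 / (1 - x ^ Suc k))"
    by (intro mult_left_mono)
  then show "(\<Prod>i<k. 1 / (1 - x ^ Suc i)) \<le> (\<Prod>i<Suc k. 1 / (1 - x ^ Suc i))" by simp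
qed

text \<open>Partitions of numbers up to \<open>N\<close> have parts at most \<open>N\<close>, so the
  partial sums are dominated by the product of \<open>N\<close> factors; conversely each finite
  product counts only some of the partitions. The two inequalities meet at the infinite
  product.\<close>

lemma partition_gf_sums:
  fixes x :: real
  assumes x: "0 \<le> x" "x < 1"
  shows "(\<lambda>n. card (partitions_of n) * x ^ n) sums partition_gf x"
proof -
  define a where "a = (\<lambda>n. card (partitions_of n) * x ^ n)"
  define c where "c = (\<lambda>k. \<Prod>i<k. 1 / (1 - x ^ Suc i))"
  have a0: "a n \<ge> 0" for n using x by (auto simp: a_def)
  have c_lim: "c \<longlonglongrightarrow> partition_gf x" using partition_gf_LIMSEQ[OF x] by (simp add: c_def)
  have c_le: "c k \<le> partition_gf x" for k
    using incseq_le[OF incseq_partition_product[OF x] partition_gf_LIMSEQ[OF x]] by (simp add: c_def)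
  have bp: "(\<lambda>n. card (bounded_partitions_of k n) * x ^ n) sums c k" for k
    using bounded_partitions_gf[OF x] by (simp add: c_def)
  have partial: "(\<Sum>n\<le>N. a n) \<le> c N" for N
  proof -
    have "(\<Sum>n\<le>N. a n) = (\<Sum>n\<le>N. card (bounded_partitions_of N n) * x ^ n)"
      by (simp add: a_def bounded_partitions_of_eq)
    also have "\<dots> \<le> c N"
      using bp[of N] x by (metis (no_types, lifting) finite_atMost mult_nonneg_nonneg of_nat_0_le_iff
          sum_le_suminf sums_iff zero_le_power)
    finally show ?thesis .
  qed
  have s: "summable a"
    by (rule bounded_imp_summable[of _ "partition_gf x"]) (use a0 partial c_le order_trans in blast)+
  have "(\<Sum>n<N. a n) \<le> partition_gf x" for N
  proof -
    have "(\<Sum>n<N. a n) \<le> (\<Sum>n\<le>N. a n)" by (rule sum_mono2) (auto simp: a0)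
    then show ?thesis using partial[of N] c_le[of N] by linarith
  qed
  then have "suminf a \<le> partition_gf x" by (intro suminf_le_const[OF s])
  moreover have "c k \<le> suminf a" for k
    using suminf_le[OF _ sums_summable[OF bp[of k]] s] card_bounded_partitions_of_le[of k] x
    by (simp add: a_def sums_unique[OF bp[of k]] mult_right_mono)
  then have "partition_gf x \<le> suminf a"
    using c_lim by (rule_tac LIMSEQ_le_const2) auto
  ultimately show ?thesis using s by (simp add: a_def sums_iff)
qed

text \<open>The omitted factors satisfy \<Prod>(1 - x^i) \<ge> 1 - \<Sum>x^i, and the sum over i > k
  is the geometric tail x^(k+1) / (1 - x). The induction adjoins \<open>m\<close> further factors
  with the corresponding finite geometric sum.\<close>

lemma partition_gf_bounds:
  assumes x: "0 \<le> x" "x < 1" and tail: "x ^ Suc k / (1 - x) < 1"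
  shows "(\<Prod>i<k. 1 / (1 - x ^ Suc i)) \<le> partition_gf x"
    and "partition_gf x \<le> (\<Prod>i<k. 1 / (1 - x ^ Suc i)) / (1 - x ^ Suc k / (1 - x))"
proof -
  define c where "c = (\<lambda>k. \<Prod>i<k. 1 / (1 - x ^ Suc i))"
  have c_lim: "c \<longlonglongrightarrow> partition_gf x" using partition_gf_LIMSEQ[OF x] by (simp add: c_def)
  have pos: "1 - x ^ Suc i > 0" for i using x power_Suc_less_one[of x i] by (cases "x = 0") auto
  have cpos: "c k > 0" for k using pos by (auto simp: c_def simp del: power_Suc intro!: prod_pos)
  show "(\<Prod>i<k. 1 / (1 - x ^ Suc i)) \<le> partition_gf x"
    by (rule incseq_le[OF incseq_partition_product[OF x] partition_gf_LIMSEQ[OF x]])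
  have "c (k + m) * (1 - x ^ Suc k * (1 - x ^ m) / (1 - x)) \<le> c k" for m
  proof (induction m)
    case (Suc m)
    define y where "y = x ^ Suc (k + m)"
    define s where "s = x ^ Suc k * (1 - x ^ m) / (1 - x)"
    have s: "x ^ Suc k * (1 - x ^ Suc m) / (1 - x) = s + y"
      using x by (simp add: s_def y_def field_simps power_add)
    have "0 \<le> s" using x by (simp add: s_def power_le_one)
    have y: "0 \<le> y" "1 - y > 0" using x pos[of "k + m"] by (auto simp: y_def)
    have "1 - (s + y) \<le> (1 - s) * (1 - y)" using \<open>0 \<le> s\<close> y by (simp add: algebra_simps)
    then have "(1 - (s + y)) / (1 - y) \<le> 1 - s" using y by (simp add: field_simps)
    then have "c (k + m) * ((1 - (s + y)) / (1 - y)) \<le> c (k + m) * (1 - s)"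
      using cpos[of "k + m"] by (intro mult_left_mono) auto
    moreover have "c (k + Suc m) = c (k + m) / (1 - y)" by (simp add: c_def y_def)
    ultimately show ?case using Suc s by (simp add: s_def)
  qed (simp)
  then have "c (m + k) * (1 - x ^ Suc k * (1 - x ^ m) / (1 - x)) \<le> c k" for m
    by (simp only: add.commute[of m k])
  moreover have "(\<lambda>m. c (m + k) * (1 - x ^ Suc k * (1 - x ^ m) / (1 - x)))
      \<longlonglongrightarrow> partition_gf x * (1 - x ^ Suc k * (1 - 0) / (1 - x))"
    using x by (intro tendsto_intros LIMSEQ_ignore_initial_segment c_lim LIMSEQ_power_zero) auto
  ultimately have "partition_gf x * (1 - x ^ Suc k / (1 - x)) \<le> c k"
    by (intro LIMSEQ_le_const2) auto
  then show "partition_gf x \<le> (\<Prod>i<k. 1 / (1 - x ^ Suc i)) / (1 - x ^ Suc k / (1 - x))"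
    using tail by (simp add: c_def field_simps)
qed

section \<open>Monotonicity, derivative and convexity of P on the unit interval\<close>

lemma partition_gf_series:
  assumes "0 \<le> x" "x < 1"
  shows "summable (\<lambda>n. real (card (partitions_of n)) * x ^ n)"
    and "partition_gf x = (\<Sum>n. real (card (partitions_of n)) * x ^ n)"
  using partition_gf_sums[OF assms] by (auto simp: sums_iff)

lemma partition_gf_ge_1:
  assumes "0 \<le> x" "x < 1"
  shows "1 \<le> partition_gf x"
proof -
  have "b \<in> partitions_of 0 \<longleftrightarrow> b = []" for b by (cases b) (auto simp: partitions_of_def)
  then have "partitions_of 0 = {[]}" by auto
  then have "(\<Sum>n\<in>{0}. real (card (partitions_of n)) * x ^ n) = 1" by simp
  moreover have "(\<Sum>n\<in>{0}. real (card (partitions_of n)) * x ^ n) \<le> partition_gf x"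
    unfolding partition_gf_series(2)[OF assms]
    by (rule sum_le_suminf[OF partition_gf_series(1)[OF assms]]) (use assms in auto)
  ultimately show ?thesis by simp
qed

lemma partition_gf_mono:
  assumes "0 \<le> x" "x \<le> y" "y < 1"
  shows "partition_gf x \<le> partition_gf y"
  using assms unfolding partition_gf_series(2)[OF assms(1) order_le_less_trans[OF assms(2,3)]]
    partition_gf_series(2)[OF order_trans[OF assms(1,2)] assms(3)]
  by (intro suminf_le partition_gf_series mult_left_mono power_mono) auto

lemma times_partition_gf_strict_mono:
  assumes "0 \<le> x" "x < y" "y < 1"
  shows "x * partition_gf x < y * partition_gf y"
proof -
  have "x * partition_gf x \<le> x * partition_gf y" using assms partition_gf_mono[of x y] by (intro mult_left_mono) auto
  also have "\<dots> < y * partition_gf y" using assms partition_gf_ge_1[of y] by (intro mult_strict_right_mono) auto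
  finally show ?thesis .
qed

lemma partition_gf_has_derivative:
  assumes x: "0 < x" "x < 1"
  shows "(partition_gf has_real_derivative (\<Sum>n. real (Suc n) * real (card (partitions_of (Suc n))) * x ^ n)) (at x)"
proof -
  let ?c = "\<lambda>n. real (card (partitions_of n))"
  obtain K where K: "x < K" "K < 1" using dense[OF x(2)] by blast
  have "((\<lambda>z. \<Sum>n. ?c n * z ^ n) has_real_derivative (\<Sum>n. diffs ?c n * x ^ n)) (at x)"
    using K x by (intro termdiffs_strong[of _ K] partition_gf_series) auto
  \<comment> \<open>Product and power series are known to agree only below 1 and for nonnegative
    arguments, so the derivative is transferred through the open interval (0,1) around
    \<open>x\<close>.\<close>
  then have "(partition_gf has_real_derivative (\<Sum>n. diffs ?c n * x ^ n)) (at x)"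
    by (rule DERIV_cong_ev[THEN iffD1, rotated -1, OF _ refl _ refl])
      (use x partition_gf_series(2) in \<open>auto intro!: eventually_mono[OF eventually_nhds_in_open[of "{0<..<1}" x]]\<close>)
  then show ?thesis by (simp add: diffs_def mult_ac)
qed

lemma partition_gf_deriv:
  assumes x: "0 < x" "x < 1"
  shows "deriv partition_gf x = (\<Sum>n. real (Suc n) * real (card (partitions_of (Suc n))) * x ^ n)"
    and "summable (\<lambda>n. real (Suc n) * real (card (partitions_of (Suc n))) * x ^ n)"
proof -
  show "deriv partition_gf x = (\<Sum>n. real (Suc n) * real (card (partitions_of (Suc n))) * x ^ n)"
    using partition_gf_has_derivative[OF x] by (rule DERIV_imp_deriv)
  obtain K where K: "x < K" "K < 1" using dense[OF x(2)] by blast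
  have "summable (\<lambda>n. diffs (\<lambda>n. real (card (partitions_of n))) n * x ^ n)"
  proof (rule termdiff_converges)
    show "norm x < K" using x K by simp
    show "summable (\<lambda>n. real (card (partitions_of n)) * z ^ n)" if "norm z < K" for z :: real
    proof (rule summable_comparison_test[OF _ partition_gf_series(1)[of K]])
      show "\<exists>N. \<forall>n\<ge>N. norm (real (card (partitions_of n)) * z ^ n) \<le> real (card (partitions_of n)) * K ^ n"
        using that by (simp add: abs_mult power_abs mult_left_mono power_mono)
    qed (use K x in auto)
  qed
  then show "summable (\<lambda>n. real (Suc n) * real (card (partitions_of (Suc n))) * x ^ n)" by (simp add: diffs_def mult_ac)
qed

lemma partition_gf_deriv_mono:
  assumes "0 < x" "x \<le> y" "y < 1"
  shows "deriv partition_gf x \<le> deriv partition_gf y"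
proof -
  have "x < 1" "0 < y" using assms by auto
  then show ?thesis
    using assms unfolding partition_gf_deriv(1)[OF assms(1) \<open>x < 1\<close>] partition_gf_deriv(1)[OF \<open>0 < y\<close> assms(3)]
    by (intro suminf_le partition_gf_deriv mult_left_mono power_mono) auto
qed

text \<open>\<open>P\<close> has nonnegative coefficients, so its derivative is monotone and
  brackets every secant slope. Bounds for P' thus follow from values of \<open>P\<close>
  alone.\<close>

lemma partition_gf_secant:
  assumes "0 < x" "x < y" "y < 1"
  shows "deriv partition_gf x \<le> (partition_gf y - partition_gf x) / (y - x)"
    and "(partition_gf y - partition_gf x) / (y - x) \<le> deriv partition_gf y"
proof -
  have "\<exists>z>x. z < y \<and> partition_gf y - partition_gf x = (y - x) * deriv partition_gf z"
  proof (rule MVT2[OF assms(2)])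
    fix z assume "x \<le> z" "z \<le> y"
    then show "(partition_gf has_real_derivative deriv partition_gf z) (at z)"
      using partition_gf_has_derivative[of z] partition_gf_deriv(1)[of z] assms by auto
  qed
  then obtain z where z: "x < z" "z < y" "partition_gf y - partition_gf x = (y - x) * deriv partition_gf z" by blast
  then have "(partition_gf y - partition_gf x) / (y - x) = deriv partition_gf z" using assms by simp
  then show "deriv partition_gf x \<le> (partition_gf y - partition_gf x) / (y - x)"
    "(partition_gf y - partition_gf x) / (y - x) \<le> deriv partition_gf y"
    using partition_gf_deriv_mono[of x z] partition_gf_deriv_mono[of z y] z assms by auto
qed

text \<open>The coefficient of x^n in x P(x) is p(n - 1), so the right-hand side is x times the
  derivative of x P(x). At \<open>x0\<close> it is the mean of the renewal weights.\<close>

lemma mean_sums: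
  assumes x: "0 < x" "x < 1"
  shows "(\<lambda>n. real n * (if n = 0 then 0 else real (card (partitions_of (n - 1))) * x ^ n)) sums
    (x * (partition_gf x + x * deriv partition_gf x))"
proof -
  let ?p = "\<lambda>n. real (card (partitions_of n))"
  have "(\<lambda>n. x * (real (Suc n) * ?p (Suc n) * x ^ n)) sums (x * deriv partition_gf x)"
    using partition_gf_deriv[OF x] by (intro sums_mult) (simp add: sums_iff)
  then have "(\<lambda>n. real (Suc n) * ?p (Suc n) * x ^ Suc n) sums (x * deriv partition_gf x)"
    by (simp add: mult_ac)
  then have "(\<lambda>n. real n * ?p n * x ^ n) sums (x * deriv partition_gf x)"
    using sums_Suc_iff[of "\<lambda>n. real n * ?p n * x ^ n"] by simp
  then have "(\<lambda>n. ?p n * x ^ n + real n * ?p n * x ^ n) sums (partition_gf x + x * deriv partition_gf x)"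
    using x by (intro sums_add partition_gf_sums) auto
  then have "(\<lambda>n. x * (?p n * x ^ n + real n * ?p n * x ^ n)) sums (x * (partition_gf x + x * deriv partition_gf x))"
    by (rule sums_mult)
  then have "(\<lambda>n. real (Suc n) * (?p n * x ^ Suc n)) sums (x * (partition_gf x + x * deriv partition_gf x))"
    by (simp add: algebra_simps)
  then show ?thesis
    using sums_Suc[of "\<lambda>n. real n * (if n = 0 then 0 else real (card (partitions_of (n - 1))) * x ^ n)"]
    by simp
qed

section \<open>Certified bounds for P, for its root x0 and for the two constants\<close>

definition enclosure_factor :: "int \<Rightarrow> int \<Rightarrow> int \<Rightarrow> int \<Rightarrow> int \<Rightarrow> int \<times> int \<times> int \<times> int" where
  "enclosure_factor M l u f g = (l, u, f * (M - u) div M, g * (M - l) div M + 1)"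

text \<open>The power of \<open>x\<close> is updated before its factor is applied. Integer division
  rounds lower bounds down, the added 1 rounds upper bounds up, and the lower bound of the product
  uses the upper bound of the power and vice versa.\<close>

definition enclosure_step :: "int \<Rightarrow> int \<Rightarrow> int \<times> int \<times> int \<times> int \<Rightarrow> int \<times> int \<times> int \<times> int" where
  "enclosure_step M X = (\<lambda>(l, u, f, g). enclosure_factor M (l * X div M) (u * X div M + 1) f g)"

text \<open>
  For \<open>x = X / M\<close>, interval arithmetic with denominator \<open>M\<close> encloses \<open>x ^ k\<close> (first two components)
  and the partial product of the factors \<open>1 - x ^ i\<close> (last two components).
\<close>

fun prod_enclosure :: "int \<Rightarrow> int \<Rightarrow> nat \<Rightarrow> int \<times> int \<times> int \<times> int" where
  "prod_enclosure M X 0 = (M, M, M, M)"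
| "prod_enclosure M X (Suc k) = enclosure_step M X (prod_enclosure M X k)"

lemma prod_enclosure_numeral:
  "prod_enclosure M X (numeral n) = enclosure_step M X (prod_enclosure M X (pred_numeral n))"
  by (simp add: numeral_eq_Suc)

lemma div_bounds:
  fixes a M :: int
  assumes "M > 0"
  shows "real_of_int (a div M) \<le> real_of_int a / real_of_int M" "real_of_int a / real_of_int M \<le> real_of_int (a div M + 1)"
proof -
  have "a div M = \<lfloor>real_of_int a / real_of_int M\<rfloor>" by (rule floor_divide_of_int_eq[symmetric])
  then show "real_of_int (a div M) \<le> real_of_int a / real_of_int M" "real_of_int a / real_of_int M \<le> real_of_int (a div M + 1)"
    using of_int_floor_le[of "real_of_int a / real_of_int M"] real_of_int_floor_add_one_ge[of "real_of_int a / real_of_int M"] by auto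
qed

text \<open>The bound \<open>u \<le> M\<close> keeps the scaled factor \<open>M - u\<close>
  nonnegative, which the multiplication of lower bounds relies on.\<close>

lemma prod_enclosure:
  assumes X: "0 < X" "X < M" and e: "prod_enclosure M X k = (l, u, f, g)"
  defines "x \<equiv> real_of_int X / real_of_int M"
  shows "0 \<le> l \<and> u \<le> M \<and> 0 \<le> f \<and> l \<le> M * x ^ k \<and> M * x ^ k \<le> u \<and>
    f \<le> M * (\<Prod>i<k. 1 - x ^ Suc i) \<and> M * (\<Prod>i<k. 1 - x ^ Suc i) \<le> g"
  using e
proof (induction k arbitrary: l u f g)
  case (Suc k)
  obtain l0 u0 f0 g0 where e0: "prod_enclosure M X k = (l0, u0, f0, g0)" by (metis prod_cases4)
  define p where "p = (\<Prod>i<k. 1 - x ^ Suc i)"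
  note IH = Suc.IH[OF e0, folded p_def]
  have M: "M > 0" "real_of_int M > 0" using X by auto
  have x: "0 < x" "x < 1" using X by (auto simp: x_def)
  have new: "l = l0 * X div M" "u = u0 * X div M + 1" "f = f0 * (M - u) div M" "g = g0 * (M - l) div M + 1"
    using Suc.prems e0 by (auto simp: enclosure_step_def enclosure_factor_def)
  have l: "real_of_int l \<le> M * x ^ Suc k"
  proof -
    have "real_of_int l \<le> real_of_int (l0 * X) / M" unfolding new using div_bounds[OF M(1)] by blast
    also have "\<dots> = real_of_int l0 * x" by (simp add: x_def)
    also have "\<dots> \<le> (M * x ^ k) * x" using IH x by (intro mult_right_mono) auto
    finally show ?thesis by (simp add: mult_ac)
  qed
  have u: "M * x ^ Suc k \<le> real_of_int u"
  proof -
    have "M * x ^ Suc k = (M * x ^ k) * x" by (simp add: mult_ac)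
    also have "\<dots> \<le> real_of_int u0 * x" using IH x by (intro mult_right_mono) auto
    also have "\<dots> = real_of_int (u0 * X) / M" by (simp add: x_def)
    also have "\<dots> \<le> real_of_int u" unfolding new using div_bounds[OF M(1)] by blast
    finally show ?thesis .
  qed
  \<comment> \<open>Since \<open>X < M\<close>, the quotient is at most \<open>M - 1\<close>, so
    rounding up by 1 does not exceed \<open>M\<close>.\<close>
  have "u0 * X \<le> M * X" using IH X by (intro mult_right_mono) auto
  then have "u0 * X div M \<le> X" using zdiv_mono1[OF _ M(1), of "u0 * X" "M * X"] M by simp
  then have uM: "u \<le> M" using new(2) X by linarith
  have l0: "0 \<le> l" unfolding new using IH X by (intro pos_imp_zdiv_nonneg_iff[THEN iffD2]) auto
  have f0': "0 \<le> f" unfolding new(3) using IH M uM by (intro pos_imp_zdiv_nonneg_iff[THEN iffD2]) auto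
  define y where "y = 1 - x ^ Suc k"
  have y: "real_of_int (M - u) \<le> M * y" "M * y \<le> real_of_int (M - l)" using l u by (auto simp: y_def algebra_simps)
  have y0: "0 \<le> y" using x by (auto simp: y_def power_le_one simp del: power_Suc)
  have p0: "0 \<le> p" using x by (auto simp: p_def power_le_one simp del: power_Suc intro!: prod_nonneg)
  have "real_of_int f \<le> real_of_int (f0 * (M - u)) / M" unfolding new(3) using div_bounds[OF M(1)] by blast
  also have "\<dots> \<le> (M * p) * (M * y) / M"
    unfolding of_int_mult using IH y uM M p0 y0 by (intro divide_right_mono mult_mono) auto
  also have "\<dots> = M * (p * y)" using M by simp
  finally have f: "real_of_int f \<le> M * (p * y)" .
  have "M * (p * y) = (M * p) * (M * y) / M" using M by simp
  also have "\<dots> \<le> real_of_int (g0 * (M - l)) / M"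
    unfolding of_int_mult using IH y M p0 y0 by (intro divide_right_mono mult_mono) (auto intro: order_trans[OF _ y(2)] order_trans[of 0 "M * p"])
  also have "\<dots> \<le> real_of_int g" unfolding new(4) using div_bounds[OF M(1)] by blast
  finally have g: "M * (p * y) \<le> real_of_int g" .
  have "(\<Prod>i<Suc k. 1 - x ^ Suc i) = p * y" by (simp add: p_def y_def)
  then show ?case using l u uM l0 f0' f g by simp
qed (use X in auto)

lemma partition_gf_enclosure:
  assumes X: "0 < X" "X < M" and e: "prod_enclosure M X k = (l, u, f, g)"
    and x: "x = real_of_int X / real_of_int M" and f: "f > 0" and tail: "x ^ Suc k / (1 - x) < t" "t < 1"
  shows "real_of_int M / real_of_int g \<le> partition_gf x"
    and "partition_gf x \<le> real_of_int M / real_of_int f / (1 - t)"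
proof -
  define p where "p = (\<Prod>i<k. 1 - x ^ Suc i)"
  have M: "real_of_int M > 0" using X by simp
  have x01: "0 < x" "x < 1" using X by (auto simp: x)
  have p: "f \<le> M * p" "M * p \<le> g"
    using prod_enclosure[OF X e, folded x] by (auto simp: p_def)
  have p': "(\<Prod>i<k. 1 / (1 - x ^ Suc i)) = 1 / p" by (simp add: p_def prod_dividef)
  have f': "real_of_int f > 0" using f by simp
  then have ppos: "0 < p" using p M by (meson less_le_trans zero_less_mult_pos)
  have gpos: "real_of_int g > 0" using p f' by linarith
  have t': "x ^ Suc k / (1 - x) < 1" using tail by linarith
  note b = partition_gf_bounds[OF less_imp_le[OF x01(1)] x01(2) t', unfolded p']
  have "M / g \<le> 1 / p" using p ppos gpos by (simp add: field_simps)
  then show "real_of_int M / real_of_int g \<le> partition_gf x" using b(1) by linarith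
  have upper: "1 / p \<le> M / f" using p ppos f' by (simp add: field_simps)
  have "1 / p / (1 - x ^ Suc k / (1 - x)) \<le> (M / f) / (1 - t)"
  proof (rule frac_le[OF _ upper])
    show "0 \<le> M / f" using M f' by simp
    show "0 < 1 - t" "1 - t \<le> 1 - x ^ Suc k / (1 - x)" using tail by linarith+
  qed
  then show "partition_gf x \<le> real_of_int M / real_of_int f / (1 - t)" using b(2) by linarith
qed

text \<open>0.4196 and 0.41961 enclose \<open>x0\<close>; 0.4192 and 0.42 are the outer points of
  the secants that bound P'(x0). At 0.4196 the value of x P(x) misses 1 by only a few millionths,
  which calls for this precision.\<close>

lemma prod_enclosure_values:
  "prod_enclosure 100000000 41920000 18 = (15, 17, 42025962, 42025989)"
  "prod_enclosure 100000000 41960000 18 = (15, 17, 41960081, 41960114)"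
  "prod_enclosure 100000000 41961000 18 = (15, 17, 41958436, 41958466)"
  "prod_enclosure 100000000 42000000 18 = (16, 17, 41894207, 41894234)"
  by (simp_all add: prod_enclosure_numeral enclosure_step_def enclosure_factor_def)

lemma partition_gf_values:
  "partition_gf 0.4192 \<le> 2.379482"
  "2.383215 \<le> partition_gf 0.4196" "partition_gf 0.4196 \<le> 2.383219"
  "2.383309 \<le> partition_gf 0.41961"
  "partition_gf 0.42 \<le> 2.386966"
proof -
  \<comment> \<open>With 18 factors the tail x^19 / (1 - x) is about 1.2e-7 at 0.42, the largest of
    the four points.\<close>
  note e = partition_gf_enclosure[where t = "0.00000015"]
  show "partition_gf 0.4192 \<le> 2.379482"
    by (rule order_trans[OF e(2)[OF _ _ prod_enclosure_values(1)]]) (simp_all add: field_simps)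
  show "2.383215 \<le> partition_gf 0.4196"
    by (rule order_trans[OF _ e(1)[OF _ _ prod_enclosure_values(2)]]) (simp_all add: field_simps)
  show "partition_gf 0.4196 \<le> 2.383219"
    by (rule order_trans[OF e(2)[OF _ _ prod_enclosure_values(2)]]) (simp_all add: field_simps)
  show "2.383309 \<le> partition_gf 0.41961"
    by (rule order_trans[OF _ e(1)[OF _ _ prod_enclosure_values(3)]]) (simp_all add: field_simps)
  show "partition_gf 0.42 \<le> 2.386966"
    by (rule order_trans[OF e(2)[OF _ _ prod_enclosure_values(4)]]) (simp_all add: field_simps)
qed

text \<open>The function x P(x) is continuous and strictly increasing on (0,1): the intermediate
  value theorem gives a root, monotonicity its uniqueness, and uniqueness identifies the description
  \<open>x0\<close> with that root.\<close>

lemma x0_ex1: "\<exists>!x::real. 0 < x \<and> x < 1 \<and> x * partition_gf x = 1"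
  and x0_bounds: "0.4196 < x0" "x0 < 0.41961"
  and x0_eq: "x0 * partition_gf x0 = 1"
proof -
  let ?f = "\<lambda>x. x * partition_gf x"
  have lo: "?f 0.4196 < 1" and hi: "?f 0.41961 > 1" using partition_gf_values by simp_all
  have "\<exists>x\<ge>0.4196. x \<le> 0.41961 \<and> ?f x = 1"
  proof (rule IVT')
    show "continuous_on {0.4196..0.41961} ?f"
      by (intro continuous_intros continuous_at_imp_continuous_on ballI DERIV_isCont[OF partition_gf_has_derivative]) auto
  qed (use lo hi in auto)
  then obtain x where x: "0.4196 \<le> x" "x \<le> 0.41961" "?f x = 1" by blast
  have "x \<noteq> 0.4196" "x \<noteq> 0.41961" using lo hi x(3) by (metis less_irrefl)+
  then have x': "0.4196 < x" "x < 0.41961" using x by auto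
  have uniq: "y = x" if "0 < y" "y < 1" "?f y = 1" for y
    using times_partition_gf_strict_mono[of x y] times_partition_gf_strict_mono[of y x] that x x'
    by (cases x y rule: linorder_cases) auto
  show ex: "\<exists>!x::real. 0 < x \<and> x < 1 \<and> x * partition_gf x = 1"
    using x x' uniq by (intro ex1I[of _ x]) auto
  have "x0 = x" unfolding x0_def using x x' uniq by (intro the_equality) auto
  then show "0.4196 < x0" "x0 < 0.41961" "x0 * partition_gf x0 = 1" using x x' by auto
qed

text \<open>The derivative is monotone, so a secant ending at 0.4196 bounds it from below and one
  starting at 0.41961 from above.\<close>

lemma deriv_partition_gf_x0: "9.33 \<le> deriv partition_gf x0" "deriv partition_gf x0 \<le> 9.38"
proof -
  have "(partition_gf 0.4196 - partition_gf 0.4192) / (0.4196 - 0.4192) \<le> deriv partition_gf 0.4196"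
    by (rule partition_gf_secant) auto
  moreover have "deriv partition_gf 0.4196 \<le> deriv partition_gf x0"
    using x0_bounds by (intro partition_gf_deriv_mono) auto
  ultimately show "9.33 \<le> deriv partition_gf x0" using partition_gf_values by (simp add: field_simps)
  have "deriv partition_gf x0 \<le> deriv partition_gf 0.41961"
    using x0_bounds by (intro partition_gf_deriv_mono) auto
  moreover have "deriv partition_gf 0.41961 \<le> (partition_gf 0.42 - partition_gf 0.41961) / (0.42 - 0.41961)"
    by (rule partition_gf_secant) auto
  ultimately show "deriv partition_gf x0 \<le> 9.38" using partition_gf_values by (simp add: field_simps)
qed

lemma partition_gf_x0: "partition_gf x0 = 1 / x0"
  using x0_eq x0_bounds by (simp add: field_simps)

lemma x0_inverse_bounds: "2.38316 \<le> 1 / x0" "1 / x0 \<le> 2.38323"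
  using x0_bounds by (simp_all add: field_simps)

lemma growth_rate_value: "\<bar>1 / x0 - 2.3832\<bar> \<le> 0.00005"
  using x0_inverse_bounds unfolding abs_le_iff by (intro conjI) simp_all

text \<open>With P(x0) = 1 / x0 the factors are enclosed separately and multiplied. Together with
  the bounds on \<open>1 / x0\<close> this fixes the decimals of the formula as 0.0145 and 2.3832;
  the values 0.7560 and 2.3822 quoted in the prose statement lie outside the proven
  intervals.\<close>

lemma leading_constant_value:
  "\<bar>1 / 2 * (partition_gf x0 - 1 / (1 - x0)) ^ 2 *
        (x0 / (partition_gf x0 + x0 * deriv partition_gf x0)) - 0.0145\<bar> \<le> 0.00005"
proof -
  define Q where "Q = partition_gf x0 - 1 / (1 - x0)"
  define D where "D = partition_gf x0 + x0 * deriv partition_gf x0"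
  have i: "1.72294 \<le> 1 / (1 - x0)" "1 / (1 - x0) \<le> 1.72298"
    using x0_bounds by (simp_all add: field_simps)
  have Q: "0.66017 \<le> Q" "Q \<le> 0.6603"
    using x0_inverse_bounds i unfolding Q_def partition_gf_x0 by simp_all
  have "0.4196 * 9.33 \<le> x0 * deriv partition_gf x0" "x0 * deriv partition_gf x0 \<le> 0.41961 * 9.38"
    using x0_bounds deriv_partition_gf_x0 by (intro mult_mono; simp)+
  then have "3.9148 \<le> x0 * deriv partition_gf x0" "x0 * deriv partition_gf x0 \<le> 3.936" by simp_all
  then have D: "6.2979 \<le> D" "D \<le> 6.3193"
    using x0_inverse_bounds unfolding D_def partition_gf_x0 by simp_all
  have Q2: "0.66017 ^ 2 \<le> Q ^ 2" "Q ^ 2 \<le> 0.6603 ^ 2" using Q by (intro power_mono; simp)+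
  have xD: "0.4196 / 6.3193 \<le> x0 / D" "x0 / D \<le> 0.41961 / 6.2979" using x0_bounds D by (intro frac_le; simp)+
  define R where "R = Q ^ 2 * (x0 / D)"
  have "0.66017 ^ 2 * (0.4196 / 6.3193) \<le> R" "R \<le> 0.6603 ^ 2 * (0.41961 / 6.2979)"
    unfolding R_def using Q2 xD x0_bounds D by (intro mult_mono; simp)+
  moreover have "0.0289 \<le> 0.66017 ^ 2 * (0.4196 / 6.3193 :: real)" "0.6603 ^ 2 * (0.41961 / 6.2979) \<le> (0.0291 :: real)"
    by (simp_all add: power2_eq_square)
  ultimately have "0.0289 \<le> R" "R \<le> 0.0291" by (meson order_trans)+
  then have "\<bar>1 / 2 * R - 0.0145\<bar> \<le> 0.00005" unfolding abs_le_iff by (intro conjI) simp_all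
  then show ?thesis by (simp add: R_def Q_def D_def)
qed

section \<open>The renewal theorem\<close>

text \<open>The limit superior, obtained as the infimum of the eventual strict upper bounds;
  boundedness makes it a real number. Applied to a negated sequence it yields the limit
  inferior.\<close>

lemma limsup_witness:
  fixes v :: "nat \<Rightarrow> real"
  assumes bd: "\<And>n. \<bar>v n\<bar> \<le> B"
  obtains l where "\<And>e. e > 0 \<Longrightarrow> eventually (\<lambda>n. v n < l + e) sequentially"
    and "\<And>e. e > 0 \<Longrightarrow> frequently (\<lambda>n. v n > l - e) sequentially"
proof -
  define X where "X = {a. eventually (\<lambda>n. v n < a) sequentially}"
  have "B + 1 \<in> X" using bd by (auto simp: X_def abs_le_iff intro!: always_eventually le_less_trans[OF _ less_add_one])
  then have ne: "X \<noteq> {}" by auto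
  have lb: "- B \<le> a" if "a \<in> X" for a
  proof -
    from that obtain n where "v n < a" by (auto simp: X_def eventually_sequentially)
    then show ?thesis using bd[of n] by linarith
  qed
  then have bb: "bdd_below X" by (auto simp: bdd_below_def)
  show ?thesis
  proof
    fix e :: real assume e: "e > 0"
    obtain a where "a \<in> X" "a < Inf X + e" using ne e by (meson cInf_lessD less_add_same_cancel1)
    then show "eventually (\<lambda>n. v n < Inf X + e) sequentially"
      by (auto simp: X_def elim: eventually_mono)
  next
    fix e :: real assume e: "e > 0"
    show "frequently (\<lambda>n. v n > Inf X - e) sequentially"
    proof (rule ccontr)
      assume "\<not> ?thesis"
      then have "eventually (\<lambda>n. v n \<le> Inf X - e) sequentially"
        by (simp add: frequently_def not_less)
      then have "Inf X - e / 2 \<in> X" using e by (auto simp: X_def elim: eventually_mono)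
      then show False using cInf_lower[OF _ bb] e by fastforce
    qed
  qed
qed

text \<open>As \<open>q 1 > 0\<close>, a value of \<open>v\<close> near its limit superior forces the preceding ones to be near it too.\<close>

lemma renewal_near_limsup:
  fixes q v :: "nat \<Rightarrow> real"
  assumes q: "\<And>n. q n \<ge> 0" "q 0 = 0" "q 1 > 0" "q sums 1"
    and bd: "\<And>n. \<bar>v n\<bar> \<le> 1"
    and rec: "\<And>n. n > 0 \<Longrightarrow> v n = (\<Sum>j\<le>n. q j * v (n - j))"
    and up: "\<And>e. e > 0 \<Longrightarrow> eventually (\<lambda>n. v n < l + e) sequentially"
    and freq: "\<And>e. e > 0 \<Longrightarrow> frequently (\<lambda>n. v n > l - e) sequentially"
    and "e > 0"
  shows "\<exists>n\<ge>M. \<forall>j\<le>J. v (n - j) > l - e"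
  using \<open>e > 0\<close>
proof (induction J arbitrary: e M)
  case 0
  then show ?case using freq[of e] by (auto simp: frequently_sequentially)
next
  case (Suc J)
  \<comment> \<open>Four errors of at most \<open>d\<close> arise below: the gap of
    \<open>v k\<close> to \<open>l\<close>, the tail of \<open>q\<close>, the excess
    \<open>s * d\<close>, and the deviation of \<open>s\<close> from \<open>1 - q 1\<close>. Their
    sum stays below \<open>q 1 * e\<close>.\<close>
  define d where "d = min e (q 1 * e / 5)"
  have d: "d > 0" "d \<le> e" "5 * d \<le> q 1 * e" using Suc.prems q by (auto simp: d_def)
  have l1: "\<bar>l\<bar> \<le> 1"
  proof (rule ccontr)
    assume "\<not> ?thesis"
    then consider "l > 1" | "l < -1" by linarith
    then show False
    proof cases
      case 1
      then obtain n where "v n > 1" using freq[of "l - 1"] by (auto simp: frequently_sequentially)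
      then show False using bd[of n] by linarith
    next
      case 2
      then obtain n where "v n < -1" using up[of "- 1 - l"] by (auto simp: eventually_sequentially)
      then show False using bd[of n] by linarith
    qed
  qed
  obtain M0 where M0: "\<And>m. m \<ge> M0 \<Longrightarrow> (\<Sum>j<m. q j) > 1 - d"
    using order_tendstoD(1)[OF q(4)[unfolded sums_def], of "1 - d"] d by (auto simp: eventually_sequentially)
  \<comment> \<open>The 2 leaves room to separate the indices 0 and 1 from the block below
    \<open>m\<close>.\<close>
  define m where "m = M0 + 2"
  have qm: "(\<Sum>j<m. q j) > 1 - d" by (rule M0) (simp add: m_def)
  obtain N where N: "\<And>n. n \<ge> N \<Longrightarrow> v n < l + d" using up[OF d(1)] by (auto simp: eventually_sequentially)
  obtain n where n: "n \<ge> M + N + m + J" "\<And>j. j \<le> J \<Longrightarrow> v (n - j) > l - d"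
    using Suc.IH[OF d(1), of "M + N + m + J"] by blast
  \<comment> \<open>\<open>k\<close> is the left end of the window on which \<open>v\<close> is
    already near \<open>l\<close>; the recursion applied there extends the window to
    \<open>k - 1\<close>.\<close>
  define k where "k = n - J"
  have k: "k \<ge> N + m" "v k > l - d" using n by (auto simp: k_def)
  have part: "(\<Sum>j\<in>A. q j) \<le> 1" if "finite A" for A
    using q that by (metis sum_le_suminf sums_iff)
  have "v k = (\<Sum>j\<le>k. q j * v (k - j))" using k by (intro rec) (auto simp: m_def)
  \<comment> \<open>The term for index 1 is isolated. In the block from 2 to \<open>m\<close> the
    argument \<open>k - j\<close> is beyond \<open>N\<close>, so \<open>l + d\<close> bounds the
    value; the rest carries weight at most \<open>d\<close> and needs only the bound 1.\<close>
  also have "{..k} = {1} \<union> ({2..<m} \<union> ({0} \<union> {m..k}))" using k by (auto simp: m_def)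
  also have "(\<Sum>j\<in>\<dots>. q j * v (k - j)) =
      q 1 * v (k - 1) + ((\<Sum>j\<in>{2..<m}. q j * v (k - j)) + (\<Sum>j\<in>{0} \<union> {m..k}. q j * v (k - j)))"
    by (subst sum.union_disjoint; (subst sum.union_disjoint)?) (auto simp: m_def)
  also have "(\<Sum>j\<in>{2..<m}. q j * v (k - j)) \<le> (\<Sum>j\<in>{2..<m}. q j * (l + d))"
    using k by (intro sum_mono mult_left_mono q(1) less_imp_le[OF N]) auto
  also have "(\<Sum>j\<in>{2..<m}. q j * (l + d)) = (\<Sum>j\<in>{2..<m}. q j) * (l + d)" by (simp add: sum_distrib_right)
  also have "(\<Sum>j\<in>{0} \<union> {m..k}. q j * v (k - j)) \<le> (\<Sum>j\<in>{0} \<union> {m..k}. q j)"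
    by (rule sum_mono) (use q bd in \<open>auto simp: abs_le_iff intro!: mult_left_le\<close>)
  also have "(\<Sum>j\<in>{0} \<union> {m..k}. q j) = (\<Sum>j\<in>{m..k}. q j)" using q(2) by (subst sum.union_disjoint) (auto simp: m_def)
  also have "\<dots> \<le> d"
  proof -
    have "(\<Sum>j<m. q j) + (\<Sum>j\<in>{m..k}. q j) = (\<Sum>j\<in>{..<m} \<union> {m..k}. q j)"
      by (rule sum.union_disjoint[symmetric]) auto
    then show ?thesis using qm part[of "{..<m} \<union> {m..k}"] by simp
  qed
  finally have step: "v k \<le> q 1 * v (k - 1) + ((\<Sum>j\<in>{2..<m}. q j) * (l + d) + d)" by simp
  define s where "s = (\<Sum>j\<in>{2..<m}. q j)"
  have "(\<Sum>j<m. q j) = q 1 + s"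
  proof -
    have "{..<m} = {0} \<union> ({1} \<union> {2..<m})" by (auto simp: m_def)
    then show ?thesis using q(2) by (simp add: s_def)
  qed
  then have s: "s > 1 - d - q 1" "s \<le> 1 - q 1" "0 \<le> s" using qm part[of "{..<m}"] q by (auto simp: s_def intro!: sum_nonneg)
  have "\<bar>s - (1 - q 1)\<bar> * \<bar>l\<bar> \<le> d * 1" using s l1 by (intro mult_mono) auto
  then have "\<bar>(s - (1 - q 1)) * l\<bar> \<le> d" by (simp add: abs_mult)
  then have "s * l \<le> l - q 1 * l + d" by (simp add: algebra_simps abs_le_iff)
  moreover have "s * d \<le> d" using s d q(3) by (simp add: mult_left_le_one_le)
  ultimately have "l - d < q 1 * v (k - 1) + (l - q 1 * l + d + d + d)"
    using step k unfolding s_def[symmetric] by (simp add: algebra_simps)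
  then have "q 1 * (l - v (k - 1)) < q 1 * e" using d by (simp add: algebra_simps)
  then have "v (k - 1) > l - e" using q(3) by simp
  moreover have "k - 1 = n - Suc J" by (simp add: k_def)
  ultimately have "\<forall>j\<le>Suc J. v (n - j) > l - e"
    using n(2) d(2) by (auto simp: le_Suc_eq) (smt (verit))
  then show ?case using n(1) by (intro exI[of _ n]) auto
qed

text \<open>The theorem of Erdos, Feller and Pollard for a distribution \<open>q\<close> with finite
  mean, aperiodic by \<open>q 1 > 0\<close>. With tail probabilities \<open>r\<close>, the
  convolution of \<open>r\<close> and \<open>u\<close> is constantly 1 and \<open>r\<close> sums to
  \<open>\<mu>\<close>. Long windows on which \<open>u\<close> is near its limit superior
  \<open>l\<close> then give \<open>l \<le> 1 / \<mu>\<close>, and the same argument for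
  \<open>- u\<close> bounds the limit inferior from below by \<open>1 / \<mu>\<close>.\<close>

theorem renewal:
  fixes q u :: "nat \<Rightarrow> real"
  assumes q: "\<And>n. q n \<ge> 0" "q 0 = 0" "q 1 > 0" "q sums 1"
    and mean: "(\<lambda>n. real n * q n) sums \<mu>"
    and u0: "u 0 = 1"
    and rec: "\<And>n. n > 0 \<Longrightarrow> u n = (\<Sum>j\<le>n. q j * u (n - j))"
  shows "u \<longlonglongrightarrow> 1 / \<mu>" and "\<And>n. 0 \<le> u n" and "\<And>n. u n \<le> 1"
proof -
  define r where "r n = 1 - (\<Sum>j\<le>n. q j)" for n
  have part: "(\<Sum>j\<in>A. q j) \<le> 1" if "finite A" for A
    using q that by (metis sum_le_suminf sums_iff)
  have r0: "r n \<ge> 0" for n using part[of "{..n}"] by (simp add: r_def)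
  have r_tend: "(\<lambda>n. (\<Sum>j\<le>n. q j)) \<longlonglongrightarrow> 1" using q(4) by (simp add: sums_def_le)
  have u01: "0 \<le> u n \<and> u n \<le> 1" for n
  proof (induction n rule: less_induct)
    case (less n)
    show ?case
    proof (cases "n = 0")
      case False
      have IH: "0 \<le> u (n - j) \<and> u (n - j) \<le> 1" if "j > 0" for j using less that False by auto
      have "0 \<le> q j * u (n - j) \<and> q j * u (n - j) \<le> q j" for j
        using IH[of j] q by (cases "j = 0") (auto intro!: mult_left_le)
      then have "0 \<le> (\<Sum>j\<le>n. q j * u (n - j)) \<and> (\<Sum>j\<le>n. q j * u (n - j)) \<le> (\<Sum>j\<le>n. q j)"
        by (auto intro!: sum_mono sum_nonneg)
      then show ?thesis using rec[of n] False part[of "{..n}"] by auto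
    qed (use u0 in auto)
  qed
  show ub: "0 \<le> u n" "u n \<le> 1" for n using u01 by auto
  \<comment> \<open>In probabilistic terms, the last renewal up to time \<open>n\<close> happens at
    exactly one time \<open>n - k\<close>, and the following gap exceeds \<open>k\<close> with
    probability \<open>r k\<close>.\<close>
  have ru: "(\<Sum>k\<le>n. r k * u (n - k)) = 1" for n
  proof (induction n)
    case 0
    then show ?case using q by (simp add: r_def u0)
  next
    case (Suc n)
    have "(\<Sum>k\<le>Suc n. r k * u (Suc n - k)) = r 0 * u (Suc n) + (\<Sum>k\<le>n. r (Suc k) * u (n - k))"
      by (subst sum.atMost_Suc_shift) simp
    also have "(\<Sum>k\<le>n. r (Suc k) * u (n - k)) = (\<Sum>k\<le>n. r k * u (n - k)) - (\<Sum>k\<le>n. q (Suc k) * u (n - k))"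
      by (simp add: r_def algebra_simps sum.distrib sum_subtractf)
    also have "(\<Sum>k\<le>n. q (Suc k) * u (n - k)) = u (Suc n)"
      using q(2) by (subst rec) (simp, subst sum.atMost_Suc_shift, simp)
    finally show ?case using Suc q by (simp add: r_def)
  qed
  have r_sums: "r sums \<mu>"
  proof -
    \<comment> \<open>Summation by parts; the boundary term tends to 0 because the tail of the mean
      series dominates it.\<close>
    have id: "(\<Sum>k<n. r k) = (\<Sum>j<n. real j * q j) + real n * (1 - (\<Sum>j<n. q j))" for n
    proof (induction n)
      case (Suc n)
      then show ?case by (simp add: r_def algebra_simps lessThan_Suc_atMost[symmetric])
    qed simp
    have t: "(\<lambda>n. \<mu> - (\<Sum>j<n. real j * q j)) \<longlonglongrightarrow> 0"
      using tendsto_diff[OF tendsto_const[of \<mu>] mean[unfolded sums_def]] by simp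
    have "(\<lambda>n. real n * (1 - (\<Sum>j<n. q j))) \<longlonglongrightarrow> 0"
    proof (rule tendsto_sandwich[OF _ _ tendsto_const t])
      show "\<forall>\<^sub>F n in sequentially. 0 \<le> real n * (1 - (\<Sum>j<n. q j))"
        using part by (intro always_eventually) auto
      show "\<forall>\<^sub>F n in sequentially. real n * (1 - (\<Sum>j<n. q j)) \<le> \<mu> - (\<Sum>j<n. real j * q j)"
      proof (intro always_eventually allI)
        fix n
        have "(\<lambda>j. real n * q (j + n)) sums (real n * (1 - (\<Sum>j<n. q j)))"
          by (intro sums_mult sums_split_initial_segment q(4))
        moreover have "(\<lambda>j. real (j + n) * q (j + n)) sums (\<mu> - (\<Sum>j<n. real j * q j))"
          by (rule sums_split_initial_segment[OF mean])
        ultimately show "real n * (1 - (\<Sum>j<n. q j)) \<le> \<mu> - (\<Sum>j<n. real j * q j)"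
          by (rule sums_le[OF mult_right_mono[OF _ q(1)], rotated]) auto
      qed
    qed
    then show ?thesis
      using tendsto_add[OF mean[unfolded sums_def], of "\<lambda>n. real n * (1 - (\<Sum>j<n. q j))" 0]
      by (simp add: sums_def id)
  qed
  have rpart: "(\<Sum>j\<in>A. r j) \<le> \<mu>" if "finite A" for A
    using r0 r_sums that by (metis sum_le_suminf sums_iff)
  have \<mu>: "\<mu> > 0" using rpart[of "{0}"] by (simp add: r_def q)
  \<comment> \<open>Cutting the identity at \<open>J\<close> costs at most the remaining mass of
    \<open>r\<close>, as \<open>u\<close> lies between 0 and 1.\<close>
  have key: "(\<Sum>k\<le>J. r k * u (n - k)) \<le> 1" "1 \<le> (\<Sum>k\<le>J. r k * u (n - k)) + (\<mu> - (\<Sum>k\<le>J. r k))"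
    if "J \<le> n" for J n
  proof -
    have d: "{..n} = {..J} \<union> {Suc J..n}" using that by auto
    have e: "1 = (\<Sum>k\<le>J. r k * u (n - k)) + (\<Sum>k\<in>{Suc J..n}. r k * u (n - k))"
      unfolding ru[of n, symmetric] d by (rule sum.union_disjoint) auto
    show "(\<Sum>k\<le>J. r k * u (n - k)) \<le> 1"
      unfolding e using r0 ub by (auto intro!: sum_nonneg)
    have "(\<Sum>k\<in>{Suc J..n}. r k * u (n - k)) \<le> (\<Sum>k\<in>{Suc J..n}. r k)"
      using r0 ub by (intro sum_mono mult_left_le) auto
    moreover have "(\<Sum>k\<le>J. r k) + (\<Sum>k\<in>{Suc J..n}. r k) = (\<Sum>k\<le>n. r k)"
      unfolding d by (rule sum.union_disjoint[symmetric]) auto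
    ultimately show "1 \<le> (\<Sum>k\<le>J. r k * u (n - k)) + (\<mu> - (\<Sum>k\<le>J. r k))"
      using e rpart[of "{..n}"] by simp
  qed
  have rJ: "(\<lambda>J. \<Sum>k\<le>J. r k) \<longlonglongrightarrow> \<mu>" using r_sums by (simp add: sums_def_le)
  have rJle: "(\<Sum>k\<le>J. r k) \<le> \<mu>" for J by (rule rpart) simp
  obtain l where l: "\<And>e. e > 0 \<Longrightarrow> eventually (\<lambda>n. u n < l + e) sequentially"
    "\<And>e. e > 0 \<Longrightarrow> frequently (\<lambda>n. u n > l - e) sequentially"
  proof (rule limsup_witness[of u 1])
    show "\<bar>u n\<bar> \<le> 1" for n using ub[of n] by simp
  qed (rule that)
  \<comment> \<open>\<open>- l'\<close> is the limit inferior of \<open>u\<close>.\<close>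
  obtain l' where l': "\<And>e. e > 0 \<Longrightarrow> eventually (\<lambda>n. - u n < l' + e) sequentially"
    "\<And>e. e > 0 \<Longrightarrow> frequently (\<lambda>n. - u n > l' - e) sequentially"
  proof (rule limsup_witness[of "\<lambda>n. - u n" 1])
    show "\<bar>- u n\<bar> \<le> 1" for n using ub[of n] by simp
  qed (rule that)
  have "(\<Sum>k\<le>J. r k) * (l - e) \<le> 1" if "e > 0" for J e
  proof -
    have "\<exists>n\<ge>J. \<forall>j\<le>J. u (n - j) > l - e"
    proof (rule renewal_near_limsup[OF q _ rec l that])
      show "\<bar>u n\<bar> \<le> 1" for n using ub[of n] by simp
    qed
    then obtain n where n: "n \<ge> J" "\<And>j. j \<le> J \<Longrightarrow> u (n - j) > l - e" by auto
    have "(\<Sum>k\<le>J. r k) * (l - e) \<le> (\<Sum>k\<le>J. r k * u (n - k))"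
      unfolding sum_distrib_right using n(2) r0 by (intro sum_mono mult_left_mono) (auto intro: less_imp_le)
    then show ?thesis using key(1)[OF n(1)] by linarith
  qed
  \<comment> \<open>\<open>J\<close> tends to infinity at fixed \<open>e\<close>; only afterwards
    does \<open>e\<close> tend to 0.\<close>
  then have "\<mu> * (l - e) \<le> 1" if "e > 0" for e
    using that by (intro LIMSEQ_le_const2[OF tendsto_mult_right[OF rJ]]) auto
  then have "l - e \<le> 1 / \<mu>" if "e > 0" for e using that \<mu> by (simp add: pos_le_divide_eq mult.commute)
  then have "l \<le> 1 / \<mu> + e" if "e > 0" for e using that by (simp add: diff_le_eq)
  then have l1: "l \<le> 1 / \<mu>" by (rule field_le_epsilon)
  have "1 \<le> (\<Sum>k\<le>J. r k) * (- l' + e) + (\<mu> - (\<Sum>k\<le>J. r k))" if "e > 0" for J e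
  proof -
    have "\<exists>n\<ge>J. \<forall>j\<le>J. - u (n - j) > l' - e"
    proof (rule renewal_near_limsup[OF q _ _ l' that])
      show "\<bar>- u n\<bar> \<le> 1" for n using ub[of n] by simp
      show "- u n = (\<Sum>j\<le>n. q j * - u (n - j))" if "n > 0" for n
        using rec[OF that] by (simp add: sum_negf)
    qed
    then obtain n where n: "n \<ge> J" "\<And>j. j \<le> J \<Longrightarrow> - u (n - j) > l' - e" by auto
    have "(\<Sum>k\<le>J. r k * u (n - k)) \<le> (\<Sum>k\<le>J. r k) * (- l' + e)"
      unfolding sum_distrib_right
    proof (intro sum_mono mult_left_mono r0)
      fix i assume "i \<in> {..J}"
      then show "u (n - i) \<le> - l' + e" using n(2)[of i] by auto
    qed
    then show ?thesis using key(2)[OF n(1)] by linarith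
  qed
  then have "1 \<le> \<mu> * (- l' + e) + (\<mu> - \<mu>)" if "e > 0" for e
    using that
    by (intro LIMSEQ_le_const[OF tendsto_add[OF tendsto_mult_right[OF rJ] tendsto_diff[OF tendsto_const rJ]]]) auto
  then have "1 / \<mu> \<le> - l' + e" if "e > 0" for e using that \<mu> by (simp add: pos_divide_le_eq mult.commute)
  then have l2: "1 / \<mu> \<le> - l'" by (rule field_le_epsilon)
  show "u \<longlonglongrightarrow> 1 / \<mu>"
  proof (rule order_tendstoI)
    fix a assume "a < 1 / \<mu>"
    then have "eventually (\<lambda>n. - u n < l' + (- l' - a)) sequentially" using l2 by (intro l') auto
    then show "eventually (\<lambda>n. a < u n) sequentially" by simp
  next
    fix a assume "a > 1 / \<mu>"
    then have "eventually (\<lambda>n. u n < l + (a - l)) sequentially" using l1 by (intro l) auto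
    then show "eventually (\<lambda>n. u n < a) sequentially" by simp
  qed
qed

text \<open>Tannery's theorem: the terms, extended by 0 for \<open>j > n\<close>, converge one by
  one and are dominated by \<open>w j * B\<close>, where \<open>B\<close> bounds
  \<open>u\<close>.\<close>

lemma convolution_tendsto:
  fixes w u :: "nat \<Rightarrow> real"
  assumes w: "\<And>n. w n \<ge> 0" "w sums W" and u: "u \<longlonglongrightarrow> L"
  shows "(\<lambda>n. \<Sum>j\<le>n. w j * u (n - j)) \<longlonglongrightarrow> W * L"
proof -
  obtain B where B: "\<And>n. \<bar>u n\<bar> \<le> B"
    using convergentI[OF u, THEN convergent_imp_Bseq] by (auto simp: Bseq_def)
  then have B0: "B \<ge> 0" using abs_ge_zero order_trans by blast
  define a where "a j n = (if j \<le> n then w j * u (n - j) else 0)" for j n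
  have "(\<lambda>n. \<Sum>j. a j n) \<longlonglongrightarrow> (\<Sum>j. w j * L)"
  proof (rule tannerys_theorem[of _ _ _ "\<lambda>j. w j * B", THEN conjunct2, THEN conjunct2])
    show "(\<lambda>n. a j n) \<longlonglongrightarrow> w j * L" for j
    proof (rule Lim_transform_eventually)
      show "(\<lambda>n. w j * u (n - j)) \<longlonglongrightarrow> w j * L"
        by (intro tendsto_intros filterlim_compose[OF u filterlim_minus_const_nat_at_top])
      show "\<forall>\<^sub>F n in sequentially. w j * u (n - j) = a j n"
        using eventually_ge_at_top[of j] by eventually_elim (simp add: a_def)
    qed
    have "norm (a j n) \<le> w j * B" for j n
      using w B B0 by (auto simp: a_def abs_mult intro!: mult_left_mono)
    then show "\<forall>\<^sub>F (j, n) in sequentially \<times>\<^sub>F sequentially. norm (a j n) \<le> w j * B"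
      by (intro always_eventually) auto
    show "summable (\<lambda>j. w j * B)" using w(2) by (intro summable_mult2) (auto simp: sums_iff)
  qed simp
  also have "(\<Sum>j. w j * L) = W * L" using sums_mult2[OF w(2)] by (simp add: sums_iff)
  also have "(\<lambda>n. \<Sum>j. a j n) = (\<lambda>n. \<Sum>j\<le>n. w j * u (n - j))"
  proof
    fix n
    have "(\<Sum>j. a j n) = (\<Sum>j\<le>n. a j n)" by (rule suminf_finite) (auto simp: a_def)
    then show "(\<Sum>j. a j n) = (\<Sum>j\<le>n. w j * u (n - j))" by (simp add: a_def)
  qed
  finally show ?thesis .
qed

section \<open>Graph isomorphisms and paths\<close>

definition nbrs :: "'a set set \<Rightarrow> 'a \<Rightarrow> 'a set" where
  "nbrs E v = {u. {v, u} \<in> E}"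

text \<open>Names the witness that \<open>graph_isomorphic\<close> hides, so that isomorphisms can
  be inverted, composed and evaluated at single vertices.\<close>

definition graph_iso :: "('a \<Rightarrow> 'b) \<Rightarrow> 'a set \<Rightarrow> 'a set set \<Rightarrow> 'b set \<Rightarrow> 'b set set \<Rightarrow> bool" where
  "graph_iso f V E W F \<longleftrightarrow> bij_betw f V W \<and> (\<forall>u\<in>V. \<forall>v\<in>V. {u, v} \<in> E \<longleftrightarrow> {f u, f v} \<in> F)"

lemma graph_isomorphic_iff: "graph_isomorphic V E W F \<longleftrightarrow> (\<exists>f. graph_iso f V E W F)"
  by (simp add: graph_isomorphic_def graph_iso_def)

lemma graph_iso_inv:
  assumes "graph_iso f V E W F"
  shows "graph_iso (the_inv_into V f) W F V E"
proof -
  have b: "bij_betw f V W" and e: "\<And>u v. u \<in> V \<Longrightarrow> v \<in> V \<Longrightarrow> {u, v} \<in> E \<longleftrightarrow> {f u, f v} \<in> F"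
    using assms by (auto simp: graph_iso_def)
  have i: "the_inv_into V f w \<in> V" "f (the_inv_into V f w) = w" if "w \<in> W" for w
    using that bij_betwE[OF bij_betw_the_inv_into[OF b]] f_the_inv_into_f_bij_betw[OF b] by auto
  have "{u, v} \<in> F \<longleftrightarrow> {the_inv_into V f u, the_inv_into V f v} \<in> E" if "u \<in> W" "v \<in> W" for u v
    using e[of "the_inv_into V f u" "the_inv_into V f v"] i[OF that(1)] i[OF that(2)] by simp
  then show ?thesis using bij_betw_the_inv_into[OF b] by (auto simp: graph_iso_def)
qed

lemma graph_iso_comp:
  assumes "graph_iso f V E W F" "graph_iso g W F X D"
  shows "graph_iso (g \<circ> f) V E X D"
  using assms bij_betw_trans[of f V W g X] by (auto simp: graph_iso_def dest: bij_betwE)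

lemma graph_isomorphic_sym: "graph_isomorphic V E W F \<Longrightarrow> graph_isomorphic W F V E"
  using graph_iso_inv graph_isomorphic_iff by metis

lemma graph_isomorphic_trans:
  "graph_isomorphic V E W F \<Longrightarrow> graph_isomorphic W F X D \<Longrightarrow> graph_isomorphic V E X D"
  using graph_iso_comp graph_isomorphic_iff by metis

lemma simple_graph_edgeD:
  assumes "simple_graph V E" "{u, v} \<in> E"
  shows "u \<in> V" "v \<in> V" "u \<noteq> v"
  using assms by (auto simp: simple_graph_def)

lemma nbrs_subset: "simple_graph V E \<Longrightarrow> nbrs E v \<subseteq> V"
  by (auto simp: nbrs_def dest: simple_graph_edgeD)

lemma finite_nbrs: "simple_graph V E \<Longrightarrow> finite (nbrs E v)"
  using nbrs_subset[of V E v] by (auto simp: simple_graph_def intro: finite_subset)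

lemma graph_degree_eq_card_nbrs:
  assumes "simple_graph V E"
  shows "graph_degree E v = card (nbrs E v)"
proof -
  have "bij_betw (\<lambda>u. {v, u}) (nbrs E v) {e \<in> E. v \<in> e}"
  proof (rule bij_betwI')
    fix x y show "({v, x} = {v, y}) = (x = y)" by (auto simp: doubleton_eq_iff)
  next
    fix x assume "x \<in> nbrs E v"
    then show "{v, x} \<in> {e \<in> E. v \<in> e}" by (simp add: nbrs_def)
  next
    fix e assume e: "e \<in> {e \<in> E. v \<in> e}"
    then have "card e = 2" using assms by (auto simp: simple_graph_def)
    then obtain a b where "e = {a, b}" by (auto simp: card_2_iff)
    with e show "\<exists>x\<in>nbrs E v. e = {v, x}" by (auto simp: nbrs_def insert_commute)
  qed
  then show ?thesis by (simp add: graph_degree_def bij_betw_same_card)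
qed

lemma graph_iso_nbrs:
  assumes f: "graph_iso f V E W F" and s: "simple_graph V E" "simple_graph W F" and v: "v \<in> V"
  shows "nbrs F (f v) = f ` nbrs E v"
proof -
  have b: "bij_betw f V W" and e: "\<And>u v. u \<in> V \<Longrightarrow> v \<in> V \<Longrightarrow> {u, v} \<in> E \<longleftrightarrow> {f u, f v} \<in> F"
    using f by (auto simp: graph_iso_def)
  show ?thesis
  proof (intro equalityI subsetI)
    fix w assume w: "w \<in> nbrs F (f v)"
    then have "w \<in> W" using nbrs_subset[OF s(2)] by blast
    then obtain u where "u \<in> V" "w = f u" using b by (auto simp: bij_betw_def)
    then show "w \<in> f ` nbrs E v" using w v e by (auto simp: nbrs_def)
  next
    fix w assume "w \<in> f ` nbrs E v"
    then obtain u where u: "u \<in> nbrs E v" "w = f u" by auto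
    then have "u \<in> V" using nbrs_subset[OF s(1)] by blast
    then show "w \<in> nbrs F (f v)" using u v e by (auto simp: nbrs_def)
  qed
qed

lemma graph_iso_card_nbrs:
  assumes f: "graph_iso f V E W F" and s: "simple_graph V E" "simple_graph W F" and v: "v \<in> V"
  shows "card (nbrs F (f v)) = card (nbrs E v)"
proof -
  have "inj_on f (nbrs E v)"
    using f nbrs_subset[OF s(1)] by (auto simp: graph_iso_def bij_betw_def intro: inj_on_subset)
  then show ?thesis using graph_iso_nbrs[OF assms] by (simp add: card_image)
qed

lemma graph_path_map:
  assumes f: "graph_iso f V E W F" and p: "graph_path V E p"
  shows "graph_path W F (map f p)"
proof -
  have b: "bij_betw f V W" and e: "\<And>u v. u \<in> V \<Longrightarrow> v \<in> V \<Longrightarrow> {u, v} \<in> E \<longleftrightarrow> {f u, f v} \<in> F"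
    using f by (auto simp: graph_iso_def)
  have "p ! i \<in> V" if "i < length p" for i using p that by (auto simp: graph_path_def)
  then show ?thesis using p b e
    by (auto simp: graph_path_def distinct_map bij_betw_def intro: inj_on_subset)
qed

lemma induced_path_map:
  assumes f: "graph_iso f V E W F" and p: "induced_path V E p"
  shows "induced_path W F (map f p)"
proof -
  have e: "\<And>u v. u \<in> V \<Longrightarrow> v \<in> V \<Longrightarrow> {u, v} \<in> E \<longleftrightarrow> {f u, f v} \<in> F"
    using f by (auto simp: graph_iso_def)
  have "p ! i \<in> V" if "i < length p" for i using p that by (auto simp: induced_path_def graph_path_def)
  then show ?thesis using p e graph_path_map[OF f, of p] by (auto simp: induced_path_def)
qed

lemma graph_cycle_map:
  assumes f: "graph_iso f V E W F" and p: "graph_cycle V E p"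
  shows "graph_cycle W F (map f p)"
proof -
  have e: "\<And>u v. u \<in> V \<Longrightarrow> v \<in> V \<Longrightarrow> {u, v} \<in> E \<longleftrightarrow> {f u, f v} \<in> F"
    using f by (auto simp: graph_iso_def)
  have "p \<noteq> []" "hd p \<in> V" "last p \<in> V" using p by (auto simp: graph_cycle_def graph_path_def)
  then show ?thesis using p e[of "last p" "hd p"] graph_path_map[OF f, of p]
    by (auto simp: graph_cycle_def last_map hd_map)
qed

lemma graph_iso_tree:
  assumes f: "graph_iso f V E W F" and W: "simple_graph W F" and t: "tree V E"
  shows "tree W F"
proof -
  note f' = graph_iso_inv[OF f]
  have b: "bij_betw f V W" using f by (auto simp: graph_iso_def)
  have "V \<noteq> {}" using t by (auto simp: tree_def graph_connected_def)
  then have "W \<noteq> {}" using b by (auto simp: bij_betw_def)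
  moreover have "\<exists>p. graph_path W F p \<and> hd p = u \<and> last p = v" if "u \<in> W" "v \<in> W" for u v
  proof -
    obtain u' v' where uv: "u' \<in> V" "u = f u'" "v' \<in> V" "v = f v'"
      using \<open>u \<in> W\<close> \<open>v \<in> W\<close> b by (auto simp: bij_betw_def)
    then obtain p where "graph_path V E p" "hd p = u'" "last p = v'"
      using t unfolding tree_def graph_connected_def by blast
    then have "graph_path W F (map f p) \<and> hd (map f p) = u \<and> last (map f p) = v"
      using graph_path_map[OF f, of p] uv by (auto simp: graph_path_def last_map hd_map)
    then show ?thesis by blast
  qed
  moreover have "\<nexists>p. graph_cycle W F p"
    using graph_cycle_map[OF f'] t by (auto simp: tree_def)
  ultimately show ?thesis using W by (auto simp: tree_def graph_connected_def)
qed

lemma graph_iso_linear_tree: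
  assumes f: "graph_iso f V E W F" and W: "simple_graph W F" and t: "linear_tree V E"
  shows "linear_tree W F"
proof -
  have V: "simple_graph V E" using t by (auto simp: linear_tree_def tree_def)
  obtain p where p: "induced_path V E p" "high_degree_vertices V E \<subseteq> set p"
    using t by (auto simp: linear_tree_def)
  have "high_degree_vertices W F \<subseteq> set (map f p)"
  proof
    fix w assume w: "w \<in> high_degree_vertices W F"
    then obtain v where v: "v \<in> V" "w = f v"
      using f by (auto simp: high_degree_vertices_def graph_iso_def bij_betw_def)
    then have "v \<in> high_degree_vertices V E"
      using w graph_iso_card_nbrs[OF f V W v(1)]
      by (simp add: high_degree_vertices_def graph_degree_eq_card_nbrs[OF V] graph_degree_eq_card_nbrs[OF W])
    then show "w \<in> set (map f p)" using v p by auto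
  qed
  then show ?thesis
    using graph_iso_tree[OF f W] induced_path_map[OF f p(1)] t unfolding linear_tree_def by blast
qed

text \<open>A walk is kept a path while it grows: if the next vertex already occurs, the path is cut
  at that occurrence.\<close>

lemma exists_path:
  assumes r: "(u, v) \<in> {(x, y). x \<in> V \<and> y \<in> V \<and> {x, y} \<in> E}\<^sup>*" and u: "u \<in> V"
  shows "\<exists>p. graph_path V E p \<and> hd p = u \<and> last p = v"
  using r
proof (induction rule: rtrancl_induct)
  case base
  show ?case using u by (intro exI[of _ "[u]"]) (auto simp: graph_path_def)
next
  case (step y z)
  then obtain p where p: "graph_path V E p" "hd p = u" "last p = y" by blast
  have yz: "y \<in> V" "z \<in> V" "{y, z} \<in> E" using step by auto
  show ?case
  proof (cases "z \<in> set p")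
    case True
    then obtain a b where ab: "p = a @ z # b" by (meson split_list)
    have "{(a @ [z]) ! i, (a @ [z]) ! Suc i} \<in> E" if "Suc i < length (a @ [z])" for i
    proof -
      have "{p ! i, p ! Suc i} \<in> E" using p that ab by (auto simp: graph_path_def)
      moreover have "p = (a @ [z]) @ b" using ab by simp
      then have "(a @ [z]) ! j = p ! j" if "j < length (a @ [z])" for j
        using that by (metis nth_append)
      ultimately show ?thesis using that by (metis Suc_lessD)
    qed
    then have "graph_path V E (a @ [z])" using p ab by (auto simp: graph_path_def)
    moreover have "hd (a @ [z]) = u" using p ab by (cases a) auto
    ultimately show ?thesis by (intro exI[of _ "a @ [z]"]) auto
  next
    case False
    have ne: "p \<noteq> []" using p by (auto simp: graph_path_def)
    have "{(p @ [z]) ! i, (p @ [z]) ! Suc i} \<in> E" if "Suc i < length (p @ [z])" for i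
    proof (cases "Suc i < length p")
      case True
      then show ?thesis using p by (auto simp: graph_path_def nth_append)
    next
      case False
      then have "i = length p - 1" using that by auto
      then show ?thesis using yz p ne by (auto simp: nth_append last_conv_nth)
    qed
    then have "graph_path V E (p @ [z])" using p False yz by (auto simp: graph_path_def)
    then show ?thesis using p ne by (intro exI[of _ "p @ [z]"]) auto
  qed
qed

text \<open>The neighbours along the cycle, with indices wrapping around; they differ because the
  length is at least 3. A vertex that is extremal on a cycle can thus lead to a
  contradiction.\<close>

lemma graph_cycle_two_nbrs:
  assumes "graph_cycle V E p" "x \<in> set p"
  obtains y z where "y \<in> set p" "z \<in> set p" "y \<noteq> z" "{x, y} \<in> E" "{x, z} \<in> E"
proof -
  define L where "L = length p"
  have L: "L \<ge> 3" and d: "distinct p" and ne: "p \<noteq> []"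
    and e: "\<And>i. Suc i < L \<Longrightarrow> {p ! i, p ! Suc i} \<in> E" and c: "{p ! (L - 1), p ! 0} \<in> E"
    using assms(1) by (auto simp: graph_cycle_def graph_path_def L_def last_conv_nth hd_conv_nth)
  obtain i where i: "i < L" "x = p ! i" using assms(2) by (auto simp: in_set_conv_nth L_def)
  define a where "a = (if Suc i < L then Suc i else 0)"
  define b where "b = (if i = 0 then L - 1 else i - 1)"
  have ab: "a < L" "b < L" "a \<noteq> b" using i L by (auto simp: a_def b_def)
  have "{x, p ! a} \<in> E"
  proof (cases "Suc i < L")
    case False
    then have "i = L - 1" using i by auto
    then show ?thesis using c False i by (simp add: a_def)
  qed (use e i in \<open>auto simp: a_def\<close>)
  moreover have "{x, p ! b} \<in> E"
    using c e[of "i - 1"] i by (cases "i = 0") (auto simp: b_def insert_commute)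
  ultimately show ?thesis
    using that[of "p ! a" "p ! b"] ab d by (auto simp: nth_eq_iff_index_eq L_def)
qed

text \<open>The edge joins the first vertex outside \<open>S\<close> to its predecessor.\<close>

lemma crossing_edge:
  assumes p: "graph_path V E p" and "hd p \<in> S" "last p \<notin> S"
  obtains u v where "u \<in> S" "v \<in> V - S" "{u, v} \<in> E"
proof -
  have ne: "p \<noteq> []" using p by (auto simp: graph_path_def)
  define i where "i = (LEAST i. i < length p \<and> p ! i \<notin> S)"
  have "length p - 1 < length p \<and> p ! (length p - 1) \<notin> S" using assms ne by (auto simp: last_conv_nth)
  then have i: "i < length p" "p ! i \<notin> S" unfolding i_def by (metis (mono_tags, lifting) LeastI)+
  have "i \<noteq> 0" using i assms(2) ne by (cases "i = 0") (auto simp: hd_conv_nth)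
  then obtain j where j: "i = Suc j" by (cases i) auto
  then have "p ! j \<in> S" using i not_less_Least[of j "\<lambda>i. i < length p \<and> p ! i \<notin> S"] by (auto simp: i_def[symmetric])
  moreover have "p ! i \<in> V - S" "{p ! j, p ! i} \<in> E" using i j p by (auto simp: graph_path_def)
  ultimately show ?thesis by (rule that)
qed

section \<open>Caterpillars with paths attached\<close>

text \<open>
  In the caterpillar of a code \<open>c\<close>, the \<open>i\<close>-th spine vertex carries one pendant path of length \<open>c ! i ! j\<close>
  for each \<open>j < length (c ! i)\<close>, and \<open>Branch i j k\<close> is the \<open>k\<close>-th vertex of that path, counted from the spine.
\<close>

datatype vertex = Spine nat | Branch nat nat nat

fun vertex_adj :: "vertex \<Rightarrow> vertex \<Rightarrow> bool" where
  "vertex_adj (Spine i) (Spine i') \<longleftrightarrow> i' = Suc i \<or> i = Suc i'"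
| "vertex_adj (Spine i) (Branch i' j k) \<longleftrightarrow> i' = i \<and> k = 0"
| "vertex_adj (Branch i j k) (Spine i') \<longleftrightarrow> i' = i \<and> k = 0"
| "vertex_adj (Branch i j k) (Branch i' j' k') \<longleftrightarrow> i' = i \<and> j' = j \<and> (k' = Suc k \<or> k = Suc k')"

definition cat_verts :: "nat list list \<Rightarrow> vertex set" where
  "cat_verts c = Spine ` {..<length c} \<union>
     {Branch i j k | i j k. i < length c \<and> j < length (c ! i) \<and> k < c ! i ! j}"

definition cat_edges :: "nat list list \<Rightarrow> vertex set set" where
  "cat_edges c = {{u, v} | u v. u \<in> cat_verts c \<and> v \<in> cat_verts c \<and> vertex_adj u v}"

lemma Spine_in_cat_verts [simp]: "Spine i \<in> cat_verts c \<longleftrightarrow> i < length c"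
  by (auto simp: cat_verts_def)

lemma Branch_in_cat_verts [simp]:
  "Branch i j k \<in> cat_verts c \<longleftrightarrow> i < length c \<and> j < length (c ! i) \<and> k < c ! i ! j"
  by (auto simp: cat_verts_def)

lemma vertex_adj_sym: "vertex_adj u v \<longleftrightarrow> vertex_adj v u"
  by (cases u; cases v) auto

lemma vertex_adj_irrefl: "\<not> vertex_adj u u"
  by (cases u) auto

lemma cat_edges_iff:
  "{u, v} \<in> cat_edges c \<longleftrightarrow> u \<in> cat_verts c \<and> v \<in> cat_verts c \<and> vertex_adj u v"
  by (auto simp: cat_edges_def doubleton_eq_iff vertex_adj_sym)

lemma cat_verts_eq:
  "cat_verts c = Spine ` {..<length c} \<union>
     (\<Union>i<length c. \<Union>j<length (c ! i). Branch i j ` {..<c ! i ! j})"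
  by (auto simp: cat_verts_def)

lemma finite_cat_verts: "finite (cat_verts c)"
  by (simp add: cat_verts_eq)

definition weight :: "nat list list \<Rightarrow> nat" where
  "weight c = (\<Sum>b\<leftarrow>c. Suc (sum_list b))"

lemma weight_simps [simp]:
  "weight [] = 0" "weight (b # c) = Suc (sum_list b) + weight c" "weight (c @ d) = weight c + weight d"
  by (simp_all add: weight_def)

lemma weight_rev [simp]: "weight (rev c) = weight c"
  by (induction c) auto

lemma card_cat_verts: "card (cat_verts c) = weight c"
proof -
  have a: "card (\<Union>j<length b. Branch i j ` {..<b ! j}) = sum_list b" for i b
  proof -
    have "card (\<Union>j<length b. Branch i j ` {..<b ! j}) = (\<Sum>j<length b. card (Branch i j ` {..<b ! j}))"
      by (rule card_UN_disjoint) auto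
    also have "\<dots> = (\<Sum>j<length b. b ! j)"
      by (intro sum.cong) (auto simp: card_image inj_on_def)
    finally show ?thesis by (simp add: sum_list_sum_nth atLeast0LessThan)
  qed
  have "card (cat_verts c) = card (Spine ` {..<length c}) +
      card (\<Union>i<length c. \<Union>j<length (c ! i). Branch i j ` {..<c ! i ! j})"
    unfolding cat_verts_eq by (rule card_Un_disjoint) auto
  also have "card (Spine ` {..<length c}) = length c" by (simp add: card_image inj_on_def)
  also have "card (\<Union>i<length c. \<Union>j<length (c ! i). Branch i j ` {..<c ! i ! j}) =
      (\<Sum>i<length c. card (\<Union>j<length (c ! i). Branch i j ` {..<c ! i ! j}))"
    by (rule card_UN_disjoint) auto
  also have "length c + \<dots> = (\<Sum>i<length c. Suc (sum_list (c ! i)))"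
    by (simp only: a sum.distrib Suc_eq_plus1) simp
  finally show ?thesis by (simp add: weight_def sum_list_sum_nth atLeast0LessThan)
qed

lemma simple_graph_cat: "simple_graph (cat_verts c) (cat_edges c)"
proof -
  have "e \<subseteq> cat_verts c \<and> card e = 2" if "e \<in> cat_edges c" for e
  proof -
    obtain u v where uv: "e = {u, v}" "u \<in> cat_verts c" "v \<in> cat_verts c" "vertex_adj u v"
      using \<open>e \<in> cat_edges c\<close> by (auto simp: cat_edges_def)
    then have "u \<noteq> v" using vertex_adj_irrefl by blast
    then show ?thesis using uv by simp
  qed
  then show ?thesis by (simp add: simple_graph_def finite_cat_verts)
qed

lemma cat_connected:
  assumes "u \<in> cat_verts c" "v \<in> cat_verts c"
  shows "\<exists>p. graph_path (cat_verts c) (cat_edges c) p \<and> hd p = u \<and> last p = v"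
proof -
  define R where "R = {(x, y). x \<in> cat_verts c \<and> y \<in> cat_verts c \<and> {x, y} \<in> cat_edges c}"
  have "sym R" by (auto simp: R_def sym_def insert_commute)
  then have s: "sym (R\<^sup>*)" by (rule sym_rtrancl)
  have sp: "(Spine 0, Spine i) \<in> R\<^sup>*" if "i < length c" for i
    using that
  proof (induction i)
    case (Suc i)
    then have "(Spine 0, Spine i) \<in> R\<^sup>*" "(Spine i, Spine (Suc i)) \<in> R" by (auto simp: R_def cat_edges_iff)
    then show ?case by simp
  qed simp
  have br: "(Spine i, Branch i j k) \<in> R\<^sup>*" if "i < length c" "j < length (c ! i)" "k < c ! i ! j" for i j k
    using that
  proof (induction k)
    case 0
    then have "(Spine i, Branch i j 0) \<in> R" by (auto simp: R_def cat_edges_iff)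
    then show ?case by simp
  next
    case (Suc k)
    then have "(Spine i, Branch i j k) \<in> R\<^sup>*" "(Branch i j k, Branch i j (Suc k)) \<in> R" by (auto simp: R_def cat_edges_iff)
    then show ?case by simp
  qed
  have "(Spine 0, w) \<in> R\<^sup>*" if "w \<in> cat_verts c" for w
  proof (cases w)
    case (Branch i j k)
    then show ?thesis using that rtrancl_trans[OF sp[of i] br[of i j k]] by auto
  qed (use that sp in auto)
  then have "(u, v) \<in> R\<^sup>*" using assms s by (meson rtrancl_trans symE)
  then show ?thesis unfolding R_def using assms(1) by (rule exists_path)
qed

text \<open>Distance from \<open>Spine 0\<close>, taken as the root.\<close>

fun depth :: "vertex \<Rightarrow> nat" where
  "depth (Spine i) = i"
| "depth (Branch i j k) = i + Suc k"

text \<open>Depths of adjacent vertices differ by one, so a neighbour that is not deeper is the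
  parent in the rooted tree.\<close>

lemma vertex_adj_lower_unique:
  "vertex_adj x y \<Longrightarrow> vertex_adj x z \<Longrightarrow> depth y \<le> depth x \<Longrightarrow> depth z \<le> depth x \<Longrightarrow> y = z"
  by (cases x; cases y; cases z) auto

text \<open>A deepest vertex of a cycle would have two different neighbours not deeper than
  itself.\<close>

lemma cat_acyclic: "\<nexists>p. graph_cycle (cat_verts c) (cat_edges c) p"
proof
  assume "\<exists>p. graph_cycle (cat_verts c) (cat_edges c) p"
  then obtain p where p: "graph_cycle (cat_verts c) (cat_edges c) p" by blast
  then have ne: "set p \<noteq> {}" by (auto simp: graph_cycle_def)
  have "Max (depth ` set p) \<in> depth ` set p" using ne by (intro Max_in) auto
  then obtain x where x: "x \<in> set p" "Max (depth ` set p) = depth x" by blast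
  have max: "depth y \<le> depth x" if "y \<in> set p" for y
    unfolding x(2)[symmetric] using that by (intro Max_ge) auto
  obtain y z where yz: "y \<in> set p" "z \<in> set p" "y \<noteq> z" "{x, y} \<in> cat_edges c" "{x, z} \<in> cat_edges c"
    using graph_cycle_two_nbrs[OF p x(1)] by blast
  then show False using vertex_adj_lower_unique[of x y z] max by (auto simp: cat_edges_iff)
qed

lemma tree_cat: "c \<noteq> [] \<Longrightarrow> tree (cat_verts c) (cat_edges c)"
  using simple_graph_cat cat_connected cat_acyclic
  by (auto simp: tree_def graph_connected_def) (metis Spine_in_cat_verts empty_iff length_greater_0_conv)

text \<open>A part 0 would occupy an index \<open>j\<close> without providing a vertex
  \<open>Branch i j 0\<close>; for positive parts the branches at \<open>Spine i\<close> correspond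
  to the indices.\<close>

lemma nbrs_Spine:
  assumes "i < length c" "0 \<notin> set (c ! i)"
  shows "nbrs (cat_edges c) (Spine i) = (if i = 0 then {} else {Spine (i - 1)}) \<union>
    (if Suc i < length c then {Spine (Suc i)} else {}) \<union> (\<lambda>j. Branch i j 0) ` {..<length (c ! i)}"
proof -
  have "0 < c ! i ! j" if "j < length (c ! i)" for j using assms that by (metis gr0I nth_mem)
  then have "v \<in> nbrs (cat_edges c) (Spine i) \<longleftrightarrow> v \<in> (if i = 0 then {} else {Spine (i - 1)}) \<union>
    (if Suc i < length c then {Spine (Suc i)} else {}) \<union> (\<lambda>j. Branch i j 0) ` {..<length (c ! i)}" for v
    using assms by (cases v) (auto simp: nbrs_def cat_edges_iff)
  then show ?thesis by blast
qed

lemma card_nbrs_Spine: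
  assumes "i < length c" "0 \<notin> set (c ! i)"
  shows "card (nbrs (cat_edges c) (Spine i)) = of_bool (i \<noteq> 0) + of_bool (Suc i < length c) + length (c ! i)"
proof -
  let ?A = "(if i = 0 then {} else {Spine (i - 1)})" and ?B = "(if Suc i < length c then {Spine (Suc i)} else {})"
    and ?C = "(\<lambda>j. Branch i j 0) ` {..<length (c ! i)}"
  have "card (?A \<union> ?B \<union> ?C) = card (?A \<union> ?B) + card ?C" by (rule card_Un_disjoint) auto
  also have "card (?A \<union> ?B) = card ?A + card ?B" by (rule card_Un_disjoint) auto
  also have "card ?C = length (c ! i)" by (simp add: card_image inj_on_def)
  finally show ?thesis unfolding nbrs_Spine[OF assms] by simp
qed

text \<open>The neighbour towards \<open>Spine 0\<close>; truncated subtraction sends the root to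
  itself.\<close>

fun vertex_parent :: "vertex \<Rightarrow> vertex" where
  "vertex_parent (Spine i) = Spine (i - 1)"
| "vertex_parent (Branch i j k) = (if k = 0 then Spine i else Branch i j (k - 1))"

lemma nbrs_Branch:
  assumes "Branch i j k \<in> cat_verts c"
  shows "nbrs (cat_edges c) (Branch i j k) = {vertex_parent (Branch i j k)} \<union>
    (if Suc k < c ! i ! j then {Branch i j (Suc k)} else {})"
proof -
  have "v \<in> nbrs (cat_edges c) (Branch i j k) \<longleftrightarrow> v \<in> {vertex_parent (Branch i j k)} \<union>
    (if Suc k < c ! i ! j then {Branch i j (Suc k)} else {})" for v
    using assms by (cases v) (auto simp: nbrs_def cat_edges_iff)
  then show ?thesis by blast
qed

lemma card_nbrs_Branch:
  assumes "Branch i j k \<in> cat_verts c"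
  shows "card (nbrs (cat_edges c) (Branch i j k)) = Suc (of_bool (Suc k < c ! i ! j))"
  unfolding nbrs_Branch[OF assms] by (subst card_Un_disjoint) auto

text \<open>Branch vertices have degree at most 2, so the spine is an induced path through all
  HDVs.\<close>

lemma linear_tree_cat:
  assumes "c \<noteq> []"
  shows "linear_tree (cat_verts c) (cat_edges c)"
proof -
  have "induced_path (cat_verts c) (cat_edges c) (map Spine [0..<length c])"
    using assms by (auto simp: induced_path_def graph_path_def cat_edges_iff distinct_map inj_on_def)
  moreover have "high_degree_vertices (cat_verts c) (cat_edges c) \<subseteq> set (map Spine [0..<length c])"
  proof
    fix v assume v: "v \<in> high_degree_vertices (cat_verts c) (cat_edges c)"
    then have "v \<in> cat_verts c" "card (nbrs (cat_edges c) v) \<ge> 3"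
      by (auto simp: high_degree_vertices_def graph_degree_eq_card_nbrs[OF simple_graph_cat])
    then show "v \<in> set (map Spine [0..<length c])"
      using card_nbrs_Branch by (cases v) (auto split: if_splits simp: of_bool_def)
  qed
  ultimately show ?thesis using tree_cat[OF assms] unfolding linear_tree_def by blast
qed

text \<open>Spine positions are permuted by \<open>g\<close> and the branches at position
  \<open>i\<close> by \<open>h i\<close>, while the position inside a branch is kept. Reversing a
  code and sorting its partitions are both of this form.\<close>

lemma graph_iso_catI:
  assumes len: "length c' = length c"
    and g: "bij_betw g {..<length c} {..<length c}"
    and adj: "\<And>i i'. i < length c \<Longrightarrow> i' < length c \<Longrightarrow> (g i' = Suc (g i) \<or> g i = Suc (g i')) \<longleftrightarrow> (i' = Suc i \<or> i = Suc i')"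
    and h: "\<And>i. i < length c \<Longrightarrow> bij_betw (h i) {..<length (c ! i)} {..<length (c' ! g i)}"
    and nth: "\<And>i j. i < length c \<Longrightarrow> j < length (c ! i) \<Longrightarrow> c' ! g i ! h i j = c ! i ! j"
  shows "graph_iso (\<lambda>v. case v of Spine i \<Rightarrow> Spine (g i) | Branch i j k \<Rightarrow> Branch (g i) (h i j) k)
    (cat_verts c) (cat_edges c) (cat_verts c') (cat_edges c')"
proof -
  define f where "f v = (case v of Spine i \<Rightarrow> Spine (g i) | Branch i j k \<Rightarrow> Branch (g i) (h i j) k)" for v
  have g1: "g i < length c" if "i < length c" for i using g that by (auto dest: bij_betwE)
  have g2: "g i = g i' \<longleftrightarrow> i = i'" if "i < length c" "i' < length c" for i i'
    using g that by (auto simp: bij_betw_def inj_on_def)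
  have g3: "\<exists>i<length c. g i = i'" if "i' < length c" for i'
    using g that unfolding bij_betw_def by (metis imageE lessThan_iff)
  have h1: "h i j < length (c' ! g i)" if "i < length c" "j < length (c ! i)" for i j
    using h[OF that(1)] that by (auto dest: bij_betwE)
  have h2: "h i j = h i j' \<longleftrightarrow> j = j'" if "i < length c" "j < length (c ! i)" "j' < length (c ! i)" for i j j'
    using h[OF that(1)] that by (auto simp: bij_betw_def inj_on_def)
  have h3: "\<exists>j<length (c ! i). h i j = j'" if "i < length c" "j' < length (c' ! g i)" for i j'
    using h[OF that(1)] that unfolding bij_betw_def by (metis imageE lessThan_iff)
  have inj: "inj_on f (cat_verts c)"
  proof (rule inj_onI)
    fix u v assume "u \<in> cat_verts c" "v \<in> cat_verts c" "f u = f v"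
    then show "u = v" using g2 h2 by (cases u; cases v) (auto simp: f_def)
  qed
  have "f u \<in> cat_verts c'" if "u \<in> cat_verts c" for u
    using that g1 h1 nth len by (cases u) (auto simp: f_def)
  moreover have "w \<in> f ` cat_verts c" if "w \<in> cat_verts c'" for w
  proof (cases w)
    case (Spine i)
    with that g3 len obtain i0 where "i0 < length c" "g i0 = i" by auto
    then have "Spine i0 \<in> cat_verts c" "f (Spine i0) = w" by (auto simp: f_def Spine)
    then show ?thesis by blast
  next
    case (Branch i j k)
    with that g3 len obtain i0 where i0: "i0 < length c" "g i0 = i" by auto
    with that h3 Branch obtain j0 where "j0 < length (c ! i0)" "h i0 j0 = j" by auto
    then have "Branch i0 j0 k \<in> cat_verts c" "f (Branch i0 j0 k) = w"
      using i0 nth that Branch by (auto simp: f_def)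
    then show ?thesis by blast
  qed
  ultimately have im: "f ` cat_verts c = cat_verts c'" by blast
  have "vertex_adj u v \<longleftrightarrow> vertex_adj (f u) (f v)" if "u \<in> cat_verts c" "v \<in> cat_verts c" for u v
    using that adj g2 h2 by (cases u; cases v) (auto simp: f_def)
  then have "graph_iso f (cat_verts c) (cat_edges c) (cat_verts c') (cat_edges c')"
    using inj im by (auto simp: graph_iso_def bij_betw_def cat_edges_iff)
  then show ?thesis by (simp add: f_def[abs_def])
qed

lemma graph_iso_rev:
  "graph_iso (\<lambda>v. case v of Spine i \<Rightarrow> Spine (length c - Suc i) | Branch i j k \<Rightarrow> Branch (length c - Suc i) j k)
    (cat_verts c) (cat_edges c) (cat_verts (rev c)) (cat_edges (rev c))"
  by (rule graph_iso_catI[where g = "\<lambda>i. length c - Suc i" and h = "\<lambda>_ j. j"])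
    (auto simp: rev_nth intro!: bij_betwI[of _ _ _ "\<lambda>i. length c - Suc i"] bij_betw_id[unfolded id_def])

lemma graph_isomorphic_sort:
  "graph_isomorphic (cat_verts c) (cat_edges c) (cat_verts (map sort c)) (cat_edges (map sort c))"
proof -
  have "\<exists>h. bij_betw h {..<length b} {..<length (sort b)} \<and> (\<forall>j<length b. b ! j = sort b ! h j)" for b :: "nat list"
    by (rule permutation_Ex_bij) simp
  then obtain h where h: "\<And>b :: nat list. bij_betw (h b) {..<length b} {..<length (sort b)}"
    "\<And>(b :: nat list) j. j < length b \<Longrightarrow> b ! j = sort b ! h b j" by metis
  show ?thesis
    unfolding graph_isomorphic_iff
    by (rule exI, rule graph_iso_catI[where g = "\<lambda>i. i" and h = "\<lambda>i. h (c ! i)"])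
      (use h in \<open>auto simp: bij_betw_def\<close>)
qed

section \<open>Uniqueness of codes\<close>

text \<open>Expressed by degrees and edges alone, hence invariant under isomorphism. For proper
  codes it marks exactly the vertices off the spine, so the spine is recovered from the bare
  graph.\<close>

inductive pendant :: "'a set set \<Rightarrow> 'a \<Rightarrow> bool" for E where
  leaf: "card (nbrs E v) = 1 \<Longrightarrow> pendant E v"
| step: "pendant E w \<Longrightarrow> {v, w} \<in> E \<Longrightarrow> card (nbrs E v) = 2 \<Longrightarrow> pendant E v"

lemma graph_iso_pendant:
  assumes f: "graph_iso f V E W F" and s: "simple_graph V E" "simple_graph W F"
    and p: "pendant E v" and v: "v \<in> V"
  shows "pendant F (f v)"
  using p v
proof induction
  case (leaf v)
  then show ?case using graph_iso_card_nbrs[OF f s] by (auto intro: pendant.leaf)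
next
  case (step w v)
  then have "w \<in> V" using simple_graph_edgeD[OF s(1)] by blast
  then have "{f v, f w} \<in> F" using step f by (auto simp: graph_iso_def)
  then show ?case using step \<open>w \<in> V\<close> graph_iso_card_nbrs[OF f s] by (auto intro: pendant.step)
qed

text \<open>An end of the spine has only one neighbour on it, so two branches are what makes it an
  HDV. Length at least 2 excludes a single spine vertex, where codes are ambiguous: a path is
  obtained from one branch as well as from two.\<close>

definition proper :: "nat list list \<Rightarrow> bool" where
  "proper c \<longleftrightarrow> 2 \<le> length c \<and> (\<forall>b\<in>set c. 0 \<notin> set b) \<and> 2 \<le> length (hd c) \<and> 2 \<le> length (last c)"

lemma proper_rev: "proper c \<Longrightarrow> proper (rev c)"
  by (auto simp: proper_def hd_rev last_rev)

lemma proper_zero_notin: "proper c \<Longrightarrow> i < length c \<Longrightarrow> 0 \<notin> set (c ! i)"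
  by (auto simp: proper_def)

text \<open>No spine vertex is a leaf, and one that carries a branch has degree at least 3; hence a
  spine vertex of degree 2 has neighbours on the spine only. This stops \<open>pendant\<close> from
  spreading to the spine.\<close>

lemma proper_card_nbrs_Spine:
  assumes c: "proper c" and i: "i < length c"
  shows "card (nbrs (cat_edges c) (Spine i)) \<ge> 2 + of_bool (c ! i \<noteq> [])"
proof -
  have "c \<noteq> []" using i by auto
  then have ends: "2 \<le> length (c ! 0)" "2 \<le> length (c ! (length c - 1))" and len: "2 \<le> length c"
    using c by (auto simp: proper_def hd_conv_nth last_conv_nth)
  note card = card_nbrs_Spine[OF i proper_zero_notin[OF c i]]
  have l: "of_bool (c ! i \<noteq> []) \<le> length (c ! i)" by (cases "c ! i") auto
  consider "i = 0" | "i = length c - 1" "i \<noteq> 0" | "i \<noteq> 0" "Suc i < length c" using i by linarith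
  then show ?thesis
  proof cases
    case 1
    then show ?thesis unfolding card using ends len by auto
  next
    case 2
    then have "2 \<le> length (c ! i)" using ends by simp
    then show ?thesis unfolding card using \<open>i \<noteq> 0\<close> by auto
  next
    case 3
    then show ?thesis unfolding card using l by simp
  qed
qed

text \<open>Off the spine, induct from the free end of a branch inwards. On the spine, use rule
  induction: a pendant neighbour would be a branch vertex, which forces degree at least 3 instead of
  2.\<close>

lemma pendant_cat_iff:
  assumes c: "proper c" and v: "v \<in> cat_verts c"
  shows "pendant (cat_edges c) v \<longleftrightarrow> (\<nexists>i. v = Spine i)"
proof
  assume "pendant (cat_edges c) v"
  then show "\<nexists>i. v = Spine i" using v
  proof induction
    case (leaf v)
    then show ?case using proper_card_nbrs_Spine[OF c] by fastforce
  next
    case (step w v)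
    show ?case
    proof
      assume "\<exists>i. v = Spine i"
      then obtain i where i: "v = Spine i" by blast
      have w: "w \<in> cat_verts c" "vertex_adj v w" using step by (auto simp: cat_edges_iff)
      then obtain i' j k where "w = Branch i' j k" using step by (cases w) auto
      with w i have "i < length c" "c ! i \<noteq> []" by auto
      then show False using proper_card_nbrs_Spine[OF c, of i] step i by auto
    qed
  qed
next
  assume "\<nexists>i. v = Spine i"
  then obtain i j k where v': "v = Branch i j k" by (cases v) auto
  have "pendant (cat_edges c) (Branch i j k)" if "k < c ! i ! j"
    using that
  proof (induction "c ! i ! j - k" arbitrary: k rule: less_induct)
    case less
    have b: "Branch i j k \<in> cat_verts c" using less.prems v v' by simp
    show ?case
    proof (cases "Suc k < c ! i ! j")
      case True
      then have "pendant (cat_edges c) (Branch i j (Suc k))" by (intro less.hyps) auto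
      moreover have "{Branch i j k, Branch i j (Suc k)} \<in> cat_edges c"
        using b True by (auto simp: cat_edges_iff)
      ultimately show ?thesis by (rule pendant.step) (use card_nbrs_Branch[OF b] True in simp)
    next
      case False
      then show ?thesis by (intro pendant.leaf) (use card_nbrs_Branch[OF b] in simp)
    qed
  qed
  then show "pendant (cat_edges c) v" using v v' by auto
qed

text \<open>Injectivity forbids turning back, so the direction of the first step persists; the range
  then fixes the starting point.\<close>

lemma path_automorphism:
  fixes g :: "nat \<Rightarrow> nat"
  assumes inj: "inj_on g {..<m}" and ran: "\<And>i. i < m \<Longrightarrow> g i < m"
    and adj: "\<And>i. Suc i < m \<Longrightarrow> g (Suc i) = Suc (g i) \<or> g i = Suc (g (Suc i))"
  shows "(\<forall>i<m. g i = i) \<or> (\<forall>i<m. g i = m - Suc i)"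
proof (cases "m \<ge> 2")
  case True
  have inj': "g i \<noteq> g (Suc (Suc i))" if "Suc (Suc i) < m" for i
    using inj_onD[OF inj, of i "Suc (Suc i)"] that by auto
  consider "g 1 = Suc (g 0)" | "g 0 = Suc (g 1)" using adj[of 0] True by auto
  then show ?thesis
  proof cases
    case 1
    have up: "Suc i < m \<Longrightarrow> g (Suc i) = Suc (g i)" for i
    proof (induction i)
      case (Suc i)
      then show ?case using adj[of "Suc i"] inj'[of i] by auto
    qed (use 1 in auto)
    have g: "i < m \<Longrightarrow> g i = g 0 + i" for i
    proof (induction i)
      case (Suc i)
      then show ?case using up[of i] by simp
    qed simp
    have g0: "g 0 = 0" using ran[of "m - 1"] True g[of "m - 1"] by linarith
    have "g i = i" if "i < m" for i using g[OF that] g0 by simp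
    then show ?thesis by blast
  next
    case 2
    have down: "Suc i < m \<Longrightarrow> g i = Suc (g (Suc i))" for i
    proof (induction i)
      case (Suc i)
      then show ?case using adj[of "Suc i"] inj'[of i] by auto
    qed (use 2 in auto)
    have g: "i < m \<Longrightarrow> g 0 = g i + i" for i
    proof (induction i)
      case (Suc i)
      then show ?case using down[of i] by auto
    qed simp
    have g0: "g 0 = m - 1" using ran[of 0] g[of "m - 1"] True by linarith
    have "g i = m - Suc i" if "i < m" for i using g[OF that] g0 by linarith
    then show ?thesis by blast
  qed
next
  case False
  then have "g i = i" if "i < m" for i using ran[of i] that by linarith
  then show ?thesis by blast
qed

text \<open>An isomorphism controls how many branches reach level \<open>k\<close>, that is, how
  many parts exceed \<open>k\<close>. Consecutive differences of these counts are the
  multiplicities.\<close>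

lemma mset_eqI_gt:
  fixes a b :: "nat list"
  assumes "0 \<notin> set a" "0 \<notin> set b"
    and "\<And>k. card {j. j < length a \<and> k < a ! j} = card {j. j < length b \<and> k < b ! j}"
  shows "mset a = mset b"
proof (rule multiset_eqI)
  fix x
  have gt: "card {j. j < length l \<and> k < l ! j} = card {j. j < length l \<and> Suc k < l ! j} + count (mset l) (Suc k)"
    for l :: "nat list" and k
  proof -
    have "count (mset l) (Suc k) = card {j. j < length l \<and> l ! j = Suc k}"
      by (simp add: count_mset count_list_eq_length_filter length_filter_conv_card eq_commute)
    moreover have "{j. j < length l \<and> k < l ! j} = {j. j < length l \<and> Suc k < l ! j} \<union> {j. j < length l \<and> l ! j = Suc k}"
      by auto
    moreover have "card ({j. j < length l \<and> Suc k < l ! j} \<union> {j. j < length l \<and> l ! j = Suc k}) =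
        card {j. j < length l \<and> Suc k < l ! j} + card {j. j < length l \<and> l ! j = Suc k}"
      by (rule card_Un_disjoint) auto
    ultimately show ?thesis by simp
  qed
  show "count (mset a) x = count (mset b) x"
  proof (cases x)
    case 0
    have "x \<notin># mset a" "x \<notin># mset b" using assms(1,2) 0 by auto
    then show ?thesis by (metis count_eq_zero_iff)
  next
    case (Suc k)
    then show ?thesis using gt[where l = a and k = k] gt[where l = b and k = k]
        assms(3)[of k] assms(3)[of "Suc k"] by simp
  qed
qed

text \<open>The isomorphism preserves the position of a vertex within its branch, so it can only permute the branches of each spine vertex.\<close>

lemma spine_fixing_iso_levels:
  assumes c: "proper c" and c': "proper c'"
    and f: "graph_iso f (cat_verts c) (cat_edges c) (cat_verts c') (cat_edges c')"
    and len: "length c' = length c" and fixed: "\<And>i. i < length c \<Longrightarrow> f (Spine i) = Spine i"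
    and i: "i < length c"
  shows "card {j. j < length (c ! i) \<and> k < c ! i ! j} \<le> card {j. j < length (c' ! i) \<and> k < c' ! i ! j}"
proof -
  have adj: "vertex_adj u v \<longleftrightarrow> vertex_adj (f u) (f v)" if "u \<in> cat_verts c" "v \<in> cat_verts c" for u v
    using f that by (auto simp: graph_iso_def cat_edges_iff dest: bij_betwE)
  have inj: "f u = f v \<longleftrightarrow> u = v" if "u \<in> cat_verts c" "v \<in> cat_verts c" for u v
    using f that by (auto simp: graph_iso_def bij_betw_def inj_on_def)
  have ran: "f u \<in> cat_verts c'" if "u \<in> cat_verts c" for u
    using f that by (auto simp: graph_iso_def dest: bij_betwE)
  \<comment> \<open>The clause for all \<open>k' < k\<close> records that the initial segment stays
    in one branch \<open>j'\<close>, so the image of the parent is known in the next step.\<close>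
  have level: "\<exists>j'. f (Branch i j k) = Branch i j' k \<and> (\<forall>k'<k. f (Branch i j k') = Branch i j' k')"
    if "Branch i j k \<in> cat_verts c" for j k
    using that
  proof (induction k)
    case 0
    have "vertex_adj (Spine i) (f (Branch i j 0))"
      using adj[of "Spine i" "Branch i j 0"] 0 fixed i by simp
    \<comment> \<open>Every spine vertex is already the image of a spine vertex.\<close>
    moreover have "f (Branch i j 0) \<noteq> Spine i'" for i'
    proof
      assume a: "f (Branch i j 0) = Spine i'"
      then have "i' < length c" using ran[OF 0] len by simp
      then show False using a fixed[of i'] inj[of "Branch i j 0" "Spine i'"] 0 by simp
    qed
    ultimately show ?case by (cases "f (Branch i j 0)") auto
  next
    case (Suc k)
    then obtain j' where j': "f (Branch i j k) = Branch i j' k" "\<And>k'. k' < k \<Longrightarrow> f (Branch i j k') = Branch i j' k'"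
      by auto
    have m: "Branch i j k \<in> cat_verts c" using Suc by auto
    \<comment> \<open>The inward neighbour of the image is already taken by \<open>f p\<close>, so
      by injectivity the next vertex can only move outwards.\<close>
    define p where "p = vertex_parent (Branch i j k)"
    have p: "p \<in> cat_verts c" "p \<noteq> Branch i j (Suc k)" using Suc by (auto simp: p_def)
    have fp: "f p = vertex_parent (Branch i j' k)" using j' fixed i by (auto simp: p_def)
    have "vertex_adj (Branch i j' k) (f (Branch i j (Suc k)))"
      using adj[of "Branch i j k" "Branch i j (Suc k)"] Suc.prems j'(1) by simp
    moreover have "f (Branch i j (Suc k)) \<noteq> vertex_parent (Branch i j' k)"
      using inj[of p "Branch i j (Suc k)"] p Suc.prems fp by auto
    ultimately have "f (Branch i j (Suc k)) = Branch i j' (Suc k)"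
      by (cases "f (Branch i j (Suc k))") (auto split: if_splits)
    then show ?case using j' by (auto simp: less_Suc_eq)
  qed
  define h where "h j = (SOME j'. f (Branch i j k) = Branch i j' k)" for j
  have h: "f (Branch i j k) = Branch i (h j) k" if "Branch i j k \<in> cat_verts c" for j
    unfolding h_def using level[OF that] by (metis (mono_tags, lifting) someI)
  show ?thesis
  proof (rule card_inj_on_le)
    show "inj_on h {j. j < length (c ! i) \<and> k < c ! i ! j}"
    proof (rule inj_onI)
      fix j1 j2 assume a: "j1 \<in> {j. j < length (c ! i) \<and> k < c ! i ! j}" "j2 \<in> {j. j < length (c ! i) \<and> k < c ! i ! j}" "h j1 = h j2"
      then show "j1 = j2" using h[of j1] h[of j2] inj[of "Branch i j1 k" "Branch i j2 k"] i by auto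
    qed
    show "h ` {j. j < length (c ! i) \<and> k < c ! i ! j} \<subseteq> {j. j < length (c' ! i) \<and> k < c' ! i ! j}"
    proof
      fix j' assume "j' \<in> h ` {j. j < length (c ! i) \<and> k < c ! i ! j}"
      then obtain j where "j' = h j" "j < length (c ! i)" "k < c ! i ! j" by auto
      then show "j' \<in> {j. j < length (c' ! i) \<and> k < c' ! i ! j}"
        using h[of j] ran[of "Branch i j k"] i by auto
    qed
  qed auto
qed

text \<open>The level inequality for \<open>f\<close> and for its inverse makes all counts
  equal.\<close>

lemma spine_fixing_iso:
  assumes c: "proper c" and c': "proper c'"
    and f: "graph_iso f (cat_verts c) (cat_edges c) (cat_verts c') (cat_edges c')"
    and len: "length c' = length c" and fixed: "\<And>i. i < length c \<Longrightarrow> f (Spine i) = Spine i"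
  shows "map sort c = map sort c'"
proof (rule nth_equalityI)
  fix i assume "i < length (map sort c)"
  then have i: "i < length c" by simp
  let ?g = "the_inv_into (cat_verts c) f"
  have g: "?g (Spine i) = Spine i" if "i < length c'" for i
    using the_inv_into_f_f[of f "cat_verts c" "Spine i"] f that fixed[of i] len
    by (auto simp: graph_iso_def bij_betw_def)
  have "mset (c ! i) = mset (c' ! i)"
  proof (rule mset_eqI_gt)
    show "0 \<notin> set (c ! i)" "0 \<notin> set (c' ! i)"
      using proper_zero_notin[OF c i] proper_zero_notin[OF c', of i] i len by auto
    show "card {j. j < length (c ! i) \<and> k < c ! i ! j} = card {j. j < length (c' ! i) \<and> k < c' ! i ! j}" for k
      using spine_fixing_iso_levels[OF c c' f len fixed i]
        spine_fixing_iso_levels[OF c' c graph_iso_inv[OF f] len[symmetric] g, of i k] i len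
      by (intro order_antisym) auto
  qed
  then have "sort (c ! i) = sort (c' ! i)" by (metis mset_sort properties_for_sort sorted_sort)
  then show "map sort c ! i = map sort c' ! i" using i len by simp
qed (use len in simp)

text \<open>Non-pendant vertices correspond, so \<open>f\<close> carries spine to spine and acts on
  the indices as an automorphism of a path: identity or reversal. In the second case composition
  with the reversal of \<open>c'\<close> reduces to the first.\<close>

theorem cat_isomorphic_imp:
  assumes c: "proper c" and c': "proper c'"
    and iso: "graph_isomorphic (cat_verts c) (cat_edges c) (cat_verts c') (cat_edges c')"
  shows "map sort c = map sort c' \<or> map sort c = rev (map sort c')"
proof -
  obtain f where f: "graph_iso f (cat_verts c) (cat_edges c) (cat_verts c') (cat_edges c')"
    using iso graph_isomorphic_iff by blast
  have pres: "\<exists>i'<length c2. h (Spine i) = Spine i'"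
    if "proper c1" "proper c2" "graph_iso h (cat_verts c1) (cat_edges c1) (cat_verts c2) (cat_edges c2)" "i < length c1"
    for c1 c2 h i
  proof -
    have hi: "h (Spine i) \<in> cat_verts c2" using that by (auto simp: graph_iso_def dest: bij_betwE)
    have "the_inv_into (cat_verts c1) h (h (Spine i)) = Spine i"
      using that by (intro the_inv_into_f_f) (auto simp: graph_iso_def bij_betw_def)
    then have "\<not> pendant (cat_edges c2) (h (Spine i))"
      using graph_iso_pendant[OF graph_iso_inv[OF that(3)] simple_graph_cat simple_graph_cat _ hi]
        pendant_cat_iff[OF that(1), of "Spine i"] that(4) by auto
    then have "\<exists>i'. h (Spine i) = Spine i'" using pendant_cat_iff[OF that(2) hi] by blast
    then show ?thesis using hi by auto
  qed
  define g where "g i = (THE i'. f (Spine i) = Spine i')" for i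
  have g: "f (Spine i) = Spine (g i)" "g i < length c'" if "i < length c" for i
  proof -
    have "\<exists>i'<length c'. f (Spine i) = Spine i'" by (rule pres[OF c c' f that])
    then show "f (Spine i) = Spine (g i)" "g i < length c'" by (auto simp: g_def)
  qed
  have card_le: "length c1 \<le> length c2"
    if "proper c1" "proper c2" "graph_iso h (cat_verts c1) (cat_edges c1) (cat_verts c2) (cat_edges c2)" for c1 c2 h
  proof -
    have "card (Spine ` {..<length c1}) \<le> card (Spine ` {..<length c2})"
    proof (rule card_inj_on_le)
      show "inj_on h (Spine ` {..<length c1})"
        using that(3) by (auto simp: graph_iso_def bij_betw_def intro: inj_on_subset)
      show "h ` Spine ` {..<length c1} \<subseteq> Spine ` {..<length c2}" using pres[OF that] by fastforce
    qed simp
    then show ?thesis by (simp add: card_image inj_on_def)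
  qed
  have len: "length c' = length c"
    using card_le[OF c c' f] card_le[OF c' c graph_iso_inv[OF f]] by simp
  have inj: "inj_on g {..<length c}"
  proof (rule inj_onI)
    fix i j assume "i \<in> {..<length c}" "j \<in> {..<length c}" "g i = g j"
    moreover have "inj_on f (cat_verts c)" using f by (auto simp: graph_iso_def bij_betw_def)
    ultimately show "i = j" using inj_onD[of f "cat_verts c" "Spine i" "Spine j"] g by auto
  qed
  have "(\<forall>i<length c. g i = i) \<or> (\<forall>i<length c. g i = length c - Suc i)"
  proof (rule path_automorphism[OF inj])
    show "g i < length c" if "i < length c" for i using g[OF that] len by simp
    show "g (Suc i) = Suc (g i) \<or> g i = Suc (g (Suc i))" if "Suc i < length c" for i
    proof -
      have "{Spine i, Spine (Suc i)} \<in> cat_edges c" using that by (auto simp: cat_edges_iff)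
      moreover have "Spine i \<in> cat_verts c" "Spine (Suc i) \<in> cat_verts c" using that by auto
      ultimately have "{f (Spine i), f (Spine (Suc i))} \<in> cat_edges c'" using f by (auto simp: graph_iso_def)
      then show ?thesis using g[of i] g[of "Suc i"] that by (auto simp: cat_edges_iff)
    qed
  qed
  then show ?thesis
  proof
    assume "\<forall>i<length c. g i = i"
    then show ?thesis using spine_fixing_iso[OF c c' f len] g by auto
  next
    assume r: "\<forall>i<length c. g i = length c - Suc i"
    let ?r = "\<lambda>v. case v of Spine i \<Rightarrow> Spine (length c - Suc i) | Branch i j k \<Rightarrow> Branch (length c - Suc i) j k"
    have "graph_iso ?r (cat_verts c') (cat_edges c') (cat_verts (rev c')) (cat_edges (rev c'))"
      using graph_iso_rev[of c'] unfolding len .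
    then have "graph_iso (?r \<circ> f) (cat_verts c) (cat_edges c) (cat_verts (rev c')) (cat_edges (rev c'))"
      by (rule graph_iso_comp[OF f])
    then have "map sort c = map sort (rev c')"
      by (rule spine_fixing_iso[OF c proper_rev[OF c']]) (use len g r in auto)
    then show ?thesis by (simp add: rev_map)
  qed
qed

section \<open>Existence of codes\<close>

text \<open>A partial isomorphism, whose image is an induced subgraph that need not exhaust
  \<open>V\<close>: the state of a process that grows branches one vertex at a time.\<close>

definition cat_embedding :: "(vertex \<Rightarrow> 'a) \<Rightarrow> nat list list \<Rightarrow> 'a set \<Rightarrow> 'a set set \<Rightarrow> bool" where
  "cat_embedding f c V E \<longleftrightarrow> inj_on f (cat_verts c) \<and> f ` cat_verts c \<subseteq> V \<and>
     (\<forall>u\<in>cat_verts c. \<forall>v\<in>cat_verts c. {f u, f v} \<in> E \<longleftrightarrow> vertex_adj u v)"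

text \<open>The starting state, a bare spine. Empty partitions produce no branch vertices, so the
  map is given on the spine only.\<close>

lemma cat_embedding_path:
  assumes p: "induced_path V E p" and s: "simple_graph V E"
  shows "cat_embedding (\<lambda>v. case v of Spine i \<Rightarrow> p ! i) (replicate (length p) []) V E"
proof -
  have v: "cat_verts (replicate (length p) []) = Spine ` {..<length p}"
    by (auto simp: cat_verts_def)
  have p': "distinct p" "\<And>i. i < length p \<Longrightarrow> p ! i \<in> V"
    "\<And>i. Suc i < length p \<Longrightarrow> {p ! i, p ! Suc i} \<in> E"
    using p by (auto simp: induced_path_def graph_path_def)
  have "{p ! i, p ! j} \<in> E \<longleftrightarrow> j = Suc i \<or> i = Suc j" if "i < length p" "j < length p" for i j
    using that p p'(3)[of i] p'(3)[of j] by (auto simp: induced_path_def insert_commute)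
  then show ?thesis
    using p' by (auto simp: cat_embedding_def v inj_on_def nth_eq_iff_index_eq)
qed

text \<open>A new leaf at a spine vertex is a new branch of size 1; at the tip of a branch it
  lengthens that branch. Inside a branch it would destroy the caterpillar shape, which
  \<open>last\<close> excludes.\<close>

lemma cat_extend:
  assumes x: "x \<in> cat_verts c" and last: "\<And>i j k. x = Branch i j k \<Longrightarrow> Suc k = c ! i ! j"
    and pos: "\<forall>b\<in>set c. 0 \<notin> set b"
  obtains c' n where "length c' = length c" "\<forall>b\<in>set c'. 0 \<notin> set b" "cat_verts c' = insert n (cat_verts c)"
    "n \<notin> cat_verts c" "\<And>y. y \<in> cat_verts c \<Longrightarrow> vertex_adj n y \<longleftrightarrow> y = x" "\<And>i. n \<noteq> Spine i"
proof (cases x)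
  case (Spine i)
  then have i: "i < length c" using x by simp
  define c' where "c' = c[i := c ! i @ [1]]"
  define n where "n = Branch i (length (c ! i)) 0"
  have "v \<in> cat_verts c' \<longleftrightarrow> v \<in> insert n (cat_verts c)" for v
    using i by (cases v) (auto simp: c'_def n_def nth_list_update nth_append split: if_splits)
  then have "cat_verts c' = insert n (cat_verts c)" by blast
  moreover have "\<forall>b\<in>set c'. 0 \<notin> set b" using pos i set_update_subset_insert[of c i "c ! i @ [1]"]
    by (fastforce simp: c'_def)
  moreover have "vertex_adj n y \<longleftrightarrow> y = x" if "y \<in> cat_verts c" for y
    using that Spine by (cases y) (auto simp: n_def)
  moreover have "length c' = length c" "n \<notin> cat_verts c" "n \<noteq> Spine i'" for i' by (auto simp: c'_def n_def)
  ultimately show ?thesis using that by blast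
next
  case (Branch i j k)
  then have ij: "i < length c" "j < length (c ! i)" "Suc k = c ! i ! j" using x last by auto
  define c' where "c' = c[i := (c ! i)[j := Suc (Suc k)]]"
  define n where "n = Branch i j (Suc k)"
  have "v \<in> cat_verts c' \<longleftrightarrow> v \<in> insert n (cat_verts c)" for v
    using ij by (cases v) (auto simp: c'_def n_def nth_list_update less_Suc_eq split: if_splits)
  then have "cat_verts c' = insert n (cat_verts c)" by blast
  moreover have "\<forall>b\<in>set c'. 0 \<notin> set b"
  proof -
    have "0 \<notin> set ((c ! i)[j := Suc (Suc k)])"
      using pos ij set_update_subset_insert[of "c ! i" j "Suc (Suc k)"] by fastforce
    then show ?thesis using pos set_update_subset_insert[of c i "(c ! i)[j := Suc (Suc k)]"]
      by (auto simp: c'_def)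
  qed
  moreover have "vertex_adj n y \<longleftrightarrow> y = x" if "y \<in> cat_verts c" for y
    using that Branch ij by (cases y) (auto simp: n_def)
  moreover have "length c' = length c" "n \<notin> cat_verts c" "n \<noteq> Spine i'" for i' using ij by (auto simp: c'_def n_def)
  ultimately show ?thesis using that by blast
qed

text \<open>Two edges from the image to an outside vertex would close a cycle in the tree.\<close>

lemma cat_embedding_unique_nbr:
  assumes t: "tree V E" and f: "cat_embedding f c V E"
    and v: "v \<in> V - f ` cat_verts c" and x: "x \<in> cat_verts c" "{f x, v} \<in> E"
    and y: "y \<in> cat_verts c" "{f y, v} \<in> E"
  shows "y = x"
proof (rule ccontr)
  assume "y \<noteq> x"
  obtain p where p: "graph_path (cat_verts c) (cat_edges c) p" "hd p = x" "last p = y"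
    using cat_connected[OF x(1) y(1)] by blast
  have ne: "p \<noteq> []" and pv: "set p \<subseteq> cat_verts c" using p by (auto simp: graph_path_def)
  have "length p \<noteq> 1" using p \<open>y \<noteq> x\<close> by (cases p) auto
  then have len: "length p \<ge> 2" using ne by (cases p; cases "tl p") auto
  have "{(map f p @ [v]) ! i, (map f p @ [v]) ! Suc i} \<in> E" if "Suc i < length (map f p @ [v])" for i
  proof (cases "Suc i < length p")
    case True
    then have "p ! i \<in> cat_verts c" "p ! Suc i \<in> cat_verts c" "vertex_adj (p ! i) (p ! Suc i)"
      using p(1) by (auto simp: graph_path_def cat_edges_iff)
    then show ?thesis using f True by (auto simp: cat_embedding_def nth_append)
  next
    case False
    then have "i = length p - 1" "i < length p" using that by auto
    then show ?thesis using y p(3) ne by (auto simp: nth_append last_conv_nth)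
  qed
  moreover have "distinct (map f p @ [v])"
    using p(1) f v pv by (auto simp: graph_path_def cat_embedding_def distinct_map intro: inj_on_subset)
  moreover have "set (map f p @ [v]) \<subseteq> V" using f v pv by (auto simp: cat_embedding_def)
  ultimately have "graph_path V E (map f p @ [v])" by (auto simp: graph_path_def)
  then have "graph_cycle V E (map f p @ [v])"
    using len x p(2) ne by (auto simp: graph_cycle_def hd_map insert_commute)
  then show False using t by (auto simp: tree_def)
qed

text \<open>Connectedness yields an edge leaving the image. Its inner end is on the spine or at the
  tip of a branch, since otherwise a vertex off the spine would have degree 3. Acyclicity makes it
  the only edge from the image to the new vertex, so the embedding stays induced.\<close>

lemma cat_embedding_extend:
  assumes t: "tree V E" and f: "cat_embedding f c V E" and pos: "\<forall>b\<in>set c. 0 \<notin> set b"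
    and hdv: "high_degree_vertices V E \<subseteq> (\<lambda>i. f (Spine i)) ` {..<length c}"
    and ne: "c \<noteq> []" and proper: "f ` cat_verts c \<noteq> V"
  shows "\<exists>c' f'. cat_embedding f' c' V E \<and> (\<forall>b\<in>set c'. 0 \<notin> set b) \<and> length c' = length c \<and>
     (\<forall>i<length c. f' (Spine i) = f (Spine i)) \<and> weight c' = Suc (weight c)"
proof -
  have s: "simple_graph V E" using t by (auto simp: tree_def)
  have f_inj: "inj_on f (cat_verts c)" and f_ran: "f ` cat_verts c \<subseteq> V"
    and f_adj: "\<And>u v. u \<in> cat_verts c \<Longrightarrow> v \<in> cat_verts c \<Longrightarrow> {f u, f v} \<in> E \<longleftrightarrow> vertex_adj u v"
    using f by (auto simp: cat_embedding_def)
  obtain w where w: "w \<in> V" "w \<notin> f ` cat_verts c" using f_ran proper by blast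
  have s0: "f (Spine 0) \<in> f ` cat_verts c" using ne by auto
  then obtain p where "graph_path V E p" "hd p = f (Spine 0)" "last p = w"
    using t w f_ran unfolding tree_def graph_connected_def by blast
  then obtain u v where uv: "u \<in> f ` cat_verts c" "v \<in> V - f ` cat_verts c" "{u, v} \<in> E"
    using crossing_edge[of V E p "f ` cat_verts c"] s0 w by metis
  then obtain x where x: "x \<in> cat_verts c" "u = f x" by blast
  have lst: "Suc k = c ! i ! j" if b: "x = Branch i j k" for i j k
  proof (rule ccontr)
    assume "Suc k \<noteq> c ! i ! j"
    then have y: "Branch i j (Suc k) \<in> cat_verts c" using x b by auto
    define z where "z = vertex_parent x"
    have z: "z \<in> cat_verts c" "vertex_adj x z" "z \<noteq> Branch i j (Suc k)" using x b by (auto simp: z_def)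
    \<comment> \<open>The neighbour towards the spine, the next branch vertex, and the new vertex
      \<open>v\<close>.\<close>
    have "{f z, f (Branch i j (Suc k)), v} \<subseteq> nbrs E u"
      using f_adj[OF x(1) z(1)] f_adj[OF x(1) y] z b uv x by (auto simp: nbrs_def)
    moreover have "card {f z, f (Branch i j (Suc k)), v} = 3"
      using z y uv inj_onD[OF f_inj _ z(1) y] by (auto simp: card_insert_if)
    ultimately have "3 \<le> card (nbrs E u)" using card_mono[OF finite_nbrs[OF s]] by metis
    then have "u \<in> high_degree_vertices V E"
      using uv f_ran by (auto simp: high_degree_vertices_def graph_degree_eq_card_nbrs[OF s])
    then obtain i' where "i' < length c" "f x = f (Spine i')" using hdv x by blast
    then show False using inj_onD[OF f_inj, of x "Spine i'"] x b by auto
  qed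
  obtain c' n where c': "length c' = length c" "\<forall>b\<in>set c'. 0 \<notin> set b" "cat_verts c' = insert n (cat_verts c)"
    "n \<notin> cat_verts c" "\<And>y. y \<in> cat_verts c \<Longrightarrow> vertex_adj n y \<longleftrightarrow> y = x" "\<And>i. n \<noteq> Spine i"
    by (rule cat_extend[OF x(1) lst pos], assumption, rule that)
  define f' where "f' = f(n := v)"
  have f'n: "f' n = v" by (simp add: f'_def)
  have f'o: "f' y = f y" if "y \<in> cat_verts c" for y using c'(4) that by (auto simp: f'_def)
  have new: "{v, f y} \<in> E \<longleftrightarrow> vertex_adj n y" if "y \<in> cat_verts c" for y
    using cat_embedding_unique_nbr[OF t f uv(2) x(1) _ that] uv x c'(5)[OF that] by (auto simp: insert_commute)
  have vv: "{v, v} \<notin> E" using simple_graph_edgeD(3)[OF s, of v v] by blast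
  have "{f' y, f' z} \<in> E \<longleftrightarrow> vertex_adj y z" if "y \<in> insert n (cat_verts c)" "z \<in> insert n (cat_verts c)" for y z
  proof (cases "y = n")
    case True
    then show ?thesis using that(2) new vv f'n f'o vertex_adj_irrefl[of n] by (cases "z = n") auto
  next
    case False
    then have y: "y \<in> cat_verts c" using that by blast
    show ?thesis
    proof (cases "z = n")
      case True
      then show ?thesis using new[OF y] f'n f'o[OF y] vertex_adj_sym[of y n] by (simp add: insert_commute)
    next
      case False
      then show ?thesis using that(2) y f'o f_adj[OF y] by simp
    qed
  qed
  moreover have "inj_on f' (insert n (cat_verts c))"
    unfolding inj_on_insert using f_inj uv(2) c'(4) f'n f'o
    by (auto simp: inj_on_def)
  moreover have "f' ` insert n (cat_verts c) \<subseteq> V" using f_ran uv(2) f'n f'o by auto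
  ultimately have "cat_embedding f' c' V E" by (simp add: cat_embedding_def c'(3))
  moreover have "weight c' = Suc (weight c)"
    unfolding card_cat_verts[symmetric] c'(3) using c'(4) finite_cat_verts by simp
  moreover have "f' (Spine i) = f (Spine i)" for i using c'(6)[of i] by (auto simp: f'_def)
  ultimately show ?thesis using c'(1,2) by blast
qed

text \<open>Induction on the number of covered vertices, from the bare spine to all of
  \<open>V\<close>. The spine is kept pointwise on \<open>p\<close>, so degrees at the ends of
  \<open>p\<close> can be read off from the ends of the code.\<close>

lemma tree_cat_decomposition:
  assumes t: "tree V E" and p: "induced_path V E p" and hdv: "high_degree_vertices V E \<subseteq> set p"
  obtains c f where "graph_iso f (cat_verts c) (cat_edges c) V E" "\<forall>b\<in>set c. 0 \<notin> set b"
    "length c = length p" "\<And>i. i < length p \<Longrightarrow> f (Spine i) = p ! i"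
proof -
  have s: "simple_graph V E" using t by (auto simp: tree_def)
  then have fin: "finite V" by (auto simp: simple_graph_def)
  have ne: "p \<noteq> []" and dist: "distinct p" "set p \<subseteq> V" using p by (auto simp: induced_path_def graph_path_def)
  have le: "length p \<le> card V" using card_mono[OF fin dist(2)] distinct_card[OF dist(1)] by simp
  have "\<exists>c f. cat_embedding f c V E \<and> (\<forall>b\<in>set c. 0 \<notin> set b) \<and> length c = length p \<and>
      (\<forall>i<length p. f (Spine i) = p ! i) \<and> weight c = card V"
    using le
  proof (induction rule: dec_induct)
    case base
    have "weight (replicate (length p) []) = length p" by (simp add: weight_def sum_list_replicate)
    then show ?case using cat_embedding_path[OF p s]
      by (intro exI[of _ "replicate (length p) []"] exI[of _ "\<lambda>v. case v of Spine i \<Rightarrow> p ! i"]) auto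
  next
    case (step n)
    then obtain c f where cf: "cat_embedding f c V E" "\<forall>b\<in>set c. 0 \<notin> set b" "length c = length p"
      "\<forall>i<length p. f (Spine i) = p ! i" "weight c = n" by blast
    have "high_degree_vertices V E \<subseteq> (\<lambda>i. f (Spine i)) ` {..<length c}"
      using hdv cf(3,4) by (auto simp: set_conv_nth)
    moreover have "card (f ` cat_verts c) = n"
      using cf(1,5) by (simp add: cat_embedding_def card_image card_cat_verts)
    then have "f ` cat_verts c \<noteq> V" using step by auto
    ultimately obtain c' f' where "cat_embedding f' c' V E" "\<forall>b\<in>set c'. 0 \<notin> set b" "length c' = length c"
      "\<forall>i<length c. f' (Spine i) = f (Spine i)" "weight c' = Suc (weight c)"
      using cat_embedding_extend[OF t cf(1,2)] ne cf(3) by fastforce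
    then show ?case using cf by (intro exI[of _ c'] exI[of _ f']) auto
  qed
  then obtain c f where cf: "cat_embedding f c V E" "\<forall>b\<in>set c. 0 \<notin> set b" "length c = length p"
    "\<forall>i<length p. f (Spine i) = p ! i" "weight c = card V" by blast
  have "f ` cat_verts c = V"
    using cf(1,5) fin by (intro card_subset_eq) (auto simp: cat_embedding_def card_image card_cat_verts)
  then have "graph_iso f (cat_verts c) (cat_edges c) V E"
    using cf(1) by (auto simp: graph_iso_def cat_embedding_def bij_betw_def cat_edges_iff)
  then show ?thesis using that cf by blast
qed

lemma induced_path_infix:
  assumes "induced_path V E (a @ q @ b)" "q \<noteq> []"
  shows "induced_path V E q"
proof -
  have n: "(a @ q @ b) ! (length a + i) = q ! i" if "i < length q" for i
    using that by (simp add: nth_append)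
  have "{q ! i, q ! Suc i} \<in> E" if "Suc i < length q" for i
    using assms(1) n[of i] n[of "Suc i"] that unfolding induced_path_def graph_path_def
    by (auto dest!: spec[of _ "length a + i"])
  moreover have "j = Suc i \<or> i = Suc j" if "i < length q" "j < length q" "{q ! i, q ! j} \<in> E" for i j
  proof -
    have "length a + j = Suc (length a + i) \<or> length a + i = Suc (length a + j)"
      using assms(1)[unfolded induced_path_def, THEN conjunct2, rule_format, of "length a + i" "length a + j"]
        that n[OF that(1)] n[OF that(2)] by simp
    then show ?thesis by auto
  qed
  ultimately show ?thesis using assms by (auto simp: induced_path_def graph_path_def)
qed

text \<open>Serves to trim a path to its first and last HDV, which become the ends of the
  spine.\<close>

lemma trim_list:
  assumes "\<exists>x\<in>set p. P x"
  obtains a q b where "p = a @ q @ b" "q \<noteq> []" "P (hd q)" "P (last q)" "\<And>x. x \<in> set p \<Longrightarrow> P x \<Longrightarrow> x \<in> set q"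
proof -
  obtain a y p' where 1: "p = a @ y # p'" "P y" "\<forall>z\<in>set a. \<not> P z" using split_list_first_prop[OF assms] by blast
  then obtain q z b where 2: "y # p' = q @ z # b" "P z" "\<forall>z\<in>set b. \<not> P z"
    using split_list_last_prop[of "y # p'" P] by auto
  have "hd (q @ [z]) = y" using 2(1) by (cases q) auto
  moreover have "p = a @ (q @ [z]) @ b" using 1 2 by simp
  ultimately show ?thesis using 1 2 by (intro that[of a "q @ [z]" b]) auto
qed

text \<open>With two or more HDVs the path is trimmed so that both ends are HDVs; an end has one
  neighbour on the spine, hence at least two branches. With at most one HDV a single vertex serves
  as spine.\<close>

theorem linear_tree_code:
  assumes t: "linear_tree V E"
  obtains c where "graph_isomorphic (cat_verts c) (cat_edges c) V E" "\<forall>b\<in>set c. 0 \<notin> set b"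
    "length c = 1 \<or> proper c"
proof -
  have tr: "tree V E" using t by (auto simp: linear_tree_def)
  then have s: "simple_graph V E" and "V \<noteq> {}" by (auto simp: tree_def graph_connected_def)
  let ?H = "high_degree_vertices V E"
  obtain p where p: "induced_path V E p" "?H \<subseteq> set p" using t by (auto simp: linear_tree_def)
  show ?thesis
  \<comment> \<open>This also covers trees without HDVs, where any vertex may be chosen.\<close>
  proof (cases "\<exists>v\<in>V. ?H \<subseteq> {v}")
    case True
    then obtain v where v: "v \<in> V" "?H \<subseteq> {v}" by blast
    have "induced_path V E [v]" using v simple_graph_edgeD(3)[OF s, of v v] by (auto simp: induced_path_def graph_path_def)
    then obtain c f where "graph_iso f (cat_verts c) (cat_edges c) V E" "\<forall>b\<in>set c. 0 \<notin> set b" "length c = length [v]"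
      by (rule tree_cat_decomposition[OF tr]) (use v in auto)
    moreover from this have "graph_isomorphic (cat_verts c) (cat_edges c) V E" unfolding graph_isomorphic_iff by blast
    ultimately show ?thesis using that[of c] by auto
  next
    case False
    have HV: "?H \<subseteq> V" by (auto simp: high_degree_vertices_def)
    have "?H \<noteq> {}" using False \<open>V \<noteq> {}\<close> by auto
    then have "\<exists>x\<in>set p. x \<in> ?H" using p by blast
    then obtain a q b where q: "p = a @ q @ b" "q \<noteq> []" "hd q \<in> ?H" "last q \<in> ?H"
      "\<And>x. x \<in> set p \<Longrightarrow> x \<in> ?H \<Longrightarrow> x \<in> set q" by (rule trim_list) blast
    have Hq: "?H \<subseteq> set q" using q p by blast
    have "\<not> ?H \<subseteq> {hd q}" using False q(3) HV by blast
    then have "length q \<noteq> 1" using Hq by (cases q) auto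
    then have len: "2 \<le> length q" using q(2) by (cases q; cases "tl q") auto
    obtain c f where cf: "graph_iso f (cat_verts c) (cat_edges c) V E" "\<forall>b\<in>set c. 0 \<notin> set b"
      "length c = length q" "\<And>i. i < length q \<Longrightarrow> f (Spine i) = q ! i"
      using tree_cat_decomposition[OF tr induced_path_infix Hq] p(1) q(1,2) by metis
    have deg: "3 \<le> of_bool (i \<noteq> 0) + of_bool (Suc i < length c) + length (c ! i)"
      if "i < length c" "q ! i \<in> ?H" for i
    proof -
      have "3 \<le> card (nbrs E (f (Spine i)))"
        using that cf by (simp add: high_degree_vertices_def graph_degree_eq_card_nbrs[OF s])
      also have "\<dots> = card (nbrs (cat_edges c) (Spine i))"
        using that by (intro graph_iso_card_nbrs[OF cf(1) simple_graph_cat s]) auto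
      also have "\<dots> = of_bool (i \<noteq> 0) + of_bool (Suc i < length c) + length (c ! i)"
        using that cf(2) by (intro card_nbrs_Spine) auto
      finally show ?thesis .
    qed
    have ne: "c \<noteq> []" using len cf(3) by auto
    have "2 \<le> length (hd c)" using deg[of 0] q(2,3) len cf(3) ne by (simp add: hd_conv_nth)
    moreover have "2 \<le> length (last c)" using deg[of "length c - 1"] q(2,4) len cf(3) ne by (simp add: last_conv_nth)
    ultimately have "proper c" using len cf by (auto simp: proper_def)
    then show ?thesis using that cf graph_isomorphic_iff by blast
  qed
qed

section \<open>Counting isomorphism classes\<close>

definition codes :: "nat \<Rightarrow> nat list list set" where
  "codes n = {c. proper c \<and> (\<forall>b\<in>set c. sorted b) \<and> weight c = n}"

text \<open>The isomorphism class described by \<open>c\<close>, as a set of labelled trees, so that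
  it can be compared with elements of the quotient.\<close>

definition code_class :: "nat \<Rightarrow> nat list list \<Rightarrow> nat set set set" where
  "code_class n c = {E \<in> labelled_linear_trees n. graph_isomorphic (cat_verts c) (cat_edges c) {..<n} E}"

lemma linear_tree_iso_Image:
  assumes "E \<in> code_class n c"
  shows "linear_tree_iso n `` {E} = code_class n c"
  using assms graph_isomorphic_trans graph_isomorphic_sym
  unfolding code_class_def linear_tree_iso_def by (auto; blast)

text \<open>Transport of structure along any bijection from the caterpillar to
  \<open>{..<n}\<close>.\<close>

lemma code_class_nonempty:
  assumes "c \<noteq> []" "weight c = n"
  shows "code_class n c \<noteq> {}"
proof -
  have "card (cat_verts c) = card {..<n}" using assms by (simp add: card_cat_verts)
  then obtain f where f: "bij_betw f (cat_verts c) {..<n}"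
    using finite_same_card_bij[OF finite_cat_verts[of c] finite_lessThan[of n]] by blast
  define E where "E = (`) f ` cat_edges c"
  have sub: "e \<subseteq> cat_verts c" "card e = 2" if "e \<in> cat_edges c" for e
    using simple_graph_cat[of c] that by (auto simp: simple_graph_def)
  have inj: "inj_on f (cat_verts c)" and im: "f ` cat_verts c = {..<n}" using f by (auto simp: bij_betw_def)
  have "e \<subseteq> {..<n} \<and> card e = 2" if "e \<in> E" for e
  proof -
    obtain e' where e': "e' \<in> cat_edges c" "e = f ` e'" using \<open>e \<in> E\<close> by (auto simp: E_def)
    then show ?thesis using sub[OF e'(1)] im card_image[OF inj_on_subset[OF inj]] by auto
  qed
  then have s: "simple_graph {..<n} E" by (simp add: simple_graph_def)
  have "{u, v} \<in> cat_edges c \<longleftrightarrow> {f u, f v} \<in> E" if "u \<in> cat_verts c" "v \<in> cat_verts c" for u v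
  proof
    assume "{f u, f v} \<in> E"
    then obtain e' where e': "e' \<in> cat_edges c" "f ` {u, v} = f ` e'" by (auto simp: E_def)
    then have "{u, v} = e'" using inj_on_image_eq_iff[OF inj, of "{u, v}" e'] that sub[OF e'(1)] by auto
    then show "{u, v} \<in> cat_edges c" using e' by simp
  next
    assume "{u, v} \<in> cat_edges c"
    then have "f ` {u, v} \<in> E" unfolding E_def by blast
    then show "{f u, f v} \<in> E" by simp
  qed
  then have iso: "graph_iso f (cat_verts c) (cat_edges c) {..<n} E" using f by (auto simp: graph_iso_def)
  then have "linear_tree {..<n} E" using graph_iso_linear_tree[OF _ s linear_tree_cat[OF assms(1)]] by blast
  then have "E \<in> code_class n c"
    using iso unfolding code_class_def labelled_linear_trees_def graph_isomorphic_iff by blast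
  then show ?thesis by blast
qed

lemma code_class_cong:
  assumes "graph_isomorphic (cat_verts c) (cat_edges c) (cat_verts d) (cat_edges d)"
  shows "code_class n c = code_class n d"
  using graph_isomorphic_trans[OF assms] graph_isomorphic_trans[OF graph_isomorphic_sym[OF assms]]
  by (auto simp: code_class_def)

lemma code_class_rev: "code_class n (rev c) = code_class n c"
proof -
  have "graph_isomorphic (cat_verts c) (cat_edges c) (cat_verts (rev c)) (cat_edges (rev c))"
    using graph_iso_rev graph_isomorphic_iff by blast
  then show ?thesis by (rule code_class_cong[symmetric])
qed

lemma sorted_map_sort: "\<forall>b\<in>set c. sorted b \<Longrightarrow> map sort c = (c :: nat list list)"
  by (simp add: map_idI sorted_sort_id)

lemma code_class_eq_imp:
  assumes c: "c \<in> codes n" and d: "d \<in> codes n" and eq: "code_class n c = code_class n d"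
  shows "c = d \<or> c = rev d"
proof -
  have pc: "proper c" "weight c = n" "map sort c = c" and pd: "proper d" "map sort d = d"
    using c d sorted_map_sort by (auto simp: codes_def)
  then have "c \<noteq> []" by (auto simp: proper_def)
  then obtain E where "E \<in> code_class n c" "E \<in> code_class n d"
    using code_class_nonempty pc(2) eq by blast
  then have "graph_isomorphic (cat_verts c) (cat_edges c) (cat_verts d) (cat_edges d)"
    using graph_isomorphic_trans graph_isomorphic_sym unfolding code_class_def by blast
  then show ?thesis using cat_isomorphic_imp[OF pc(1) pd(1)] pc(3) pd(2) by simp
qed

lemma length_le_weight: "length c \<le> weight c"
  by (induction c) auto

lemma member_le_weight: "b \<in> set c \<Longrightarrow> sum_list b < weight c"
  by (induction c) auto

lemma finite_codes_aux: "finite {c. (\<forall>b\<in>set c. 0 \<notin> set b) \<and> weight c = n}"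
proof (rule finite_subset)
  let ?B = "{b. set b \<subseteq> {..n} \<and> length b \<le> n}"
  show "{c. (\<forall>b\<in>set c. 0 \<notin> set b) \<and> weight c = n} \<subseteq> {c. set c \<subseteq> ?B \<and> length c \<le> n}"
  proof (clarsimp, intro conjI subsetI)
    fix c b assume c: "\<forall>b\<in>set c. 0 \<notin> set b" "n = weight c"
    show "length c \<le> weight c" by (rule length_le_weight)
    assume b: "b \<in> set c"
    show "b \<in> {b. set b \<subseteq> {..weight c} \<and> length b \<le> weight c}"
      using member_le_weight[OF b] length_le_sum_list[of b] c b member_le_sum_list[of _ b] by fastforce
  qed
  show "finite {c. set c \<subseteq> ?B \<and> length c \<le> n}"
    by (intro finite_lists_length_le) simp
qed

lemma finite_codes: "finite (codes n)"
  by (rule finite_subset[OF _ finite_codes_aux[of n]]) (auto simp: codes_def proper_def)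

text \<open>Codes with a single spine vertex are taken in only as an upper bound; repetitions among
  them are harmless, as their number is negligible.\<close>

lemma quotient_subset:
  "labelled_linear_trees n // linear_tree_iso n \<subseteq>
    code_class n ` codes n \<union> code_class n ` (\<lambda>b. [b]) ` partitions_of (n - 1)"
proof
  fix X assume "X \<in> labelled_linear_trees n // linear_tree_iso n"
  then obtain E where E: "E \<in> labelled_linear_trees n" "X = linear_tree_iso n `` {E}" by (auto simp: quotient_def)
  then have "linear_tree {..<n} E" by (simp add: labelled_linear_trees_def)
  then obtain c where c: "graph_isomorphic (cat_verts c) (cat_edges c) {..<n} E" "\<forall>b\<in>set c. 0 \<notin> set b"
    "length c = 1 \<or> proper c" by (rule linear_tree_code)
  define d where "d = map sort c"
  have cd: "graph_isomorphic (cat_verts d) (cat_edges d) {..<n} E"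
    using graph_isomorphic_trans[OF graph_isomorphic_sym[OF graph_isomorphic_sort] c(1)] by (simp add: d_def)
  then have X: "X = code_class n d" using E linear_tree_iso_Image[of E n d] by (auto simp: code_class_def)
  have "weight d = n"
    using cd bij_betw_same_card by (force simp: graph_isomorphic_def card_cat_verts[symmetric])
  have d: "\<forall>b\<in>set d. 0 \<notin> set b \<and> sorted b" using c(2) by (auto simp: d_def)
  from c(3) show "X \<in> code_class n ` codes n \<union> code_class n ` (\<lambda>b. [b]) ` partitions_of (n - 1)"
  proof
    assume "length c = 1"
    then obtain b where b: "d = [b]" by (auto simp: d_def length_Suc_conv)
    then have "b \<in> partitions_of (n - 1)" using d \<open>weight d = n\<close> by (auto simp: partitions_of_def)
    then show ?thesis using X b by blast
  next
    assume p: "proper c"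
    then have "c \<noteq> []" by (auto simp: proper_def)
    then have "proper d" using p by (auto simp: proper_def d_def hd_map last_map)
    then have "d \<in> codes n" using d \<open>weight d = n\<close> by (auto simp: codes_def)
    then show ?thesis using X by blast
  qed
qed

lemma quotient_supset: "code_class n ` codes n \<subseteq> labelled_linear_trees n // linear_tree_iso n"
proof
  fix X assume "X \<in> code_class n ` codes n"
  then obtain c where c: "X = code_class n c" "c \<in> codes n" by blast
  then have "c \<noteq> []" "weight c = n" by (auto simp: codes_def proper_def)
  then obtain E where E: "E \<in> code_class n c" using code_class_nonempty by blast
  then have "X = linear_tree_iso n `` {E}" using linear_tree_iso_Image c by simp
  then show "X \<in> labelled_linear_trees n // linear_tree_iso n"
    using E by (auto simp: code_class_def quotient_def)
qed

definition palindromes :: "nat \<Rightarrow> nat list list set" where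
  "palindromes n = {c \<in> codes n. rev c = c}"

text \<open>A class determines its code up to reversal, so at most two codes share a class.\<close>

lemma card_code_classes_ge: "card (codes n) \<le> 2 * card (code_class n ` codes n)"
proof -
  let ?F = "\<lambda>X. {c \<in> codes n. code_class n c = X}"
  have "codes n = (\<Union>X\<in>code_class n ` codes n. ?F X)" by auto
  then have "card (codes n) = card (\<Union>X\<in>code_class n ` codes n. ?F X)" by (rule arg_cong)
  also have "\<dots> \<le> (\<Sum>X\<in>code_class n ` codes n. card (?F X))"
    by (rule card_UN_le) (simp add: finite_codes)
  also have "\<dots> \<le> (\<Sum>X\<in>code_class n ` codes n. 2)"
  proof (rule sum_mono)
    fix X assume "X \<in> code_class n ` codes n"
    then obtain c where c: "c \<in> codes n" "X = code_class n c" by blast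
    have "?F X \<subseteq> {c, rev c}" using code_class_eq_imp[OF _ c(1)] c(2) by auto
    then have "card (?F X) \<le> card {c, rev c}" by (intro card_mono) auto
    also have "\<dots> \<le> 2" by (simp add: card_insert_if)
    finally show "card (?F X) \<le> 2" .
  qed
  finally show ?thesis by simp
qed

lemma rev_in_codes: "c \<in> codes n \<Longrightarrow> rev c \<in> codes n"
  by (simp add: codes_def proper_rev)

text \<open>Each class of a non-palindrome accounts for two codes. Palindromes give at most one
  class each; doubling counts them once more, hence the extra term.\<close>

lemma card_code_classes_le: "2 * card (code_class n ` codes n) \<le> card (codes n) + card (palindromes n)"
proof -
  let ?N = "codes n - palindromes n"
  let ?F = "\<lambda>X. {c \<in> ?N. code_class n c = X}"
  have fin: "finite ?N" "finite (palindromes n)" using finite_codes by (auto simp: palindromes_def)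
  have dec: "codes n = palindromes n \<union> ?N" by (auto simp: palindromes_def)
  have "2 * card (code_class n ` ?N) = (\<Sum>X\<in>code_class n ` ?N. 2)" by simp
  also have "\<dots> \<le> (\<Sum>X\<in>code_class n ` ?N. card (?F X))"
  proof (rule sum_mono)
    fix X assume "X \<in> code_class n ` ?N"
    then obtain c where c: "c \<in> ?N" "X = code_class n c" by blast
    have "{c, rev c} \<subseteq> ?F X"
      using c rev_in_codes[of c n] by (auto simp: code_class_rev palindromes_def)
    then have "card {c, rev c} \<le> card (?F X)" using fin by (intro card_mono) auto
    moreover have "card {c, rev c} = 2" using c by (auto simp: palindromes_def card_insert_if)
    ultimately show "2 \<le> card (?F X)" by simp
  qed
  also have "\<dots> = card (\<Union>X\<in>code_class n ` ?N. ?F X)"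
    using fin by (intro card_UN_disjoint[symmetric]) auto
  also have "(\<Union>X\<in>code_class n ` ?N. ?F X) = ?N" by auto
  finally have 1: "2 * card (code_class n ` ?N) \<le> card ?N" .
  have "code_class n ` codes n = code_class n ` palindromes n \<union> code_class n ` ?N"
    using dec by blast
  then have "card (code_class n ` codes n) \<le> card (code_class n ` palindromes n) + card (code_class n ` ?N)"
    using card_Un_le[of "code_class n ` palindromes n" "code_class n ` ?N"] by simp
  moreover have "card (code_class n ` palindromes n) \<le> card (palindromes n)" using fin by (intro card_image_le)
  moreover have "card (codes n) = card (palindromes n) + card ?N"
    using card_Un_disjoint[OF fin(2,1)] dec by (metis Diff_disjoint)
  ultimately show ?thesis using 1 by linarith
qed

theorem num_linear_trees_bounds:
  "card (codes n) \<le> 2 * num_linear_trees n"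
  "2 * num_linear_trees n \<le> card (codes n) + card (palindromes n) + 2 * card (partitions_of (n - 1))"
proof -
  have fin: "finite (code_class n ` codes n)" "finite (code_class n ` (\<lambda>b. [b]) ` partitions_of (n - 1))"
    using finite_codes finite_partitions_of by auto
  have "card (code_class n ` codes n) \<le> num_linear_trees n"
    unfolding num_linear_trees_def using quotient_supset finite_subset[OF quotient_subset] fin
    by (intro card_mono) auto
  then show "card (codes n) \<le> 2 * num_linear_trees n" using card_code_classes_ge[of n] by linarith
  have "num_linear_trees n \<le> card (code_class n ` codes n \<union> code_class n ` (\<lambda>b. [b]) ` partitions_of (n - 1))"
    unfolding num_linear_trees_def using fin by (intro card_mono[OF _ quotient_subset]) auto
  also have "\<dots> \<le> card (code_class n ` codes n) + card (code_class n ` (\<lambda>b. [b]) ` partitions_of (n - 1))"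
    by (rule card_Un_le)
  also have "card (code_class n ` (\<lambda>b. [b]) ` partitions_of (n - 1)) \<le> card (partitions_of (n - 1))"
    using finite_partitions_of card_image_le le_trans finite_imageI by metis
  finally show "2 * num_linear_trees n \<le> card (codes n) + card (palindromes n) + 2 * card (partitions_of (n - 1))"
    using card_code_classes_le[of n] by linarith
qed

section \<open>Asymptotics\<close>

lemma card_convolution:
  fixes s :: "'a \<Rightarrow> nat" and t :: "'b \<Rightarrow> nat" and f :: "'a \<Rightarrow> 'b \<Rightarrow> 'c"
  assumes A: "\<And>k. finite {a \<in> A. s a = k}" and B: "\<And>k. finite {b \<in> B. t b = k}"
    and inj: "\<And>a b a' b'. f a b = f a' b' \<Longrightarrow> a = a' \<and> b = b'"
  shows "card {f a b | a b. a \<in> A \<and> b \<in> B \<and> s a + t b = n} =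
    (\<Sum>k\<le>n. card {a \<in> A. s a = k} * card {b \<in> B. t b = n - k})"
proof -
  let ?P = "\<lambda>k. {a \<in> A. s a = k} \<times> {b \<in> B. t b = n - k}"
  have "(a, b) \<in> (\<Union>k\<le>n. ?P k) \<longleftrightarrow> a \<in> A \<and> b \<in> B \<and> s a + t b = n" for a b by auto
  then have "(\<Union>k\<le>n. ?P k) = {(a, b). a \<in> A \<and> b \<in> B \<and> s a + t b = n}" by blast
  then have "{f a b | a b. a \<in> A \<and> b \<in> B \<and> s a + t b = n} = (\<lambda>(a, b). f a b) ` (\<Union>k\<le>n. ?P k)"
    by auto
  moreover have "inj_on (\<lambda>(a, b). f a b) (\<Union>k\<le>n. ?P k)" using inj by (auto simp: inj_on_def)
  moreover have "card (\<Union>k\<le>n. ?P k) = (\<Sum>k\<le>n. card (?P k))"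
    by (rule card_UN_disjoint) (use A B in auto)
  ultimately show ?thesis by (simp add: card_image card_cartesian_product)
qed

definition is_partition :: "nat list \<Rightarrow> bool" where
  "is_partition b \<longleftrightarrow> sorted b \<and> 0 \<notin> set b"

text \<open>Sequences of partitions with no condition on the ends; counted by \<open>weight\<close>
  they have the generating function 1 / (1 - x P(x)).\<close>

definition partition_lists :: "nat list list set" where
  "partition_lists = {c. \<forall>b\<in>set c. is_partition b}"

lemma partition_lists_simps [simp]:
  "[] \<in> partition_lists" "b # c \<in> partition_lists \<longleftrightarrow> is_partition b \<and> c \<in> partition_lists"
  "c @ d \<in> partition_lists \<longleftrightarrow> c \<in> partition_lists \<and> d \<in> partition_lists" "rev c \<in> partition_lists \<longleftrightarrow> c \<in> partition_lists"
  by (auto simp: partition_lists_def)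

lemma finite_partition_lists: "finite {c \<in> partition_lists. weight c = n}"
  by (rule finite_subset[OF _ finite_codes_aux[of n]]) (auto simp: partition_lists_def is_partition_def)

lemma partitions_of_eq: "{b. is_partition b \<and> Suc (sum_list b) = k} = (if k = 0 then {} else partitions_of (k - 1))"
  by (auto simp: is_partition_def partitions_of_def)

text \<open>Splitting off the first partition gives the renewal equation; \<open>k = 0\<close>
  contributes nothing because the spine vertex itself counts 1.\<close>

lemma card_partition_lists_rec:
  assumes "n > 0"
  shows "card {c \<in> partition_lists. weight c = n} =
    (\<Sum>k\<le>n. (if k = 0 then 0 else card (partitions_of (k - 1))) * card {c \<in> partition_lists. weight c = n - k})"
proof -
  have "{c \<in> partition_lists. weight c = n} =
      {b # c | b c. b \<in> Collect is_partition \<and> c \<in> partition_lists \<and> Suc (sum_list b) + weight c = n}"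
  proof -
    have "c \<in> {c \<in> partition_lists. weight c = n} \<longleftrightarrow>
      c \<in> {b # c | b c. b \<in> Collect is_partition \<and> c \<in> partition_lists \<and> Suc (sum_list b) + weight c = n}" for c
      using assms by (cases c) auto
    then show ?thesis by blast
  qed
  also have "card \<dots> = (\<Sum>k\<le>n. card {b \<in> Collect is_partition. Suc (sum_list b) = k} * card {c \<in> partition_lists. weight c = n - k})"
    by (rule card_convolution) (auto simp: partitions_of_eq finite_partitions_of finite_partition_lists)
  finally show ?thesis by (simp add: partitions_of_eq if_distrib cong: if_cong)
qed

text \<open>The coefficients of x Q(x): admissible partitions at an end, with the spine vertex
  included in the weight.\<close>

definition end_count :: "nat \<Rightarrow> nat" where
  "end_count k = card {b. (is_partition b \<and> 2 \<le> length b) \<and> Suc (sum_list b) = k}"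

lemma finite_end: "finite {b. (is_partition b \<and> 2 \<le> length b) \<and> Suc (sum_list b) = k}"
  by (rule finite_subset[OF _ finite_partitions_of[of "k - 1"]]) (auto simp: is_partition_def partitions_of_def)

text \<open>Only the last partition is constrained, so that the two end factors are attached in two
  separate convolutions.\<close>

definition open_codes :: "nat list list set" where
  "open_codes = {c \<in> partition_lists. c \<noteq> [] \<and> 2 \<le> length (last c)}"

lemma finite_open_codes: "finite {c \<in> open_codes. weight c = n}"
  by (rule finite_subset[OF _ finite_partition_lists[of n]]) (auto simp: open_codes_def)

lemma card_open_codes:
  "card {c \<in> open_codes. weight c = n} = (\<Sum>k\<le>n. end_count k * card {c \<in> partition_lists. weight c = n - k})"
proof -
  have "{c \<in> open_codes. weight c = n} =
      {c @ [b] | b c. b \<in> {b. is_partition b \<and> 2 \<le> length b} \<and> c \<in> partition_lists \<and> Suc (sum_list b) + weight c = n}"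
  proof -
    have "c \<in> {c \<in> open_codes. weight c = n} \<longleftrightarrow>
      c \<in> {c @ [b] | b c. b \<in> {b. is_partition b \<and> 2 \<le> length b} \<and> c \<in> partition_lists \<and> Suc (sum_list b) + weight c = n}" for c
      by (cases c rule: rev_cases) (auto simp: open_codes_def)
    then show ?thesis by blast
  qed
  also have "card \<dots> = (\<Sum>k\<le>n. card {b \<in> {b. is_partition b \<and> 2 \<le> length b}. Suc (sum_list b) = k} * card {c \<in> partition_lists. weight c = n - k})"
    by (rule card_convolution) (use finite_end finite_partition_lists in auto)
  finally show ?thesis by (simp add: end_count_def)
qed

lemma card_codes:
  "card (codes n) = (\<Sum>k\<le>n. end_count k * card {c \<in> open_codes. weight c = n - k})"
proof -
  have "codes n =
      {b # c | b c. b \<in> {b. is_partition b \<and> 2 \<le> length b} \<and> c \<in> open_codes \<and> Suc (sum_list b) + weight c = n}"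
  proof -
    have "c \<in> codes n \<longleftrightarrow>
      c \<in> {b # c | b c. b \<in> {b. is_partition b \<and> 2 \<le> length b} \<and> c \<in> open_codes \<and> Suc (sum_list b) + weight c = n}" for c
      by (cases c; cases "tl c = []")
        (auto simp: open_codes_def codes_def proper_def partition_lists_def is_partition_def Suc_le_eq)
    then show ?thesis by blast
  qed
  also have "card \<dots> = (\<Sum>k\<le>n. card {b \<in> {b. is_partition b \<and> 2 \<le> length b}. Suc (sum_list b) = k} * card {c \<in> open_codes. weight c = n - k})"
    by (rule card_convolution) (use finite_end finite_open_codes in auto)
  finally show ?thesis by (simp add: end_count_def)
qed

text \<open>Exactly one partition of \<open>m\<close> has fewer than two parts: the empty one if
  \<open>m = 0\<close>, otherwise \<open>[m]\<close>. This is the subtracted series 1 / (1 -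
  x).\<close>

lemma end_count_eq: "end_count k = (if k = 0 then 0 else card (partitions_of (k - 1)) - 1)"
proof (cases k)
  case (Suc m)
  let ?s = "if m = 0 then [] else [m]"
  have "b \<in> partitions_of m \<longleftrightarrow> b = ?s \<or> (is_partition b \<and> 2 \<le> length b) \<and> sum_list b = m" for b
  proof (cases "2 \<le> length b")
    case False
    then consider "b = []" | x where "b = [x]" by (cases b; cases "tl b") auto
    then show ?thesis by cases (auto simp: partitions_of_def is_partition_def)
  qed (auto simp: partitions_of_def is_partition_def)
  then have "b \<in> partitions_of m \<longleftrightarrow> b \<in> insert ?s {b. (is_partition b \<and> 2 \<le> length b) \<and> Suc (sum_list b) = k}" for b
    unfolding Suc insert_iff mem_Collect_eq nat.inject .
  then have "partitions_of m = insert ?s {b. (is_partition b \<and> 2 \<le> length b) \<and> Suc (sum_list b) = k}"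
    by blast
  moreover have "?s \<notin> {b. (is_partition b \<and> 2 \<le> length b) \<and> Suc (sum_list b) = k}" by auto
  ultimately have "card (partitions_of m) = Suc (end_count k)"
    using finite_end by (simp add: end_count_def)
  then show ?thesis using Suc by simp
qed (simp add: end_count_def)

lemma card_partitions_of_pos: "0 < card (partitions_of n)"
proof -
  have "(if n = 0 then [] else [n]) \<in> partitions_of n" by (auto simp: partitions_of_def)
  then show ?thesis using finite_partitions_of by (metis card_gt_0_iff empty_iff)
qed

section \<open>Limits of the scaled counts\<close>

lemma x0_props: "0 < x0" "x0 < 1"
  using x0_bounds by auto

lemma end_count_sums: "(\<lambda>k. end_count k * x0 ^ k) sums (x0 * (partition_gf x0 - 1 / (1 - x0)))"
proof -
  have "(\<lambda>n. x0 * (card (partitions_of n) * x0 ^ n - x0 ^ n)) sums (x0 * (partition_gf x0 - 1 / (1 - x0)))"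
    using x0_props by (intro sums_mult sums_diff partition_gf_sums geometric_sums) auto
  moreover have "x0 * (card (partitions_of n) * x0 ^ n - x0 ^ n) = end_count (Suc n) * x0 ^ Suc n" for n
    using card_partitions_of_pos[of n] by (simp add: end_count_eq of_nat_diff Suc_le_eq algebra_simps)
  ultimately have "(\<lambda>n. end_count (Suc n) * x0 ^ Suc n) sums (x0 * (partition_gf x0 - 1 / (1 - x0)))" by simp
  from sums_Suc[OF this] show ?thesis by (simp add: end_count_eq)
qed

definition mean_weight :: real where
  "mean_weight = x0 * (partition_gf x0 + x0 * deriv partition_gf x0)"

lemma scale_convolution:
  fixes a b :: "nat \<Rightarrow> nat" and x :: real
  shows "real (\<Sum>k\<le>n. a k * b (n - k)) * x ^ n = (\<Sum>k\<le>n. (a k * x ^ k) * (b (n - k) * x ^ (n - k)))"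
proof -
  have "x ^ n = x ^ k * x ^ (n - k)" if "k \<le> n" for k using that by (simp add: power_add[symmetric])
  then show ?thesis unfolding of_nat_sum sum_distrib_right by (intro sum.cong) simp_all
qed

text \<open>\<open>q\<close> is a probability distribution since x0 P(x0) = 1, and the scaled counts
  are its renewal sequence. The uniform bound 1 is kept for the estimate of palindromes.\<close>

lemma partition_lists_asymptotics:
  shows "(\<lambda>n. card {c \<in> partition_lists. weight c = n} * x0 ^ n) \<longlonglongrightarrow> 1 / mean_weight"
    and "card {c \<in> partition_lists. weight c = n} * x0 ^ n \<le> 1"
proof -
  define q where "q k = (if k = 0 then 0 else card (partitions_of (k - 1)) * x0 ^ k)" for k
  define u where "u n = card {c \<in> partition_lists. weight c = n} * x0 ^ n" for n
  have "(\<lambda>n. x0 * (card (partitions_of n) * x0 ^ n)) sums (x0 * partition_gf x0)"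
    using x0_props by (intro sums_mult partition_gf_sums) auto
  then have "(\<lambda>n. q (Suc n)) sums 1" by (simp add: x0_eq q_def mult_ac)
  then have "q sums (1 + q 0)" by (rule sums_Suc)
  moreover have "q 0 = 0" by (simp add: q_def)
  ultimately have q1: "q sums 1" by simp
  have "(\<lambda>n. real n * q n) sums mean_weight"
    using mean_sums[OF x0_props] by (simp add: q_def mean_weight_def if_distrib cong: if_cong)
  moreover have "u n = (\<Sum>k\<le>n. q k * u (n - k))" if "n > 0" for n
    unfolding u_def card_partition_lists_rec[OF that]
      scale_convolution[where b = "\<lambda>m. card {c \<in> partition_lists. weight c = m}"] by (intro sum.cong) (auto simp: q_def)
  moreover have "u 0 = 1"
  proof -
    have "{c \<in> partition_lists. weight c = 0} = {[]}" using length_le_weight by (auto simp: partition_lists_def) (metis length_0_conv le_zero_eq)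
    then show ?thesis by (simp add: u_def)
  qed
  \<comment> \<open>This weight comes from the empty partition, a spine vertex without
    branches.\<close>
  moreover have "q 1 > 0" using card_partitions_of_pos[of 0] x0_props by (simp add: q_def)
  moreover have "q n \<ge> 0" "q 0 = 0" for n using x0_props by (auto simp: q_def)
  ultimately have "u \<longlonglongrightarrow> 1 / mean_weight" "u n \<le> 1" for n using renewal[of q mean_weight u] q1 by auto
  then show "(\<lambda>n. card {c \<in> partition_lists. weight c = n} * x0 ^ n) \<longlonglongrightarrow> 1 / mean_weight"
    "card {c \<in> partition_lists. weight c = n} * x0 ^ n \<le> 1" by (auto simp: u_def[abs_def])
qed

text \<open>Each of the two convolutions with the summable end sequence multiplies the limit by its
  sum x0 Q(x0).\<close>

lemma codes_asymptotics:
  "(\<lambda>n. card (codes n) * x0 ^ n) \<longlonglongrightarrow> (x0 * (partition_gf x0 - 1 / (1 - x0))) ^ 2 / mean_weight"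
proof -
  let ?W = "x0 * (partition_gf x0 - 1 / (1 - x0))"
  have nn: "0 \<le> end_count k * x0 ^ k" for k using x0_props by simp
  have "(\<lambda>n. card {c \<in> open_codes. weight c = n} * x0 ^ n) \<longlonglongrightarrow> ?W * (1 / mean_weight)"
    unfolding card_open_codes scale_convolution[where b = "\<lambda>m. card {c \<in> partition_lists. weight c = m}"]
    by (rule convolution_tendsto[OF nn end_count_sums partition_lists_asymptotics(1)])
  then have "(\<lambda>n. card (codes n) * x0 ^ n) \<longlonglongrightarrow> ?W * (?W * (1 / mean_weight))"
    unfolding card_codes scale_convolution[where b = "\<lambda>m. card {c \<in> open_codes. weight c = m}"]
    by (rule convolution_tendsto[OF nn end_count_sums])
  then show ?thesis by (simp add: power2_eq_square)
qed

section \<open>Palindromic codes are negligible\<close>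

lemma palindrome_decomposition:
  assumes "rev c = c"
  obtains h m where "c = h @ m @ rev h" "length m \<le> 1"
proof -
  define k where "k = length c div 2"
  define h where "h = take k c"
  define m where "m = take (length c - 2 * k) (drop k c)"
  have "rev h = drop (length c - k) c" unfolding h_def using assms by (metis rev_take)
  moreover have "drop (length c - 2 * k) (drop k c) = drop (length c - k) c"
    by (simp add: k_def)
  ultimately have "c = h @ m @ rev h" unfolding h_def m_def by (metis append_take_drop_id)
  moreover have "length m \<le> 1" by (simp add: m_def k_def)
  ultimately show ?thesis by (rule that)
qed

lemma partition_count_bound:
  fixes y :: real
  assumes "0 < y" "y < 1"
  shows "card (partitions_of n) * y ^ n \<le> partition_gf y"
proof -
  have "(\<Sum>k\<in>{n}. card (partitions_of k) * y ^ k) \<le> partition_gf y"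
    unfolding partition_gf_series(2)[OF less_imp_le[OF assms(1)] assms(2)]
    by (rule sum_le_suminf[OF partition_gf_series(1)]) (use assms in auto)
  then show ?thesis by simp
qed

text \<open>These are the possible middles of a palindrome: the empty list or a single partition, at
  most one more than there are partitions of \<open>n - 1\<close>.\<close>

lemma short_lists_bound:
  fixes y :: real
  assumes y: "0 < y" "y < 1"
  shows "card {c \<in> partition_lists. length c \<le> 1 \<and> weight c = n} * y ^ n \<le> 2 * partition_gf y"
proof -
  have "c \<in> insert [] ((\<lambda>b. [b]) ` partitions_of (n - 1))" if "c \<in> partition_lists" "length c \<le> 1" "weight c = n" for c
    using that by (cases c) (auto simp: is_partition_def partitions_of_def)
  then have "{c \<in> partition_lists. length c \<le> 1 \<and> weight c = n} \<subseteq> insert [] ((\<lambda>b. [b]) ` partitions_of (n - 1))" by auto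
  then have "card {c \<in> partition_lists. length c \<le> 1 \<and> weight c = n} \<le> card (insert [] ((\<lambda>b. [b]) ` partitions_of (n - 1)))"
    by (intro card_mono) (simp_all add: finite_partitions_of)
  also have "\<dots> \<le> Suc (card (partitions_of (n - 1)))"
    using card_insert_le_m1[of "Suc (card (partitions_of (n - 1)))" "(\<lambda>b. [b]) ` partitions_of (n - 1)" "[]"]
    by (simp add: card_image_le finite_partitions_of)
  finally have "real (card {c \<in> partition_lists. length c \<le> 1 \<and> weight c = n}) * y ^ n \<le> (1 + card (partitions_of (n - 1))) * y ^ n"
    using y by (intro mult_right_mono) auto
  also have "\<dots> = y ^ n + card (partitions_of (n - 1)) * y ^ n" by (simp add: algebra_simps)
  also have "\<dots> \<le> partition_gf y + partition_gf y"
  proof (rule add_mono)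
    have "y ^ n \<le> 1" using y by (simp add: power_le_one)
    also have "1 \<le> partition_gf y" using y by (intro partition_gf_ge_1) auto
    finally show "y ^ n \<le> partition_gf y" .
    have "card (partitions_of (n - 1)) * y ^ n \<le> card (partitions_of (n - 1)) * y ^ (n - 1)"
      using y by (intro mult_left_mono power_decreasing) auto
    also have "\<dots> \<le> partition_gf y" by (rule partition_count_bound[OF y])
    finally show "card (partitions_of (n - 1)) * y ^ n \<le> partition_gf y" .
  qed
  finally show ?thesis by simp
qed

text \<open>A palindrome is a half \<open>h\<close> of weight \<open>k\<close>, a short middle and
  the mirrored half. Scaling by \<open>sqrt x0\<close> gives both halves together the factor
  \<open>x0 ^ k\<close>, so the renewal bound applies to \<open>h\<close>; the linear factor bounds
  the number of values of \<open>k\<close>.\<close>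

lemma palindromes_bound:
  "card (palindromes n) * sqrt x0 ^ n \<le> (real n + 1) * (2 * partition_gf (sqrt x0))"
proof -
  define y where "y = sqrt x0"
  have y: "0 < y" "y < 1" "y ^ 2 = x0" using x0_props by (auto simp: y_def)
  let ?H = "\<lambda>k. {c \<in> partition_lists. weight c = k}" and ?M = "\<lambda>k. {c \<in> partition_lists. length c \<le> 1 \<and> weight c = k}"
  let ?K = "{k. 2 * k \<le> n}"
  have K: "finite ?K" "card ?K \<le> n + 1"
  proof -
    have "?K \<subseteq> {..n}" by auto
    then show "finite ?K" "card ?K \<le> n + 1" using finite_subset card_mono[of "{..n}" ?K] by auto
  qed
  have M: "finite (?M k)" for k by (rule finite_subset[OF _ finite_partition_lists[of k]]) auto
  have "palindromes n \<subseteq> (\<Union>k\<in>?K. (\<lambda>(h, m). h @ m @ rev h) ` (?H k \<times> ?M (n - 2 * k)))"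
  proof
    fix c assume c: "c \<in> palindromes n"
    then have "rev c = c" "c \<in> partition_lists" "weight c = n"
      by (auto simp: palindromes_def codes_def proper_def partition_lists_def is_partition_def)
    moreover then obtain h m where "c = h @ m @ rev h" "length m \<le> 1" by (meson palindrome_decomposition)
    ultimately show "c \<in> (\<Union>k\<in>?K. (\<lambda>(h, m). h @ m @ rev h) ` (?H k \<times> ?M (n - 2 * k)))"
      by (intro UN_I[of "weight h"] image_eqI[of _ _ "(h, m)"]) auto
  qed
  then have "card (palindromes n) \<le> card (\<Union>k\<in>?K. (\<lambda>(h, m). h @ m @ rev h) ` (?H k \<times> ?M (n - 2 * k)))"
    using K M finite_partition_lists by (intro card_mono) auto
  also have "\<dots> \<le> (\<Sum>k\<in>?K. card ((\<lambda>(h, m). h @ m @ rev h) ` (?H k \<times> ?M (n - 2 * k))))"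
    by (rule card_UN_le[OF K(1)])
  also have "\<dots> \<le> (\<Sum>k\<in>?K. card (?H k \<times> ?M (n - 2 * k)))"
    using M finite_partition_lists by (intro sum_mono card_image_le) auto
  also have "\<dots> = (\<Sum>k\<in>?K. card (?H k) * card (?M (n - 2 * k)))" by (simp add: card_cartesian_product)
  finally have "real (card (palindromes n)) * y ^ n \<le> real (\<Sum>k\<in>?K. card (?H k) * card (?M (n - 2 * k))) * y ^ n"
    using y by (intro mult_right_mono) (auto simp del: of_nat_sum)
  also have "\<dots> = (\<Sum>k\<in>?K. (card (?H k) * x0 ^ k) * (card (?M (n - 2 * k)) * y ^ (n - 2 * k)))"
    unfolding of_nat_sum sum_distrib_right
  proof (rule sum.cong[OF refl])
    fix k assume "k \<in> ?K"
    then have "y ^ n = (y ^ 2) ^ k * y ^ (n - 2 * k)" by (simp add: power_mult[symmetric] power_add[symmetric])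
    then show "real (card (?H k) * card (?M (n - 2 * k))) * y ^ n = (card (?H k) * x0 ^ k) * (card (?M (n - 2 * k)) * y ^ (n - 2 * k))"
      by (simp add: y(3))
  qed
  also have "\<dots> \<le> (\<Sum>k\<in>?K. 1 * (2 * partition_gf y))"
  proof (rule sum_mono, rule mult_mono)
    fix k
    show "card (?H k) * x0 ^ k \<le> 1" by (rule partition_lists_asymptotics(2))
    show "card (?M (n - 2 * k)) * y ^ (n - 2 * k) \<le> 2 * partition_gf y" by (rule short_lists_bound[OF y(1,2)])
  qed (use y in auto)
  also have "\<dots> = card ?K * (2 * partition_gf y)" by simp
  also have "\<dots> \<le> (real n + 1) * (2 * partition_gf y)"
    using K(2) partition_gf_ge_1[of y] y by (intro mult_right_mono) auto
  finally show ?thesis by (simp add: y_def)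
qed

lemma n_power_tendsto_0:
  fixes y :: real
  assumes "0 \<le> y" "y < 1"
  shows "(\<lambda>n. (real n + 1) * y ^ n) \<longlonglongrightarrow> 0"
proof -
  have "(\<lambda>n. real n * y ^ n + y ^ n) \<longlonglongrightarrow> 0 + 0"
    using assms by (intro tendsto_add powser_times_n_limit_0 LIMSEQ_power_zero) auto
  then show ?thesis by (simp add: algebra_simps)
qed

text \<open>One factor \<open>sqrt x0 ^ n\<close> is spent on bounding the palindromes; the other
  remains and beats the linear growth.\<close>

lemma palindromes_tendsto_0: "(\<lambda>n. card (palindromes n) * x0 ^ n) \<longlonglongrightarrow> 0"
proof -
  define y where "y = sqrt x0"
  have y: "0 < y" "y < 1" "y ^ 2 = x0" using x0_props by (auto simp: y_def)
  have "(\<lambda>n. (2 * partition_gf y) * ((real n + 1) * y ^ n)) \<longlonglongrightarrow> (2 * partition_gf y) * 0"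
    using y by (intro tendsto_intros n_power_tendsto_0) auto
  then have lim: "(\<lambda>n. (2 * partition_gf y) * ((real n + 1) * y ^ n)) \<longlonglongrightarrow> 0" by simp
  have "norm (card (palindromes n) * x0 ^ n) \<le> (2 * partition_gf y) * ((real n + 1) * y ^ n)" for n
  proof -
    have "x0 ^ n = y ^ n * y ^ n" unfolding y(3)[symmetric] by (simp add: power2_eq_square power_mult_distrib)
    then have "card (palindromes n) * x0 ^ n = (card (palindromes n) * y ^ n) * y ^ n" by simp
    also have "\<dots> \<le> ((real n + 1) * (2 * partition_gf y)) * y ^ n"
      using palindromes_bound y by (intro mult_right_mono) (auto simp: y_def)
    finally show ?thesis using x0_props by (simp add: mult_ac)
  qed
  then show ?thesis by (intro Lim_null_comparison[OF always_eventually lim] allI)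
qed

lemma partitions_tendsto_0: "(\<lambda>n. card (partitions_of (n - 1)) * x0 ^ n) \<longlonglongrightarrow> 0"
proof (rule LIMSEQ_imp_Suc)
  have "(\<lambda>n. card (partitions_of n) * x0 ^ n) \<longlonglongrightarrow> 0"
    using x0_props by (intro summable_LIMSEQ_zero partition_gf_series) auto
  then have "(\<lambda>n. x0 * (card (partitions_of n) * x0 ^ n)) \<longlonglongrightarrow> x0 * 0" by (intro tendsto_intros)
  then show "(\<lambda>n. card (partitions_of (Suc n - 1)) * x0 ^ Suc n) \<longlonglongrightarrow> 0" by (simp add: mult_ac)
qed

text \<open>Twice the number of trees lies between the number of codes and that number plus two
  error terms, from palindromes and from single spine vertices, whose scaled values vanish.\<close>

theorem num_linear_trees_tendsto:
  "(\<lambda>n. num_linear_trees n * x0 ^ n) \<longlonglongrightarrow>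
    1 / 2 * (partition_gf x0 - 1 / (1 - x0)) ^ 2 * (x0 / (partition_gf x0 + x0 * deriv partition_gf x0))"
proof -
  let ?L = "(x0 * (partition_gf x0 - 1 / (1 - x0))) ^ 2 / mean_weight"
  have "(\<lambda>n. 2 * (num_linear_trees n * x0 ^ n)) \<longlonglongrightarrow> ?L"
  proof (rule tendsto_sandwich[OF _ _ codes_asymptotics])
    show "\<forall>\<^sub>F n in sequentially. card (codes n) * x0 ^ n \<le> 2 * (num_linear_trees n * x0 ^ n)"
    proof (intro always_eventually allI)
      fix n
      have "real (card (codes n)) \<le> real (2 * num_linear_trees n)" using num_linear_trees_bounds(1)[of n] by simp
      from mult_right_mono[OF this, of "x0 ^ n"] show "card (codes n) * x0 ^ n \<le> 2 * (num_linear_trees n * x0 ^ n)"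
        using x0_props by simp
    qed
    show "\<forall>\<^sub>F n in sequentially. 2 * (num_linear_trees n * x0 ^ n) \<le>
      card (codes n) * x0 ^ n + card (palindromes n) * x0 ^ n + 2 * (card (partitions_of (n - 1)) * x0 ^ n)"
    proof (intro always_eventually allI)
      fix n
      have "real (2 * num_linear_trees n) \<le> real (card (codes n) + card (palindromes n) + 2 * card (partitions_of (n - 1)))"
        using num_linear_trees_bounds(2)[of n] by (simp only: of_nat_le_iff)
      from mult_right_mono[OF this, of "x0 ^ n"]
      show "2 * (num_linear_trees n * x0 ^ n) \<le>
        card (codes n) * x0 ^ n + card (palindromes n) * x0 ^ n + 2 * (card (partitions_of (n - 1)) * x0 ^ n)"
        using x0_props by (simp add: algebra_simps)
    qed
    have "(\<lambda>n. card (codes n) * x0 ^ n + card (palindromes n) * x0 ^ n + 2 * (card (partitions_of (n - 1)) * x0 ^ n))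
      \<longlonglongrightarrow> ?L + 0 + 2 * 0"
      by (intro tendsto_intros codes_asymptotics palindromes_tendsto_0 partitions_tendsto_0)
    then show "(\<lambda>n. card (codes n) * x0 ^ n + card (palindromes n) * x0 ^ n + 2 * (card (partitions_of (n - 1)) * x0 ^ n))
      \<longlonglongrightarrow> ?L" by simp
  qed
  then have "(\<lambda>n. 1 / 2 * (2 * (num_linear_trees n * x0 ^ n))) \<longlonglongrightarrow> 1 / 2 * ?L" by (intro tendsto_intros)
  \<comment> \<open>One \<open>x0\<close> of the squared end factor cancels against the
    \<open>x0\<close> in \<open>mean_weight\<close>.\<close>
  moreover have "1 / 2 * ?L = 1 / 2 * (partition_gf x0 - 1 / (1 - x0)) ^ 2 * (x0 / (partition_gf x0 + x0 * deriv partition_gf x0))"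
    using x0_props by (simp add: mean_weight_def power2_eq_square)
  ultimately show ?thesis by simp
qed

theorem theorem2:
  shows "(\<exists>!x::real. 0 < x \<and> x < 1 \<and> x * partition_gf x = 1) \<and>
    0.4196 \<le> x0 \<and> x0 < 0.4197 \<and>
    (\<lambda>n. real (num_linear_trees n)) \<sim>[at_top]
      (\<lambda>n. 1 / 2 * (partition_gf x0 - 1 / (1 - x0)) ^ 2 *
        (x0 / (partition_gf x0 + x0 * deriv partition_gf x0)) * (1 / x0) ^ n) \<and>
    \<bar>1 / 2 * (partition_gf x0 - 1 / (1 - x0)) ^ 2 *
        (x0 / (partition_gf x0 + x0 * deriv partition_gf x0)) - 0.0145\<bar> \<le> 0.00005 \<and>
    \<bar>1 / x0 - 2.3832\<bar> \<le> 0.00005"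
proof -
  define K where "K = 1 / 2 * (partition_gf x0 - 1 / (1 - x0)) ^ 2 *
        (x0 / (partition_gf x0 + x0 * deriv partition_gf x0))"
  have "\<bar>K - 0.0145\<bar> \<le> 0.00005" using leading_constant_value by (simp only: K_def)
  \<comment> \<open>The numerical enclosure also supplies that the constant is nonzero, as the
    division below requires.\<close>
  then have K: "K \<noteq> 0" by auto
  have "(\<lambda>n. num_linear_trees n * x0 ^ n) \<longlonglongrightarrow> K"
    using num_linear_trees_tendsto by (simp only: K_def)
  then have "(\<lambda>n. num_linear_trees n * x0 ^ n / K) \<longlonglongrightarrow> K / K"
    using K by (intro tendsto_divide tendsto_const)
  then have "(\<lambda>n. num_linear_trees n / (K * (1 / x0) ^ n)) \<longlonglongrightarrow> 1"
    using K x0_props by (simp add: power_one_over field_simps)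
  then have "(\<lambda>n. real (num_linear_trees n)) \<sim>[at_top] (\<lambda>n. K * (1 / x0) ^ n)"
    by (rule asymp_equivI')
  moreover have "0.4196 \<le> x0" "x0 < 0.4197" using x0_bounds by simp_all
  ultimately show ?thesis
    using x0_ex1 growth_rate_value leading_constant_value unfolding K_def by blast
qed

end
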